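(* Let $\mathbb{K}$ be a field and let $B=B_1\cdots B_s$, where $B_1,\dots,B_s$ are sets of monomials in $\mathbb{K}[x_1,\dots,x_n]$, each of which is a basis with the strong exchange property. Then: (1) the toric ideal $\mathcal{J}_B$ of $B$ is generated by symmetric exchange relations; and (2) $\mathbb{K}[B]\cong \big(\mathbb{K}[B_1]\circ\cdots\circ\mathbb{K}[B_s]\big)/L$, where $\circ$ denotes the Segre product and $L$ is generated by binomials of degree one.
   Context: Notation: $\deg_i(x_1^{\alpha_1}\cdots x_n^{\alpha_n})=\alpha_i$. The product of sets of monomials is $B_1\cdots B_s=\{b_1\cdots b_s \mid b_j\in B_j\}$. A set $B$ of monomials in $\mathbb{K}[x_1,\dots,x_n]$ is called a basis with the strong exchange property (SEP) if all the monomials in $B$ are of the same degree and, whenever $f,g\in B$ and $\deg_i f>\deg_i g$ and $\deg_j f<\deg_j g$ for some $i$ and $j$, then $\frac{x_j}{x_i}f\in B$. For a set $B=\{f_1,\dots,f_m\}$ of monomials of the same degree, $\mathbb{K}[B]$ is the subring of $\mathbb{K}[x_1,\dots,x_n]$ generated over $\mathbb{K}$ by the monomials in $B$, graded so that each element of $B$ has degree $1$. Let $Y=\{y_1,\dots,y_m\}$ and define the homomorphism $\varphi:\mathbb{K}[Y]\to\mathbb{K}[x_1,\dots,x_n]$ by $\varphi(y_r)=f_r$. The toric ideal of $B$ is $\mathcal{J}_B=\ker\varphi$. A symmetric exchange relation is a binomial $y_ry_s-y_ty_u\in\mathbb{K}[Y]$ for which there are $i$ and $j$ such that $\deg_i\varphi(y_r)>\deg_i\varphi(y_s)$,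 $\deg_j\varphi(y_r)<\deg_j\varphi(y_s)$, $\varphi(y_t)=\frac{x_j}{x_i}\varphi(y_r)$ and $\varphi(y_u)=\frac{x_i}{x_j}\varphi(y_s)$. The Segre product of graded $\mathbb{K}$-algebras $R=\bigoplus_{i\ge0}R_i$ and $S=\bigoplus_{i\ge0}S_i$ is $R\circ S=\bigoplus_{i\ge0}R_i\otimes_{\mathbb{K}}S_i$. A binomial of degree one in $\mathbb{K}[B_1]\circ\cdots\circ\mathbb{K}[B_s]$ is a difference $f_1\otimes\cdots\otimes f_s-g_1\otimes\cdots\otimes g_s$ with $f_j,g_j\in B_j$; the set of generators of $L$ may be empty.
   Formalization: The case B = {1} is excluded: there K[B] = K has no grading with 1 in degree one, and the toric ideal (y − 1) is not generated by symmetric exchange relations, as there are none. *)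

theory Defs
  imports "HOL-Library.Poly_Mapping" "HOL-Algebra.QuotRing" "HOL-Algebra.Generated_Rings"
begin

section \<open>Monomials and polynomials\<close>

text \<open>
  A monomial \<open>x\<^sup>\<alpha>\<close> is represented by its exponent vector \<open>\<alpha>\<close>. Hence \<open>deg\<^sub>i\<close> is
  \<open>Poly_Mapping.lookup \<alpha> i\<close>, the monomial \<open>1\<close> is \<open>0\<close>, and products of monomials are sums.
  With this encoding the ring multiplication of \<^theory>\<open>HOL-Library.Poly_Mapping\<close> on
  \<open>('v, 'k) mpoly\<close> is the multiplication of polynomials.
\<close>

type_synonym 'v monom = "'v \<Rightarrow>\<^sub>0 nat"
type_synonym ('v, 'k) mpoly = "'v monom \<Rightarrow>\<^sub>0 'k"

definition mono_deg :: "'v monom \<Rightarrow> nat" where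
  "mono_deg f = (\<Sum>i\<in>Poly_Mapping.keys f. Poly_Mapping.lookup f i)"

text \<open>\<open>exchange i j f\<close> is \<open>(x\<^sub>j / x\<^sub>i) f\<close>; it is only used when \<open>x\<^sub>i\<close> divides \<open>f\<close>.\<close>

definition exchange :: "'v \<Rightarrow> 'v \<Rightarrow> 'v monom \<Rightarrow> 'v monom" where
  "exchange i j f = f + Poly_Mapping.single j 1 - Poly_Mapping.single i 1"

definition exchangeable :: "'v \<Rightarrow> 'v \<Rightarrow> 'v monom \<Rightarrow> 'v monom \<Rightarrow> bool" where
  "exchangeable i j f g \<longleftrightarrow>
     Poly_Mapping.lookup f i > Poly_Mapping.lookup g i \<and>
     Poly_Mapping.lookup f j < Poly_Mapping.lookup g j"

definition SEP_basis :: "'v monom set \<Rightarrow> bool" where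
  "SEP_basis B \<longleftrightarrow>
     (\<forall>f\<in>B. \<forall>g\<in>B. mono_deg f = mono_deg g) \<and>
     (\<forall>f\<in>B. \<forall>g\<in>B. \<forall>i j. exchangeable i j f g \<longrightarrow> exchange i j f \<in> B)"

text \<open>The product set \<open>\<Prod>\<^sub>j B\<^sub>j\<close>, \<open>j \<in> J\<close>, of monomials.\<close>

definition mono_prod :: "'s set \<Rightarrow> ('s \<Rightarrow> 'v monom set) \<Rightarrow> 'v monom set" where
  "mono_prod J B = {\<Sum>j\<in>J. b j | b. \<forall>j\<in>J. b j \<in> B j}"

definition monomial :: "'v monom \<Rightarrow> ('v, 'k::comm_ring_1) mpoly" where
  "monomial f = Poly_Mapping.single f 1"

definition smul :: "'k::comm_ring_1 \<Rightarrow> ('a \<Rightarrow>\<^sub>0 'k) \<Rightarrow> ('a \<Rightarrow>\<^sub>0 'k)" where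
  "smul c p = Poly_Mapping.map (times c) p"

text \<open>
  Algebras over the field given by a type \<open>'k\<close> are records of type \<open>('k, _) module\<close> of
  HOL-Algebra. The subalgebra with carrier \<open>S\<close> of a polynomial ring:
\<close>

definition alg_on :: "('v, 'k::comm_ring_1) mpoly set \<Rightarrow> ('k, ('v, 'k) mpoly) module" where
  "alg_on S = \<lparr>carrier = S, mult = times, one = 1, zero = 0, add = plus, smult = smul\<rparr>"

text \<open>The polynomial ring in the variables from \<open>V\<close>.\<close>

definition poly_alg :: "'v set \<Rightarrow> ('k::comm_ring_1, ('v, 'k) mpoly) module" where
  "poly_alg V = alg_on {p. \<forall>m\<in>Poly_Mapping.keys p. Poly_Mapping.keys m \<subseteq> V}"


section \<open>The toric ideal\<close>

text \<open>
  The variables of \<open>K[Y]\<close> are indexed by the elements of \<open>B\<close> themselves, so that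
  \<open>K[Y]\<close> is \<open>poly_alg B\<close>, with \<open>yvar f\<close> the variable mapped to \<open>f\<close>.

  The set \<open>B = {1}\<close>, encoded as \<open>{0}\<close>, has to be excluded in applications: its algebra
  \<open>K\<close> has no grading with \<open>1\<close> in degree one, and its toric ideal is generated by \<open>y - 1\<close>.
\<close>

definition yvar :: "'v monom \<Rightarrow> ('v monom, 'k::comm_ring_1) mpoly" where
  "yvar f = monomial (Poly_Mapping.single f 1)"

definition toric_map :: "('v monom, 'k::comm_ring_1) mpoly \<Rightarrow> ('v, 'k) mpoly" where
  "toric_map p = (\<Sum>m\<in>Poly_Mapping.keys p. smul (Poly_Mapping.lookup p m)
     (\<Prod>f\<in>Poly_Mapping.keys m. monomial f ^ Poly_Mapping.lookup m f))"

definition toric_ideal :: "'v monom set \<Rightarrow> ('v monom, 'k::comm_ring_1) mpoly set" where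
  "toric_ideal B = a_kernel (poly_alg B) (poly_alg UNIV :: ('k, ('v, 'k) mpoly) module) toric_map"

definition sym_exchange_relations :: "'v monom set \<Rightarrow> ('v monom, 'k::comm_ring_1) mpoly set" where
  "sym_exchange_relations B =
     {yvar r * yvar s - yvar t * yvar u | r s t u.
        r \<in> B \<and> s \<in> B \<and> t \<in> B \<and> u \<in> B \<and>
        (\<exists>i j. exchangeable i j r s \<and> t = exchange i j r \<and> u = exchange j i s)}"


section \<open>The graded algebra generated by a set of monomials\<close>

definition mono_alg :: "'v monom set \<Rightarrow> ('k::comm_ring_1, ('v, 'k) mpoly) module" where
  "mono_alg B =
     alg_on (generate_ring (poly_alg UNIV :: ('k, ('v, 'k) mpoly) module)
       (range (Poly_Mapping.single 0) \<union> monomial ` B))"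

text \<open>
  Every element of \<open>B\<close> has degree \<open>1\<close>: the component of degree \<open>i\<close> is the linear span of
  the products of \<open>i\<close> elements of \<open>B\<close>. (This is a grading of \<open>mono_alg B\<close> if \<open>B\<close> consists
  of monomials of one and the same positive degree.)
\<close>

definition mono_alg_comp :: "'v monom set \<Rightarrow> nat \<Rightarrow> ('v, 'k::comm_ring_1) mpoly set" where
  "mono_alg_comp B i = Modules.module.span smul (monomial ` mono_prod {..<i} (\<lambda>_. B))"


section \<open>Quotients and isomorphisms of graded algebras\<close>

definition quot_alg :: "('k, 'a) module \<Rightarrow> 'a set \<Rightarrow> ('k, 'a set) module" where
  "quot_alg A I = ring.extend (A Quot I)
     (module.fields (\<lambda>c X. \<Union>x\<in>X. I +>\<^bsub>A\<^esub> (c \<odot>\<^bsub>A\<^esub> x)))"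

definition quot_comp :: "('k, 'a) module \<Rightarrow> 'a set \<Rightarrow> (nat \<Rightarrow> 'a set) \<Rightarrow> nat \<Rightarrow> 'a set set" where
  "quot_comp A I Ac i = (\<lambda>x. I +>\<^bsub>A\<^esub> x) ` Ac i"

definition graded_alg_iso ::
  "('k, 'a) module \<Rightarrow> (nat \<Rightarrow> 'a set) \<Rightarrow> ('k, 'b) module \<Rightarrow> (nat \<Rightarrow> 'b set) \<Rightarrow> ('a \<Rightarrow> 'b) \<Rightarrow> bool" where
  "graded_alg_iso A Ac B Bc h \<longleftrightarrow>
     h \<in> ring_iso A B \<and>
     (\<forall>c. \<forall>x\<in>carrier A. h (c \<odot>\<^bsub>A\<^esub> x) = c \<odot>\<^bsub>B\<^esub> h x) \<and>
     (\<forall>i. h ` Ac i = Bc i)"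


section \<open>Segre products\<close>

text \<open>
  The tensor product \<open>\<Otimes>\<^sub>j V\<^sub>j\<close> of linear subspaces \<open>V\<^sub>j\<close> is \<open>free_tensors V\<close>, the space
  with the tuples in \<open>\<Prod>\<^sub>j V\<^sub>j\<close> as a basis, modulo \<open>null_tensors V\<close>.
\<close>

definition free_tensors :: "('s \<Rightarrow> 'a set) \<Rightarrow> (('s \<Rightarrow> 'a) \<Rightarrow>\<^sub>0 'k::comm_ring_1) set" where
  "free_tensors V = {p. \<forall>r\<in>Poly_Mapping.keys p. \<forall>j. r j \<in> V j}"

definition multilinear_rels ::
  "('s \<Rightarrow> ('m \<Rightarrow>\<^sub>0 'k) set) \<Rightarrow> (('s \<Rightarrow> 'm \<Rightarrow>\<^sub>0 'k) \<Rightarrow>\<^sub>0 'k::comm_ring_1) set" where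
  "multilinear_rels V =
     {Poly_Mapping.single (r(j := a + b)) 1
        - Poly_Mapping.single (r(j := a)) 1 - Poly_Mapping.single (r(j := b)) 1 | r j a b.
        (\<forall>l. r l \<in> V l) \<and> a \<in> V j \<and> b \<in> V j} \<union>
     {Poly_Mapping.single (r(j := smul c a)) 1 - Poly_Mapping.single (r(j := a)) c | r j a c.
        (\<forall>l. r l \<in> V l) \<and> a \<in> V j}"

definition null_tensors ::
  "('s \<Rightarrow> ('m \<Rightarrow>\<^sub>0 'k) set) \<Rightarrow> (('s \<Rightarrow> 'm \<Rightarrow>\<^sub>0 'k) \<Rightarrow>\<^sub>0 'k::comm_ring_1) set" where
  "null_tensors V = Modules.module.span smul (multilinear_rels V)"

text \<open>The bilinear extension of \<open>(\<Otimes>\<^sub>j r\<^sub>j) (\<Otimes>\<^sub>j t\<^sub>j) = \<Otimes>\<^sub>j r\<^sub>j t\<^sub>j\<close>.\<close>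

definition tensor_mult ::
  "(('s \<Rightarrow> 'a) \<Rightarrow>\<^sub>0 'k) \<Rightarrow> (('s \<Rightarrow> 'a) \<Rightarrow>\<^sub>0 'k) \<Rightarrow> (('s \<Rightarrow> 'a::comm_ring_1) \<Rightarrow>\<^sub>0 'k::comm_ring_1)" where
  "tensor_mult p q =
     (\<Sum>r\<in>Poly_Mapping.keys p. \<Sum>t\<in>Poly_Mapping.keys q.
        Poly_Mapping.single (\<lambda>j. r j * t j) (Poly_Mapping.lookup p r * Poly_Mapping.lookup q t))"

text \<open>
  Let \<open>R j i\<close> be the component of degree \<open>i\<close> of the \<open>j\<close>-th graded algebra. The Segre product
  \<open>\<Oplus>\<^sub>i \<Otimes>\<^sub>j R j i\<close> is obtained as the quotient of the direct sum over \<open>i\<close> of the spaces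
  \<open>free_tensors (\<lambda>j. R j i)\<close> by the direct sum of the \<open>null_tensors (\<lambda>j. R j i)\<close>. Elements of
  these direct sums are finitely supported families indexed by the degree.
\<close>

type_synonym ('s, 'm, 'k) tensors = "nat \<Rightarrow>\<^sub>0 (('s \<Rightarrow> 'm \<Rightarrow>\<^sub>0 'k) \<Rightarrow>\<^sub>0 'k)"

definition segre_free ::
  "('s \<Rightarrow> nat \<Rightarrow> ('m::comm_monoid_add \<Rightarrow>\<^sub>0 'k::comm_ring_1) set) \<Rightarrow> ('k, ('s, 'm, 'k) tensors) module" where
  "segre_free R =
     \<lparr>carrier = {P. \<forall>i. Poly_Mapping.lookup P i \<in> free_tensors (\<lambda>j. R j i)},
      mult = (\<lambda>P Q. \<Sum>i\<in>Poly_Mapping.keys P. \<Sum>k\<in>Poly_Mapping.keys Q.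
        Poly_Mapping.single (i + k) (tensor_mult (Poly_Mapping.lookup P i) (Poly_Mapping.lookup Q k))),
      one = Poly_Mapping.single 0 (Poly_Mapping.single (\<lambda>_. 1) 1),
      zero = 0, add = plus, smult = (\<lambda>c. Poly_Mapping.map (smul c))\<rparr>"

definition segre_null ::
  "('s \<Rightarrow> nat \<Rightarrow> ('m \<Rightarrow>\<^sub>0 'k::comm_ring_1) set) \<Rightarrow> ('s, 'm, 'k) tensors set" where
  "segre_null R = {P. \<forall>i. Poly_Mapping.lookup P i \<in> null_tensors (\<lambda>j. R j i)}"

definition segre ::
  "('s \<Rightarrow> nat \<Rightarrow> ('m::comm_monoid_add \<Rightarrow>\<^sub>0 'k::comm_ring_1) set) \<Rightarrow>
   ('k, ('s, 'm, 'k) tensors set) module" where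
  "segre R = quot_alg (segre_free R) (segre_null R)"

definition segre_comp ::
  "('s \<Rightarrow> nat \<Rightarrow> ('m::comm_monoid_add \<Rightarrow>\<^sub>0 'k::comm_ring_1) set) \<Rightarrow> nat \<Rightarrow>
   ('s, 'm, 'k) tensors set set" where
  "segre_comp R = quot_comp (segre_free R) (segre_null R)
     (\<lambda>i. {P \<in> carrier (segre_free R). Poly_Mapping.keys P \<subseteq> {i}})"

text \<open>The class of the pure tensor \<open>\<Otimes>\<^sub>j r\<^sub>j\<close> of degree \<open>i\<close>.\<close>

definition pure_tensor ::
  "('s \<Rightarrow> nat \<Rightarrow> ('m::comm_monoid_add \<Rightarrow>\<^sub>0 'k::comm_ring_1) set) \<Rightarrow> nat \<Rightarrow> ('s \<Rightarrow> 'm \<Rightarrow>\<^sub>0 'k) \<Rightarrow>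
   ('s, 'm, 'k) tensors set" where
  "pure_tensor R i r =
     segre_null R +>\<^bsub>segre_free R\<^esub> Poly_Mapping.single i (Poly_Mapping.single r 1)"

abbreviation mono_comps ::
  "('s \<Rightarrow> 'v monom set) \<Rightarrow> 's \<Rightarrow> nat \<Rightarrow> ('v, 'k::comm_ring_1) mpoly set" where
  "mono_comps B \<equiv> (\<lambda>j. mono_alg_comp (B j))"

definition degree_one_binomials ::
  "('s \<Rightarrow> 'v monom set) \<Rightarrow> ('s, 'v monom, 'k::comm_ring_1) tensors set set" where
  "degree_one_binomials B =
     {pure_tensor (mono_comps B) 1 (\<lambda>j. monomial (f j))
        \<ominus>\<^bsub>segre (mono_comps B)\<^esub> pure_tensor (mono_comps B) 1 (\<lambda>j. monomial (g j)) | f g.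
        \<forall>j. f j \<in> B j \<and> g j \<in> B j}"

end

theory Submission
  imports Defs "HOL-Library.Multiset"
begin

text \<open>
  Both parts say that the kernel of a homomorphism to a polynomial ring is generated by obvious
  elements. The map sends a family of generators (monomials in \<open>Y\<close>, or pure tensors of monomials)
  to monomials, so its kernel is spanned by the differences of two generators with the same image
  (\<open>kernel_of_map_to_monomials\<close>). What remains is combinatorial: two generators with the same image
  have to be joined by a chain of elementary moves, each of which changes the generator by a
  multiple of one of the proposed ideal generators.

  For the toric ideal the generators are multisets of elements of \<open>B\<close>, and two of them with the same
  product have to be joined by symmetric exchanges. The argument follows the one for strongly base
  orderable matroids. A basis with the strong exchange property contains all vectors of its degree
  in the box spanned by two of its elements \<open>f, g\<close> (\<open>SEP_between\<close>). Hence if \<open>f\<close> and \<open>g\<close> are written as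
  \<open>h x\<^sub>p\<^sub>1 ... x\<^sub>p\<^sub>r\<close> and \<open>h x\<^sub>q\<^sub>1 ... x\<^sub>q\<^sub>r\<close> with their greatest common divisor \<open>h\<close>, any
  subset of the pairs \<open>(p\<^sub>k, q\<^sub>k)\<close> may be exchanged simultaneously. This property
  (\<open>strongly_orderable\<close>) passes to products of sets of monomials, simply by concatenating the lists of
  pairs (\<open>strongly_orderable_sum\<close>), and besides the degrees it is all that is used of \<open>B\<close>. Exchanges that
  decrease the sum of the squares of the exponents lead from any multiset to a balanced one, in which the
  exponents of each variable differ by at most one (\<open>exch_conn_balanced\<close>). Two balanced multisets
  with the same product are brought together factor by factor: the pairs that separate two factors
  on the one side and two factors on the other side are the edges of a graph, and an orientation of
  this graph in which every vertex has almost as many incoming as outgoing edges (\<open>balanceable\<close>)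
  tells which of the exchanges to carry out (\<open>balanced_exch_conn\<close>).

  For the Segre product the generators are the pure tensors of monomials \<open>m\<^sub>1, ..., m\<^sub>s\<close>, where
  \<open>m\<^sub>j\<close> is a product of \<open>i\<close> elements of \<open>B\<^sub>j\<close>. If two of them have the same product, then the variables
  of which some \<open>m\<^sub>j\<close> has too many are missing in another component, and following these surpluses
  closes up to a cycle of components (\<open>self_map_cycle\<close>). Exchanging along the cycle affects only one
  of the \<open>i\<close> factors in each component (\<open>SEP_power_exchange\<close>), so the tensor changes by a multiple of
  a binomial of degree one (\<open>tuples_connected\<close>, \<open>mono_tensors_congruent\<close>).
\<close>

(* Keeps the variable x_i in the form single i 1. *)
declare One_nat_def [simp del]

section \<open>Exponent vectors and the strong exchange property\<close>

abbreviation lookup :: "('a \<Rightarrow>\<^sub>0 'b::zero) \<Rightarrow> 'a \<Rightarrow> 'b" where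
  "lookup \<equiv> Poly_Mapping.lookup"

abbreviation single :: "'a \<Rightarrow> 'b \<Rightarrow> ('a \<Rightarrow>\<^sub>0 'b::zero)" where
  "single \<equiv> Poly_Mapping.single"

abbreviation keys :: "('a \<Rightarrow>\<^sub>0 'b::zero) \<Rightarrow> 'a set" where
  "keys \<equiv> Poly_Mapping.keys"

abbreviation dg :: "'v monom \<Rightarrow> 'v \<Rightarrow> nat" where
  "dg \<equiv> lookup"

abbreviation var :: "'v \<Rightarrow> 'v monom" where
  "var i \<equiv> single i 1"

lemma dg_var: "dg (var i) k = (if i = k then 1 else 0)"
  by (simp add: lookup_single when_def)

lemma mono_deg_eq_sum: "mono_deg (f :: 'n::finite monom) = (\<Sum>i\<in>UNIV. dg f i)"
  unfolding mono_deg_def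
  by (rule sum.mono_neutral_left) (auto simp: in_keys_iff)

lemma mono_deg_add: "mono_deg (f + g) = mono_deg f + mono_deg (g :: 'n::finite monom)"
  by (simp add: mono_deg_eq_sum lookup_add sum.distrib)

lemma mono_deg_zero [simp]: "mono_deg 0 = 0"
  by (simp add: mono_deg_def)

lemma mono_deg_sum: "mono_deg (sum f A :: 'n::finite monom) = (\<Sum>x\<in>A. mono_deg (f x))"
  by (induction A rule: infinite_finite_induct) (auto simp: mono_deg_add)

lemma mono_deg_var [simp]: "mono_deg (var i) = 1"
  by (simp add: mono_deg_def)

lemma mono_deg_0_iff: "mono_deg f = 0 \<longleftrightarrow> f = 0"
  by (auto simp: mono_deg_def in_keys_iff intro!: poly_mapping_eqI)

lemma exchange_eqI: "f + var j = g + var i \<Longrightarrow> exchange i j f = g"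
  by (simp add: exchange_def)

lemma exchange_add:
  assumes "dg f i > 0" shows "exchange i j f + var i = f + var j"
  using assms by (intro poly_mapping_eqI) (auto simp: exchange_def lookup_add lookup_minus dg_var)

lemma dg_exchange:
  "dg (exchange i j f) k = dg f k + (if k = j then 1 else 0) - (if k = i then 1 else 0)"
  by (auto simp: exchange_def lookup_add lookup_minus dg_var)

lemma mono_deg_exchange:
  fixes f :: "'n::finite monom"
  assumes "dg f i > 0" shows "mono_deg (exchange i j f) = mono_deg f"
  using arg_cong[OF exchange_add[OF assms, of j], of mono_deg] by (simp add: mono_deg_add)

lemma compensating_variable:
  fixes f g :: "'n::finite monom"
  assumes "mono_deg f = mono_deg g" "dg f i < dg g i"
  obtains j where "dg g j < dg f j"
proof -
  have "\<exists>j. dg g j < dg f j"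
  proof (rule ccontr)
    assume "\<not> ?thesis"
    then have "(\<Sum>i\<in>UNIV. dg f i) < (\<Sum>i\<in>UNIV. dg g i)"
      using assms(2) by (intro sum_strict_mono_ex1) (auto simp: not_less)
    then show False using assms(1) by (simp add: mono_deg_eq_sum)
  qed
  then show thesis using that by blast
qed

lemma SEP_deg: "SEP_basis B \<Longrightarrow> f \<in> B \<Longrightarrow> g \<in> B \<Longrightarrow> mono_deg f = mono_deg g"
  unfolding SEP_basis_def by blast

lemma SEP_exchange:
  "SEP_basis B \<Longrightarrow> f \<in> B \<Longrightarrow> g \<in> B \<Longrightarrow> dg g i < dg f i \<Longrightarrow> dg f j < dg g j \<Longrightarrow> exchange i j f \<in> B"
  unfolding SEP_basis_def exchangeable_def by blast

text \<open>
  Every step of the strong exchange property moves \<open>f\<close> towards \<open>a\<close>, so that a basis contains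
  the whole box, within its degree, that is spanned by two of its elements.
\<close>

lemma SEP_between:
  fixes B :: "'n::finite monom set"
  assumes "SEP_basis B" "f \<in> B" "g \<in> B" "mono_deg a = mono_deg f"
    and "\<And>i. min (dg f i) (dg g i) \<le> dg a i" "\<And>i. dg a i \<le> max (dg f i) (dg g i)"
  shows "a \<in> B"
  using assms(2,4-6)
proof (induction "\<Sum>i\<in>UNIV. dg f i - dg a i" arbitrary: f rule: less_induct)
  case less
  show ?case
  proof (cases "f = a")
    case False
    then obtain k where k: "dg f k \<noteq> dg a k" by (metis poly_mapping_eqI)
    obtain i where i: "dg a i < dg f i"
      using k compensating_variable[of f a k] less.prems(2) by (metis linorder_neqE_nat)
    obtain j where j: "dg f j < dg a j"
      using compensating_variable[of a f i] i less.prems(2) by metis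
    have ij: "i \<noteq> j" using i j by auto
    let ?f = "exchange i j f"
    have gi: "dg g i < dg f i" "dg g i \<le> dg a i" using less.prems(3)[of i] i by linarith+
    have gj: "dg f j < dg g j" "dg a j \<le> dg g j" using less.prems(4)[of j] j by linarith+
    have 1: "?f \<in> B" by (rule SEP_exchange[OF assms(1) less.prems(1) assms(3) gi(1) gj(1)])
    have 2: "(\<Sum>i\<in>UNIV. dg ?f i - dg a i) < (\<Sum>i\<in>UNIV. dg f i - dg a i)"
    proof (rule sum_strict_mono_ex1)
      show "\<forall>k\<in>UNIV. dg ?f k - dg a k \<le> dg f k - dg a k"
      proof
        fix k
        show "dg ?f k - dg a k \<le> dg f k - dg a k"
          using j by (cases "k = j") (simp_all add: dg_exchange diff_le_mono)
      qed
      show "\<exists>k\<in>UNIV. dg ?f k - dg a k < dg f k - dg a k"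
      proof
        show "dg ?f i - dg a i < dg f i - dg a i"
          using i ij by (simp add: dg_exchange)
      qed simp
    qed simp
    have 3: "mono_deg a = mono_deg ?f"
      using less.prems(2) i by (subst mono_deg_exchange) auto
    have 4: "min (dg ?f k) (dg g k) \<le> dg a k" "dg a k \<le> max (dg ?f k) (dg g k)" for k
      using less.prems(3)[of k] less.prems(4)[of k] i j ij gi gj
      unfolding min_le_iff_disj le_max_iff_disj by (auto simp: dg_exchange)
    show ?thesis by (rule less.hyps[OF 2 1 3 4])
  next
    case True
    then show ?thesis using less.prems(1) by simp
  qed
qed

text \<open>
  The two witnesses of an exchange may be different elements: \<open>g\<close> shows that \<open>x\<^sub>p\<close> may be
  lowered, and \<open>g'\<close> shows that \<open>x\<^sub>q\<close> may be raised. Unless \<open>g\<close> is a witness for both, exchanges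
  with \<open>g\<close> lower \<open>x\<^sub>p\<close> in \<open>g'\<close> without touching \<open>x\<^sub>q\<close>, until \<open>g'\<close> is a witness for both.
\<close>

lemma SEP_exchange_two_witnesses:
  fixes B :: "'n::finite monom set"
  assumes "SEP_basis B" "f \<in> B" "g \<in> B" "g' \<in> B"
    and "dg g p < dg f p" "dg f q < dg g' q"
  shows "exchange p q f \<in> B"
  using assms(4,6)
proof (induction "dg g' p" arbitrary: g' rule: less_induct)
  case less
  consider "dg f q < dg g q" | "dg g' p < dg f p" | "dg g q \<le> dg f q" "dg f p \<le> dg g' p"
    by linarith
  then show ?case
  proof cases
    case 3
    have gp: "dg g p < dg g' p" and gq: "dg g q < dg g' q" using 3 assms(5) less.prems(2) by linarith+
    obtain k where k: "dg g' k < dg g k"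
      by (rule compensating_variable[OF SEP_deg[OF assms(1,3) less.prems(1)] gp])
    have kk: "k \<noteq> p" "k \<noteq> q" using k gp gq by auto
    have *: "exchange p k g' \<in> B"
      by (rule SEP_exchange[OF assms(1) less.prems(1) assms(3) gp k])
    show ?thesis
    proof (cases "p = q")
      case True
      then show ?thesis using assms(2) exchange_eqI[of f p f p] by simp
    next
      case False
      show ?thesis
      proof (rule less.hyps[OF _ *])
        show "dg (exchange p k g') p < dg g' p" using kk gp by (simp add: dg_exchange)
        show "dg f q < dg (exchange p k g') q" using kk False less.prems(2) by (simp add: dg_exchange)
      qed
    qed
  next
    case 1
    show ?thesis by (rule SEP_exchange[OF assms(1-3,5) 1])
  next
    case 2
    show ?thesis by (rule SEP_exchange[OF assms(1,2) less.prems(1) 2 less.prems(2)])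
  qed
qed

section \<open>Orientations of edge lists\<close>

text \<open>
  An edge \<open>(p, q)\<close> stands for a factor \<open>x\<^sub>p\<close> of one monomial that may be swapped against a factor
  \<open>x\<^sub>q\<close> of another one. The monomials are \<open>h + srcs es\<close> and \<open>h + tgts es\<close> with a common part \<open>h\<close>, and
  carrying out some of the swaps amounts to reversing some of the edges.
\<close>

definition srcs :: "('v \<times> 'v) list \<Rightarrow> 'v monom" where
  "srcs es = (\<Sum>e\<leftarrow>es. var (fst e))"

definition tgts :: "('v \<times> 'v) list \<Rightarrow> 'v monom" where
  "tgts es = (\<Sum>e\<leftarrow>es. var (snd e))"

definition reorients :: "('v \<times> 'v) list \<Rightarrow> ('v \<times> 'v) list \<Rightarrow> bool" where
  "reorients = list_all2 (\<lambda>e e'. e' = e \<or> e' = prod.swap e)"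

lemma srcs_simps [simp]:
  "srcs [] = 0" "srcs (e # es) = var (fst e) + srcs es" "srcs (es @ es') = srcs es + srcs es'"
  by (simp_all add: srcs_def)

lemma tgts_simps [simp]:
  "tgts [] = 0" "tgts (e # es) = var (snd e) + tgts es" "tgts (es @ es') = tgts es + tgts es'"
  by (simp_all add: tgts_def)

lemma reorients_simps [simp]:
  "reorients [] os \<longleftrightarrow> os = []"
  "reorients (e # es) os \<longleftrightarrow> (\<exists>e' os'. os = e' # os' \<and> (e' = e \<or> e' = prod.swap e) \<and> reorients es os')"
  by (auto simp: reorients_def list_all2_Cons1)

lemma reorients_append:
  "reorients (es @ es') os \<longleftrightarrow> (\<exists>o1 o2. os = o1 @ o2 \<and> reorients es o1 \<and> reorients es' o2)"
  unfolding reorients_def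
proof
  assume "\<exists>o1 o2. os = o1 @ o2 \<and> list_all2 (\<lambda>e e'. e' = e \<or> e' = prod.swap e) es o1 \<and>
    list_all2 (\<lambda>e e'. e' = e \<or> e' = prod.swap e) es' o2"
  then show "list_all2 (\<lambda>e e'. e' = e \<or> e' = prod.swap e) (es @ es') os"
    by (elim exE conjE) (simp add: list_all2_appendI)
qed (auto simp: list_all2_append1)

lemma reorients_refl [simp]: "reorients es es"
  by (induction es) auto

lemma reorients_map_swap: "reorients es os \<Longrightarrow> reorients es (map prod.swap os)"
  by (induction es arbitrary: os) auto

lemma reorients_perm:
  assumes "mset es = mset es'" "reorients es' os'"
  obtains os where "reorients es os" "mset os = mset os'"
  using list_all2_reorder_left_invariance[OF assms(2)[unfolded reorients_def] assms(1)]
  unfolding reorients_def by blast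

lemma srcs_mset: "srcs es = (\<Sum>e\<in>#mset es. var (fst e))"
  by (induction es) auto

lemma tgts_mset: "tgts es = (\<Sum>e\<in>#mset es. var (snd e))"
  by (induction es) auto

lemma srcs_cong: "mset es = mset es' \<Longrightarrow> srcs es = srcs es'"
  by (simp add: srcs_mset)

lemma tgts_cong: "mset es = mset es' \<Longrightarrow> tgts es = tgts es'"
  by (simp add: tgts_mset)

lemma srcs_map_swap [simp]: "srcs (map prod.swap es) = tgts es"
  by (induction es) auto

lemma tgts_map_swap [simp]: "tgts (map prod.swap es) = srcs es"
  by (induction es) auto

lemma dg_srcs: "dg (srcs es) i = count (mset (map fst es)) i"
  by (induction es) (auto simp: lookup_add dg_var)

lemma dg_tgts: "dg (tgts es) i = count (mset (map snd es)) i"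
  by (induction es) (auto simp: lookup_add dg_var)

lemma dg_srcs_0_iff: "dg (srcs es) i = 0 \<longleftrightarrow> i \<notin> fst ` set es"
  by (simp add: dg_srcs count_eq_zero_iff)

lemma dg_tgts_0_iff: "dg (tgts es) i = 0 \<longleftrightarrow> i \<notin> snd ` set es"
  by (simp add: dg_tgts count_eq_zero_iff)

lemma dg_srcs_tgts_reorients:
  "reorients es os \<Longrightarrow> dg (srcs os) i + dg (tgts os) i = dg (srcs es) i + dg (tgts es) i"
proof (induction es arbitrary: os)
  case (Cons e es)
  from Cons.prems obtain e' os' where *: "os = e' # os'" "e' = e \<or> e' = prod.swap e" "reorients es os'"
    by auto
  from *(2) show ?case using Cons.IH[OF *(3)] by (elim disjE) (simp_all add: *(1) lookup_add)
qed simp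

lemma mono_deg_srcs: "mono_deg (srcs es :: 'n::finite monom) = length es"
  by (induction es) (auto simp: mono_deg_add)

lemma length_reorients: "reorients es os \<Longrightarrow> length os = length es"
  unfolding reorients_def by (drule list_all2_lengthD) simp

lemma mset_eq_Cons: "e \<in> set es \<Longrightarrow> \<exists>es'. mset es = mset (e # es')"
  by (rule exI[of _ "remove1 e es"]) simp

section \<open>Contraction\<close>

text \<open>
  Two edges \<open>(b, v)\<close> and \<open>(v, a)\<close> contribute \<open>x\<^sub>v\<close> to both monomials. They can be replaced by one edge
  \<open>(b, a)\<close> when \<open>x\<^sub>v\<close> is moved to the common part. Reversing the new edge means reversing both old
  ones, so nothing new becomes reachable. In the end no variable occurs on both sides.
\<close>

lemma contract_edges:
  "\<exists>h' es'. h' + srcs es' = h + srcs es \<and> h' + tgts es' = h + tgts es \<and>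
     fst ` set es' \<inter> snd ` set es' = {} \<and>
     (\<forall>os'. reorients es' os' \<longrightarrow> (\<exists>os. reorients es os \<and> h + srcs os = h' + srcs os'))"
proof (induction "length es" arbitrary: h es rule: less_induct)
  case less
  have shorter: ?case if *: "length es1 < length es" "h1 + srcs es1 = h + srcs es"
    "h1 + tgts es1 = h + tgts es"
    "\<And>os1. reorients es1 os1 \<Longrightarrow> \<exists>os. reorients es os \<and> h + srcs os = h1 + srcs os1" for h1 es1
  proof -
    obtain h' es' where **: "h' + srcs es' = h1 + srcs es1" "h' + tgts es' = h1 + tgts es1"
       "fst ` set es' \<inter> snd ` set es' = {}"
       "\<forall>os'. reorients es' os' \<longrightarrow> (\<exists>os. reorients es1 os \<and> h1 + srcs os = h' + srcs os')"
      using less.hyps[OF *(1), of h1] by blast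
    show ?thesis
    proof (rule exI[of _ h'], rule exI[of _ es'], intro conjI allI impI)
      fix os' assume "reorients es' os'"
      then obtain os1 where "reorients es1 os1" "h1 + srcs os1 = h' + srcs os'" using **(4) by blast
      then show "\<exists>os. reorients es os \<and> h + srcs os = h' + srcs os'"
        using *(4)[of os1] by simp
    qed (use * ** in auto)
  qed
  show ?case
  proof (cases "fst ` set es \<inter> snd ` set es = {}")
    case True
    then show ?thesis by blast
  next
    case False
    then obtain v where "v \<in> fst ` set es" "v \<in> snd ` set es" by blast
    then obtain a b where ab: "(v, a) \<in> set es" "(b, v) \<in> set es" by force
    show ?thesis
    proof (cases "a = v")
      case True
      then obtain es1 where es1: "mset es = mset ((v, v) # es1)" using mset_eq_Cons[of "(v, v)" es] ab True by auto
      show ?thesis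
      proof (rule shorter[of es1 "h + var v"])
        show "length es1 < length es" using mset_eq_length[OF es1] by simp
        show "h + var v + srcs es1 = h + srcs es" "h + var v + tgts es1 = h + tgts es"
          by (simp_all add: srcs_cong[OF es1] tgts_cong[OF es1] add.assoc)
        fix os1 assume "reorients es1 os1"
        then have "reorients ((v, v) # es1) ((v, v) # os1)" by simp
        then obtain os where "reorients es os" "mset os = mset ((v, v) # os1)"
          using reorients_perm[OF es1] by blast
        then show "\<exists>os. reorients es os \<and> h + srcs os = h + var v + srcs os1"
          using srcs_cong[of os "(v, v) # os1"] by (auto simp: add.assoc)
      qed
    next
      case False
      obtain es0 where es0: "mset es = mset ((v, a) # es0)" using mset_eq_Cons[OF ab(1)] by blast
      have bv: "(b, v) \<in> set es0" using ab(2) False mset_eq_setD[OF es0] by auto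
      obtain es1 where es1: "mset es0 = mset ((b, v) # es1)" using mset_eq_Cons[OF bv] by blast
      have es: "mset es = mset ((v, a) # (b, v) # es1)" using es0 es1 by simp
      show ?thesis
      proof (rule shorter[of "(b, a) # es1" "h + var v"])
        show "length ((b, a) # es1) < length es" using mset_eq_length[OF es] by simp
        show "h + var v + srcs ((b, a) # es1) = h + srcs es" "h + var v + tgts ((b, a) # es1) = h + tgts es"
          by (simp_all add: srcs_cong[OF es] tgts_cong[OF es] add_ac)
        fix os1 assume "reorients ((b, a) # es1) os1"
        then consider os2 where "os1 = (b, a) # os2" "reorients es1 os2"
          | os2 where "os1 = (a, b) # os2" "reorients es1 os2" by auto
        then show "\<exists>os. reorients es os \<and> h + srcs os = h + var v + srcs os1"
        proof cases
          case 1
          then have "reorients ((v, a) # (b, v) # es1) ((v, a) # (b, v) # os2)" by simp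
          then obtain os where "reorients es os" "mset os = mset ((v, a) # (b, v) # os2)"
            using reorients_perm[OF es] by blast
          then show ?thesis using srcs_cong[of os "(v, a) # (b, v) # os2"] 1 by (auto simp: add_ac)
        next
          case 2
          then have "reorients ((v, a) # (b, v) # es1) ((a, v) # (v, b) # os2)" by simp
          then obtain os where "reorients es os" "mset os = mset ((a, v) # (v, b) # os2)"
            using reorients_perm[OF es] by blast
          then show ?thesis using srcs_cong[of os "(a, v) # (v, b) # os2"] 2 by (auto simp: add_ac)
        qed
      qed
    qed
  qed
qed

section \<open>Balanced orientations\<close>

definition balanced_orientation :: "('v \<times> 'v) list \<Rightarrow> bool" where
  "balanced_orientation os \<longleftrightarrow>
     (\<forall>i. dg (srcs os) i \<le> dg (tgts os) i + 1 \<and> dg (tgts os) i \<le> dg (srcs os) i + 1)"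

definition balanceable :: "('v \<times> 'v) list \<Rightarrow> bool" where
  "balanceable es \<longleftrightarrow> (\<exists>os. reorients es os \<and> balanced_orientation os)"

lemma balanceable_perm: "mset es = mset es' \<Longrightarrow> balanceable es' \<Longrightarrow> balanceable es"
proof -
  assume *: "mset es = mset es'" "balanceable es'"
  then obtain os' where os': "reorients es' os'" "balanced_orientation os'"
    unfolding balanceable_def by blast
  obtain os where os: "reorients es os" "mset os = mset os'"
    by (rule reorients_perm[OF *(1) os'(1)])
  have "balanced_orientation os"
    using os'(2) srcs_cong[OF os(2)] tgts_cong[OF os(2)] by (simp add: balanced_orientation_def)
  then show ?thesis using os(1) unfolding balanceable_def by blast
qed

lemma balanceable_swap: "balanceable (prod.swap e # es) \<Longrightarrow> balanceable (e # es)"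
  unfolding balanceable_def reorients_simps swap_swap by blast

text \<open>
  An edge between \<open>a\<close> and \<open>c\<close> may be subdivided at \<open>v\<close>: passing through \<open>v\<close> in the direction of the
  edge adds one incoming and one outgoing edge there.
\<close>

lemma balanceable_expand:
  assumes "balanceable ((a, c) # es)" shows "balanceable ((a, v) # (v, c) # es)"
proof -
  obtain os where os: "reorients ((a, c) # es) os" "balanced_orientation os"
    using assms by (auto simp: balanceable_def)
  from os(1) consider os' where "os = (a, c) # os'" "reorients es os'"
    | os' where "os = (c, a) # os'" "reorients es os'" by auto
  then show ?thesis
  proof cases
    case 1
    have "balanced_orientation ((a, v) # (v, c) # os')"
      using os(2) 1 by (simp add: balanced_orientation_def lookup_add add_ac)
    moreover have "reorients ((a, v) # (v, c) # es) ((a, v) # (v, c) # os')" using 1(2) by simp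
    ultimately show ?thesis unfolding balanceable_def by blast
  next
    case 2
    have "balanced_orientation ((v, a) # (c, v) # os')"
      using os(2) 2 by (simp add: balanced_orientation_def lookup_add add_ac)
    moreover have "reorients ((a, v) # (v, c) # es) ((v, a) # (c, v) # os')" using 2(2) by simp
    ultimately show ?thesis unfolding balanceable_def by blast
  qed
qed

text \<open>
  If an endpoint of the first edge lies on another edge, the two are merged into one, which is
  expanded again after the shorter list has been oriented. Otherwise the first edge is the only
  one at its endpoints, and its direction does not matter.
\<close>

lemma balanceable: "balanceable es"
proof (induction "length es" arbitrary: es rule: less_induct)
  case less
  show ?case
  proof (cases es)
    case Nil
    then show ?thesis by (simp add: balanceable_def balanced_orientation_def)
  next
    case (Cons e0 rest)
    obtain a b where e0: "e0 = (a, b)" by fastforce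
    have shared: "balanceable ((x, v) # rest)"
      if v: "v \<in> fst ` set rest \<union> snd ` set rest" and e0': "e0 = (x, v) \<or> e0 = (v, x)" for x v
    proof -
      obtain w where "(v, w) \<in> set rest \<or> (w, v) \<in> set rest" using v by force
      then obtain r where r: "mset rest = mset ((v, w) # r) \<or> mset rest = mset ((w, v) # r)"
        using mset_eq_Cons[of "(v, w)" rest] mset_eq_Cons[of "(w, v)" rest] by blast
      then have "length rest = Suc (length r)" unfolding size_mset[symmetric] by (elim disjE) simp_all
      then have "balanceable ((x, w) # r)" using less.hyps[of "(x, w) # r"] Cons by simp
      then have 1: "balanceable ((x, v) # (v, w) # r)" by (rule balanceable_expand)
      have "balanceable ((v, w) # (x, v) # r)"
        by (rule balanceable_perm[OF _ 1]) simp
      then have "balanceable ((w, v) # (x, v) # r)" using balanceable_swap[of "(w, v)"] by simp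
      then have 2: "balanceable ((x, v) # (w, v) # r)"
        by (rule balanceable_perm[rotated]) simp
      from r show ?thesis
      proof
        assume "mset rest = mset ((v, w) # r)"
        then show ?thesis by (intro balanceable_perm[OF _ 1]) simp
      next
        assume "mset rest = mset ((w, v) # r)"
        then show ?thesis by (intro balanceable_perm[OF _ 2]) simp
      qed
    qed
    let ?V = "fst ` set rest \<union> snd ` set rest"
    consider "b \<in> ?V" | "a \<in> ?V" | "a \<notin> ?V" "b \<notin> ?V" by blast
    then show ?thesis
    proof cases
      case 1
      then show ?thesis using shared[of b a] e0 Cons by simp
    next
      case 2
      then have "balanceable ((b, a) # rest)" using shared[of a b] e0 by simp
      then show ?thesis using balanceable_swap[of "(a, b)" rest] e0 Cons by simp
    next
      case 3
      obtain os where os: "reorients rest os" "balanced_orientation os"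
        using less.hyps[of rest] Cons by (auto simp: balanceable_def)
      have ab0: "dg (srcs os) a = 0" "dg (tgts os) a = 0" "dg (srcs os) b = 0" "dg (tgts os) b = 0"
        using dg_srcs_tgts_reorients[OF os(1), of a] dg_srcs_tgts_reorients[OF os(1), of b] 3
          dg_srcs_0_iff[of rest a] dg_tgts_0_iff[of rest a] dg_srcs_0_iff[of rest b] dg_tgts_0_iff[of rest b]
        by auto
      have "balanced_orientation ((a, b) # os)"
        unfolding balanced_orientation_def
      proof
        fix i
        show "dg (srcs ((a, b) # os)) i \<le> dg (tgts ((a, b) # os)) i + 1 \<and>
          dg (tgts ((a, b) # os)) i \<le> dg (srcs ((a, b) # os)) i + 1"
          using os(2)[unfolded balanced_orientation_def, rule_format, of i] ab0
          by (cases "i = a"; cases "i = b") (simp_all add: lookup_add dg_var)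
      qed
      moreover have "reorients es ((a, b) # os)" using os(1) Cons e0 by simp
      ultimately show ?thesis unfolding balanceable_def by blast
    qed
  qed
qed

section \<open>Strong orderability\<close>

text \<open>
  The analogue for sets of monomials of strongly base orderable matroids: two elements are joined
  by edges any subset of which may be swapped.
\<close>

definition strongly_orderable :: "'v monom set \<Rightarrow> bool" where
  "strongly_orderable B \<longleftrightarrow> (\<forall>f\<in>B. \<forall>g\<in>B. \<exists>h es.
     f = h + srcs es \<and> g = h + tgts es \<and> (\<forall>os. reorients es os \<longrightarrow> h + srcs os \<in> B))"

text \<open>
  The edges match the factors that \<open>f\<close> has in excess of \<open>g\<close> with those that \<open>g\<close> has in excess of \<open>f\<close>,
  in any order.
\<close>

lemma edges_between:
  fixes f g :: "'n::finite monom"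
  assumes "mono_deg f = mono_deg g"
  shows "\<exists>h es. f = h + srcs es \<and> g = h + tgts es \<and> (\<forall>i. dg h i = min (dg f i) (dg g i))"
  using assms
proof (induction "mono_deg f" arbitrary: f g rule: less_induct)
  case less
  show ?case
  proof (cases "f = g")
    case True
    then show ?thesis by (intro exI[of _ f] exI[of _ "[]"]) simp
  next
    case False
    then obtain k where k: "dg f k \<noteq> dg g k" by (metis poly_mapping_eqI)
    obtain i where i: "dg g i < dg f i"
      using k compensating_variable[OF less.prems, of k] by (metis linorder_neqE_nat)
    obtain j where j: "dg f j < dg g j"
      by (rule compensating_variable[OF less.prems[symmetric] i])
    define f0 g0 where "f0 = f - var i" and "g0 = g - var j"
    have f: "f = f0 + var i"
      unfolding f0_def using i by (intro poly_mapping_eqI) (auto simp: lookup_add lookup_minus dg_var)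
    have g: "g = g0 + var j"
      unfolding g0_def using j by (intro poly_mapping_eqI) (auto simp: lookup_add lookup_minus dg_var)
    have "mono_deg f0 < mono_deg f" "mono_deg f0 = mono_deg g0"
      using less.prems unfolding f g by (simp_all add: mono_deg_add)
    then obtain h es where h: "f0 = h + srcs es" "g0 = h + tgts es" "\<And>i. dg h i = min (dg f0 i) (dg g0 i)"
      using less.hyps[of f0 g0] by blast
    have "dg h k = min (dg f k) (dg g k)" for k
      using h(3)[of k] i j unfolding f g by (cases "k = i"; cases "k = j") (auto simp: lookup_add dg_var)
    then show ?thesis
      by (intro exI[of _ h] exI[of _ "(i, j) # es"]) (simp add: f g h(1,2) add_ac)
  qed
qed

text \<open>
  Swapping edges does not leave the box spanned by \<open>f\<close> and \<open>g\<close>.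
\<close>

lemma SEP_strongly_orderable:
  fixes B :: "'n::finite monom set"
  assumes "SEP_basis B" shows "strongly_orderable B"
  unfolding strongly_orderable_def
proof (intro ballI)
  fix f g assume fg: "f \<in> B" "g \<in> B"
  obtain h es where h: "f = h + srcs es" "g = h + tgts es" "\<And>i. dg h i = min (dg f i) (dg g i)"
    using edges_between[OF SEP_deg[OF assms fg]] by blast
  have "h + srcs os \<in> B" if os: "reorients es os" for os
  proof (rule SEP_between[OF assms fg])
    show "mono_deg (h + srcs os) = mono_deg f"
      by (simp add: h mono_deg_add mono_deg_srcs length_reorients[OF os])
    fix i
    show "min (dg f i) (dg g i) \<le> dg (h + srcs os) i"
      using h(3)[of i] by (simp add: lookup_add)
    show "dg (h + srcs os) i \<le> max (dg f i) (dg g i)"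
      using h(3)[of i] dg_srcs_tgts_reorients[OF os, of i] by (simp add: h(1,2) lookup_add)
  qed
  then show "\<exists>h es. f = h + srcs es \<and> g = h + tgts es \<and> (\<forall>os. reorients es os \<longrightarrow> h + srcs os \<in> B)"
    using h(1,2) by blast
qed

lemma strongly_orderable_sum:
  assumes "strongly_orderable B" "strongly_orderable C"
  shows "strongly_orderable {b + c | b c. b \<in> B \<and> c \<in> C}"
  unfolding strongly_orderable_def
proof (intro ballI)
  fix f g assume "f \<in> {b + c | b c. b \<in> B \<and> c \<in> C}" "g \<in> {b + c | b c. b \<in> B \<and> c \<in> C}"
  then obtain b c b' c' where *: "f = b + c" "g = b' + c'" "b \<in> B" "c \<in> C" "b' \<in> B" "c' \<in> C" by blast
  obtain h es where h: "b = h + srcs es" "b' = h + tgts es" "\<And>os. reorients es os \<Longrightarrow> h + srcs os \<in> B"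
    using assms(1) *(3,5) unfolding strongly_orderable_def by blast
  obtain k ds where k: "c = k + srcs ds" "c' = k + tgts ds" "\<And>os. reorients ds os \<Longrightarrow> k + srcs os \<in> C"
    using assms(2) *(4,6) unfolding strongly_orderable_def by blast
  have "(h + k) + srcs os \<in> {b + c | b c. b \<in> B \<and> c \<in> C}" if "reorients (es @ ds) os" for os
  proof -
    obtain o1 o2 where o12: "os = o1 @ o2" "reorients es o1" "reorients ds o2"
      using \<open>reorients (es @ ds) os\<close> unfolding reorients_append by blast
    have "(h + k) + srcs os = (h + srcs o1) + (k + srcs o2)" by (simp add: o12(1) add_ac)
    then show ?thesis using h(3)[OF o12(2)] k(3)[OF o12(3)] by blast
  qed
  then show "\<exists>h es. f = h + srcs es \<and> g = h + tgts es \<and>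
    (\<forall>os. reorients es os \<longrightarrow> h + srcs os \<in> {b + c | b c. b \<in> B \<and> c \<in> C})"
    by (intro exI[of _ "h + k"] exI[of _ "es @ ds"]) (simp add: *(1,2) h(1,2) k(1,2) add_ac)
qed

lemma mono_prod_empty: "mono_prod {} B = {0}"
  by (auto simp: mono_prod_def)

lemma mono_prod_insert:
  assumes "finite J" "j \<notin> J"
  shows "mono_prod (insert j J) B = {b + c | b c. b \<in> B j \<and> c \<in> mono_prod J B}"
proof (intro equalityI subsetI)
  fix f assume "f \<in> mono_prod (insert j J) B"
  then obtain b where "f = sum b (insert j J)" "\<forall>l\<in>insert j J. b l \<in> B l"
    unfolding mono_prod_def by blast
  then have "f = b j + sum b J" "b j \<in> B j" "sum b J \<in> mono_prod J B"
    using assms unfolding mono_prod_def by auto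
  then show "f \<in> {b + c | b c. b \<in> B j \<and> c \<in> mono_prod J B}" by blast
next
  fix f assume "f \<in> {b + c | b c. b \<in> B j \<and> c \<in> mono_prod J B}"
  then obtain a b where *: "f = a + sum b J" "a \<in> B j" "\<forall>l\<in>J. b l \<in> B l"
    unfolding mono_prod_def by blast
  have "f = sum (b(j := a)) (insert j J)"
  proof -
    have "sum (b(j := a)) J = sum b J" using assms(2) by (intro sum.cong) auto
    then show ?thesis using assms *(1) by simp
  qed
  moreover have "\<forall>l\<in>insert j J. (b(j := a)) l \<in> B l" using * by auto
  ultimately show "f \<in> mono_prod (insert j J) B" unfolding mono_prod_def by blast
qed

lemma strongly_orderable_mono_prod:
  assumes "finite J" "\<And>j. j \<in> J \<Longrightarrow> strongly_orderable (B j)"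
  shows "strongly_orderable (mono_prod J B)"
  using assms
proof (induction J rule: finite_induct)
  case empty
  show ?case unfolding strongly_orderable_def mono_prod_empty
    by (intro ballI exI[of _ 0] exI[of _ "[]"]) simp
next
  case (insert j J)
  then show ?case by (simp add: mono_prod_insert strongly_orderable_sum)
qed

text \<open>
  After contraction each variable occurs in at most one of the two differences. Reversing all
  edges shows that the complementary factor \<open>h + tgts os\<close> lies in \<open>B\<close> as well.
\<close>

lemma strongly_orderable_edges:
  assumes "strongly_orderable B" "f \<in> B" "g \<in> B"
  obtains h es where "f = h + srcs es" "g = h + tgts es" "fst ` set es \<inter> snd ` set es = {}"
    "\<And>os. reorients es os \<Longrightarrow> h + srcs os \<in> B" "\<And>os. reorients es os \<Longrightarrow> h + tgts os \<in> B"
proof -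
  obtain h es where h: "f = h + srcs es" "g = h + tgts es" "\<And>os. reorients es os \<Longrightarrow> h + srcs os \<in> B"
    using assms unfolding strongly_orderable_def by blast
  obtain h' es' where h': "h' + srcs es' = h + srcs es" "h' + tgts es' = h + tgts es"
     "fst ` set es' \<inter> snd ` set es' = {}"
     "\<And>os'. reorients es' os' \<Longrightarrow> \<exists>os. reorients es os \<and> h + srcs os = h' + srcs os'"
    using contract_edges[of h es] by blast
  have *: "h' + srcs os \<in> B" if os: "reorients es' os" for os
  proof -
    obtain os1 where os1: "reorients es os1" "h + srcs os1 = h' + srcs os" using h'(4)[OF os] by blast
    show ?thesis unfolding os1(2)[symmetric] by (rule h(3)[OF os1(1)])
  qed
  have "h' + tgts os \<in> B" if "reorients es' os" for os
    using *[OF reorients_map_swap[OF that]] by simp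
  then show thesis using that[of h' es'] h h' * by simp
qed

section \<open>Connectivity by symmetric exchanges\<close>

inductive exch_conn :: "'v monom set \<Rightarrow> 'v monom multiset \<Rightarrow> 'v monom multiset \<Rightarrow> bool" for B where
  exch_conn_refl: "exch_conn B M M"
| exch_conn_sym: "exch_conn B M N \<Longrightarrow> exch_conn B N M"
| exch_conn_trans: "exch_conn B M N \<Longrightarrow> exch_conn B N P \<Longrightarrow> exch_conn B M P"
| exch_conn_step: "set_mset C \<subseteq> B \<Longrightarrow> r \<in> B \<Longrightarrow> s \<in> B \<Longrightarrow> exchange i j r \<in> B \<Longrightarrow> exchange j i s \<in> B \<Longrightarrow>
    exchangeable i j r s \<Longrightarrow> exch_conn B (C + {#r, s#}) (C + {#exchange i j r, exchange j i s#})"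

lemma exch_conn_add:
  assumes "exch_conn B M N" "set_mset C \<subseteq> B" shows "exch_conn B (C + M) (C + N)"
  using assms
proof (induction rule: exch_conn.induct)
  case (exch_conn_step D r s i j)
  have "exch_conn B ((C + D) + {#r, s#}) ((C + D) + {#exchange i j r, exchange j i s#})"
    using exch_conn_step by (intro exch_conn.exch_conn_step) auto
  then show ?case by (simp only: add.assoc)
qed (blast intro: exch_conn.intros)+

lemma exchange_sum:
  assumes "exchangeable i j r s" shows "exchange i j r + exchange j i s = r + s"
proof -
  have "dg r i > 0" "dg s j > 0" using assms unfolding exchangeable_def by linarith+
  then show ?thesis
    by (intro poly_mapping_eqI) (simp add: lookup_add dg_exchange)
qed

lemma exch_conn_invariants:
  assumes "exch_conn B M N"
  shows "size M = size N \<and> sum_mset M = sum_mset N \<and> (set_mset M \<subseteq> B \<longleftrightarrow> set_mset N \<subseteq> B)"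
  using assms
proof (induction rule: exch_conn.induct)
  case (exch_conn_step C r s i j)
  then show ?case using exchange_sum[OF exch_conn_step.hyps(6)] by (simp add: add_ac)
qed auto

lemma reorients_replace:
  assumes "e' = e \<or> e' = prod.swap e"
  shows "reorients (ps @ e' # es) os \<longleftrightarrow> reorients (ps @ e # es) os"
proof (induction ps arbitrary: os)
  case Nil
  show ?case using assms by (elim disjE) auto
qed simp

text \<open>
  The edges are reversed one after the other. Each time this is a symmetric exchange, because the
  endpoints lie on no other edge, so that the two factors differ in them by exactly one.
\<close>

lemma exch_conn_reorient:
  assumes "reorients es os" "distinct (map fst (ps @ es) @ map snd (ps @ es))"
    and "\<And>os'. reorients (ps @ es) os' \<Longrightarrow> h + srcs os' \<in> B"
  shows "exch_conn B {#h + srcs (ps @ es), h + tgts (ps @ es)#} {#h + srcs (ps @ os), h + tgts (ps @ os)#}"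
  using assms
proof (induction es arbitrary: ps os)
  case Nil
  then show ?case by (simp add: exch_conn_refl)
next
  case (Cons e es)
  obtain e' os' where os: "os = e' # os'" "e' = e \<or> e' = prod.swap e" "reorients es os'"
    using Cons.prems(1) by auto
  have inB: "h + srcs os'' \<in> B" if "reorients (ps @ e' # es) os''" for os''
  proof -
    have "reorients (ps @ e # es) os''"
      using that reorients_replace[OF os(2)] by simp
    then show ?thesis by (rule Cons.prems(3))
  qed
  have inB2: "h + tgts os'' \<in> B" if "reorients (ps @ e' # es) os''" for os''
    using inB[OF reorients_map_swap[OF that]] by simp
  have conn1: "exch_conn B {#h + srcs (ps @ e # es), h + tgts (ps @ e # es)#}
     {#h + srcs (ps @ e' # es), h + tgts (ps @ e' # es)#}"
  proof (cases "e' = e")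
    case True
    then show ?thesis by (simp add: exch_conn_refl)
  next
    case False
    obtain i j where e: "e = (i, j)" by fastforce
    have e': "e' = (j, i)" using False os(2) e by simp
    define R S where "R = h + srcs (ps @ es)" and "S = h + tgts (ps @ es)"
    have R: "h + srcs (ps @ e # es) = R + var i" "h + srcs (ps @ e' # es) = R + var j"
      by (simp_all add: R_def e e' add_ac)
    have S: "h + tgts (ps @ e # es) = S + var j" "h + tgts (ps @ e' # es) = S + var i"
      by (simp_all add: S_def e e' add_ac)
    have x: "exchange i j (R + var i) = R + var j" "exchange j i (S + var j) = S + var i"
      by (intro exchange_eqI; simp add: add_ac)+
    have d: "i \<noteq> j" "i \<notin> fst ` set (ps @ es)" "i \<notin> snd ` set (ps @ es)"
      "j \<notin> fst ` set (ps @ es)" "j \<notin> snd ` set (ps @ es)"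
      using Cons.prems(2) unfolding e by auto
    have "dg R i = dg S i" "dg R j = dg S j"
      using d(2-5)[folded dg_srcs_0_iff dg_tgts_0_iff] unfolding R_def S_def by (simp_all add: lookup_add)
    then have ex: "exchangeable i j (R + var i) (S + var j)"
      using d(1) by (simp add: exchangeable_def lookup_add dg_var)
    have "reorients (ps @ e' # es) (ps @ e # es)" by (simp add: reorients_replace[OF os(2)])
    from inB[OF this] inB2[OF this] inB[of "ps @ e' # es"] inB2[of "ps @ e' # es"]
    have mem: "R + var i \<in> B" "S + var j \<in> B" "R + var j \<in> B" "S + var i \<in> B"
      unfolding R S by simp_all
    have "exch_conn B ({#} + {#R + var i, S + var j#})
       ({#} + {#exchange i j (R + var i), exchange j i (S + var j)#})"
      by (rule exch_conn_step) (use mem ex x in simp_all)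
    then show ?thesis unfolding R S x by simp
  qed
  have "mset (map fst ((ps @ [e']) @ es) @ map snd ((ps @ [e']) @ es)) =
      mset (map fst (ps @ e # es) @ map snd (ps @ e # es))"
    using os(2) by (elim disjE) simp_all
  from mset_eq_imp_distinct_iff[OF this]
  have "distinct (map fst ((ps @ [e']) @ es) @ map snd ((ps @ [e']) @ es))"
    using Cons.prems(2) by simp
  then have "exch_conn B {#h + srcs ((ps @ [e']) @ es), h + tgts ((ps @ [e']) @ es)#}
     {#h + srcs ((ps @ [e']) @ os'), h + tgts ((ps @ [e']) @ os')#}"
    using inB by (intro Cons.IH[OF os(3)]) simp_all
  then show ?case using exch_conn_trans[OF conn1] os(1) by simp
qed

section \<open>Balanced families\<close>

definition balanced :: "'v monom multiset \<Rightarrow> bool" where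
  "balanced M \<longleftrightarrow> (\<forall>f\<in>#M. \<forall>g\<in>#M. \<forall>i. dg f i \<le> dg g i + 1)"

lemma balancedD: "balanced M \<Longrightarrow> f \<in># M \<Longrightarrow> g \<in># M \<Longrightarrow> dg f i \<le> dg g i + 1"
  unfolding balanced_def by blast

lemma mset_eq_two:
  assumes "x \<in># M" "y \<in># M" "x \<noteq> y" shows "\<exists>C. M = C + {#x, y#}"
proof -
  obtain C where C: "M = add_mset x C" using assms(1) by (rule mset_add)
  then have "y \<in># C" using assms by simp
  then obtain D where "C = add_mset y D" by (rule mset_add)
  then show ?thesis using C by (intro exI[of _ D]) simp
qed

lemma square_exchange: "y + 2 \<le> x \<Longrightarrow> (x - 1)\<^sup>2 + (y + 1)\<^sup>2 < x\<^sup>2 + (y::nat)\<^sup>2"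
proof -
  assume "y + 2 \<le> x"
  then obtain z where "x = y + 2 + z" using le_Suc_ex by blast
  then show ?thesis by (simp add: power2_eq_square algebra_simps)
qed

lemma square_exchange_le: "y + 1 \<le> x \<Longrightarrow> (x - 1)\<^sup>2 + (y + 1)\<^sup>2 \<le> x\<^sup>2 + (y::nat)\<^sup>2"
proof -
  assume "y + 1 \<le> x"
  then obtain z where "x = y + 1 + z" using le_Suc_ex by blast
  then show ?thesis by (simp add: power2_eq_square algebra_simps)
qed

text \<open>
  As long as \<open>f\<close> and \<open>g\<close> differ by at least two in the exponent of some \<open>x\<^sub>i\<close>, an exchange that moves
  \<open>x\<^sub>i\<close> from \<open>f\<close> to \<open>g\<close> decreases the sum of the squares of all exponents.
\<close>

lemma exch_conn_balanced:
  fixes B :: "'n::finite monom set"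
  assumes B: "strongly_orderable B" and "set_mset M \<subseteq> B"
  shows "\<exists>N. exch_conn B M N \<and> balanced N"
  using assms(2)
proof (induction "\<Sum>f\<in>#M. \<Sum>i\<in>UNIV. (dg f i)\<^sup>2" arbitrary: M rule: less_induct)
  case less
  show ?case
  proof (cases "balanced M")
    case True
    then show ?thesis using exch_conn_refl by blast
  next
    case False
    then obtain f g i where fg: "f \<in># M" "g \<in># M" and nle: "\<not> dg f i \<le> dg g i + 1"
      unfolding balanced_def by blast
    then have i: "dg g i + 2 \<le> dg f i" by linarith
    then have "f \<noteq> g" by auto
    then obtain C where C: "M = C + {#f, g#}" using mset_eq_two[OF fg] by blast
    have mem: "f \<in> B" "g \<in> B" "set_mset C \<subseteq> B" using less.prems fg C by auto
    obtain h es where h: "f = h + srcs es" "g = h + tgts es" "fst ` set es \<inter> snd ` set es = {}"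
      "\<And>os. reorients es os \<Longrightarrow> h + srcs os \<in> B" "\<And>os. reorients es os \<Longrightarrow> h + tgts os \<in> B"
      using strongly_orderable_edges[OF B mem(1,2)] by blast
    have "dg (srcs es) i \<noteq> 0" using i unfolding h by (simp add: lookup_add)
    then have iin: "i \<in> fst ` set es" unfolding dg_srcs_0_iff by simp
    then obtain j where ij: "(i, j) \<in> set es" by auto
    then obtain es1 where es1: "mset es = mset ((i, j) # es1)" using mset_eq_Cons[OF ij] by blast
    have jin: "j \<in> snd ` set es" using ij by force
    have "i \<noteq> j" using iin jin h(3) by blast
    have "dg (srcs es) j = 0" "dg (tgts es) j \<noteq> 0"
      unfolding dg_srcs_0_iff dg_tgts_0_iff using jin h(3) by blast+
    then have j: "dg f j + 1 \<le> dg g j" unfolding h by (simp add: lookup_add)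
    define t u where "t = exchange i j f" and "u = exchange j i g"
    have t: "t = h + srcs ((j, i) # es1)" unfolding t_def
      by (rule exchange_eqI) (simp add: h srcs_cong[OF es1] add_ac)
    have u: "u = h + tgts ((j, i) # es1)" unfolding u_def
      by (rule exchange_eqI) (simp add: h tgts_cong[OF es1] add_ac)
    have "reorients ((i, j) # es1) ((j, i) # es1)" by simp
    then obtain os where os: "reorients es os" "mset os = mset ((j, i) # es1)"
      using reorients_perm[OF es1] by blast
    have tu: "t \<in> B" "u \<in> B"
      unfolding t u srcs_cong[OF os(2), symmetric] tgts_cong[OF os(2), symmetric] using h(4,5) os(1) by blast+
    have ex: "exchangeable i j f g" using i j by (simp add: exchangeable_def)
    have conn: "exch_conn B M (C + {#t, u#})"
      unfolding C t_def u_def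
      by (rule exch_conn_step) (use mem tu ex in \<open>simp_all add: t_def u_def\<close>)
    have "(\<Sum>k\<in>UNIV. (dg t k)\<^sup>2 + (dg u k)\<^sup>2) < (\<Sum>k\<in>UNIV. (dg f k)\<^sup>2 + (dg g k)\<^sup>2)"
    proof (rule sum_strict_mono_ex1)
      show "\<forall>k\<in>UNIV. (dg t k)\<^sup>2 + (dg u k)\<^sup>2 \<le> (dg f k)\<^sup>2 + (dg g k)\<^sup>2"
      proof
        fix k
        consider "k = i" | "k = j" | "k \<noteq> i" "k \<noteq> j" by blast
        then show "(dg t k)\<^sup>2 + (dg u k)\<^sup>2 \<le> (dg f k)\<^sup>2 + (dg g k)\<^sup>2"
        proof cases
          case 1
          then show ?thesis using square_exchange_le[of "dg g i" "dg f i"] i \<open>i \<noteq> j\<close>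
            by (simp add: t_def u_def dg_exchange)
        next
          case 2
          then show ?thesis using square_exchange_le[of "dg f j" "dg g j"] j \<open>i \<noteq> j\<close>
            by (simp add: t_def u_def dg_exchange add.commute)
        qed (simp add: t_def u_def dg_exchange)
      qed
      show "\<exists>k\<in>UNIV. (dg t k)\<^sup>2 + (dg u k)\<^sup>2 < (dg f k)\<^sup>2 + (dg g k)\<^sup>2"
      proof
        show "(dg t i)\<^sup>2 + (dg u i)\<^sup>2 < (dg f i)\<^sup>2 + (dg g i)\<^sup>2"
          using square_exchange[OF i] \<open>i \<noteq> j\<close> by (simp add: t_def u_def dg_exchange)
      qed simp
    qed simp
    then have "(\<Sum>f\<in>#C + {#t, u#}. \<Sum>i\<in>UNIV. (dg f i)\<^sup>2) < (\<Sum>f\<in>#M. \<Sum>i\<in>UNIV. (dg f i)\<^sup>2)"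
      unfolding C by (simp add: sum.distrib)
    moreover have "set_mset (C + {#t, u#}) \<subseteq> B" using mem tu by simp
    ultimately obtain N where "exch_conn B (C + {#t, u#}) N" "balanced N"
      using less.hyps by blast
    then show ?thesis using exch_conn_trans[OF conn] by blast
  qed
qed

lemma dg_sum_mset: "dg (sum_mset M) i = (\<Sum>f\<in>#M. dg f i)"
  by (induction M) (auto simp: lookup_add)

text \<open>
  If \<open>f\<close> in \<open>F\<close> exceeded \<open>g\<close> in \<open>G\<close> by two in some variable, then all of \<open>F\<close> would lie at least one
  above \<open>g\<close> and all of \<open>G\<close> at most one above \<open>g\<close>, and the products could not agree.
\<close>

lemma balanced_union:
  assumes "balanced F" "balanced G" "size F = size G" "sum_mset F = sum_mset G"
  shows "balanced (F + G)"
proof -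
  have cross: "dg f i \<le> dg g i + 1"
    if "balanced F" "balanced G" "size F = size G" "sum_mset F = sum_mset G" "f \<in># F" "g \<in># G"
    for F G :: "'a monom multiset" and f g i
  proof (rule ccontr)
    assume "\<not> ?thesis"
    then have fg: "dg g i + 2 \<le> dg f i" by simp
    have "dg g i + 1 \<le> dg f' i" if "f' \<in># F" for f'
      using balancedD[OF \<open>balanced F\<close> \<open>f \<in># F\<close> that, of i] fg by simp
    then have "(\<Sum>f'\<in>#F. dg g i + 1) \<le> (\<Sum>f'\<in>#F. dg f' i)"
      by (intro sum_mset_mono)
    moreover obtain G' where G': "G = add_mset g G'" using \<open>g \<in># G\<close> by (rule mset_add)
    have "dg g' i \<le> dg g i + 1" if "g' \<in># G'" for g'
      using balancedD[OF \<open>balanced G\<close> _ \<open>g \<in># G\<close>, of g' i] that G' by simp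
    then have "(\<Sum>g'\<in>#G'. dg g' i) \<le> (\<Sum>g'\<in>#G'. dg g i + 1)"
      by (intro sum_mset_mono)
    ultimately show False
      using arg_cong[OF \<open>sum_mset F = sum_mset G\<close>, of "\<lambda>f. dg f i"] \<open>size F = size G\<close>
      by (simp add: dg_sum_mset G' lookup_add)
  qed
  show ?thesis
    unfolding balanced_def
  proof (intro ballI allI)
    fix f g i assume fg: "f \<in># F + G" "g \<in># F + G"
    then consider "f \<in># F" "g \<in># F" | "f \<in># F" "g \<in># G" | "f \<in># G" "g \<in># F" | "f \<in># G" "g \<in># G"
      by auto
    then show "dg f i \<le> dg g i + 1"
      by cases (use assms cross[of F G f g i] cross[of G F f g i] in \<open>auto dest: balancedD\<close>)
  qed
qed

lemma balanced_coordinatewise: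
  assumes "balanced M" "\<And>x i. x \<in># N \<Longrightarrow> \<exists>y\<in>#M. dg x i = dg y i"
  shows "balanced N"
  unfolding balanced_def
proof (intro ballI allI)
  fix f g i assume fg: "f \<in># N" "g \<in># N"
  obtain x where x: "x \<in># M" "dg f i = dg x i" using assms(2)[OF fg(1)] by blast
  obtain y where y: "y \<in># M" "dg g i = dg y i" using assms(2)[OF fg(2)] by blast
  show "dg f i \<le> dg g i + 1"
    using balancedD[OF assms(1) x(1) y(1), of i] x(2) y(2) by simp
qed

text \<open>
  Within a balanced family the edges between two factors form a matching, as needed in
  \<open>exch_conn_reorient\<close>.
\<close>

lemma balanced_edges_distinct:
  assumes "balanced M" "h + srcs es \<in># M" "h + tgts es \<in># M" "fst ` set es \<inter> snd ` set es = {}"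
  shows "distinct (map fst es @ map snd es)" "dg (srcs es) i + dg (tgts es) i \<le> 1"
proof -
  have sum: "dg (srcs es) i + dg (tgts es) i \<le> 1" for i
  proof -
    have "dg (srcs es) i = 0 \<or> dg (tgts es) i = 0"
      using assms(4) unfolding dg_srcs_0_iff dg_tgts_0_iff by blast
    then show ?thesis
      using balancedD[OF assms(1-3), of i] balancedD[OF assms(1,3,2), of i] by (auto simp: lookup_add)
  qed
  show "dg (srcs es) i + dg (tgts es) i \<le> 1" by (rule sum)
  have *: "distinct xs" if "\<And>i. count (mset xs) i \<le> 1" for xs :: "'a list"
    unfolding distinct_count_atmost_1
  proof
    fix a show "count (mset xs) a = (if a \<in> set xs then 1 else 0)"
      using that[of a] count_greater_zero_iff[of "mset xs" a]
      by (auto simp: count_eq_zero_iff simp del: count_greater_zero_iff)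
  qed
  have "count (mset (map fst es)) i \<le> 1" "count (mset (map snd es)) i \<le> 1" for i
    using sum[of i] unfolding dg_srcs dg_tgts by linarith+
  then have "distinct (map fst es)" "distinct (map snd es)" by (blast intro: *)+
  then show "distinct (map fst es @ map snd es)" using assms(4) by auto
qed

definition monom_dist :: "'n::finite monom \<Rightarrow> 'n monom \<Rightarrow> nat" where
  "monom_dist f g = (\<Sum>i\<in>UNIV. (dg f i - dg g i) + (dg g i - dg f i))"

text \<open>
  The effect of one step of \<open>balanced_exch_conn\<close> on a single variable. The letters \<open>s, t\<close> and \<open>a, b\<close>
  are the numbers of outgoing and incoming edges at this variable before and after reorienting the
  edges between \<open>f\<^sub>1\<close> and \<open>f\<^sub>2\<close>, and the primed letters those for \<open>g\<^sub>1\<close> and \<open>g\<^sub>2\<close>. If both pairs differ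
  in this variable, a balanced orientation makes one edge enter and the other one leave; since the
  roles of \<open>a'\<close> and \<open>b'\<close> are interchanged in \<open>new\<close>, the distance then becomes zero.
\<close>

lemma reorient_coordinate:
  fixes h s t h' s' t' a b a' b' :: nat
  assumes "s + t \<le> 1" "s' + t' \<le> 1" "a + b = s + t" "a' + b' = s' + t'"
    and "a + a' \<le> b + b' + 1" "b + b' \<le> a + a' + 1"
    and "h + s \<le> h' + s' + 1" "h + s \<le> h' + t' + 1" "h + t \<le> h' + s' + 1" "h + t \<le> h' + t' + 1"
    and "h' + s' \<le> h + s + 1" "h' + s' \<le> h + t + 1" "h' + t' \<le> h + s + 1" "h' + t' \<le> h + t + 1"
  defines "old \<equiv> ((h + s - (h' + s')) + (h' + s' - (h + s))) + ((h + t - (h' + t')) + (h' + t' - (h + t)))"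
    and "new \<equiv> ((h + a - (h' + b')) + (h' + b' - (h + a))) + ((h + b - (h' + a')) + (h' + a' - (h + b)))"
  shows "new \<le> old" "h + s < h' + s' \<Longrightarrow> h' + t' < h + t \<Longrightarrow> new < old"
proof -
  have st: "(s = 0 \<and> t = 0) \<or> (s = 0 \<and> t = 1) \<or> (s = 1 \<and> t = 0)" using assms(1) by linarith
  have st': "(s' = 0 \<and> t' = 0) \<or> (s' = 0 \<and> t' = 1) \<or> (s' = 1 \<and> t' = 0)" using assms(2) by linarith
  have ab: "(a = 0 \<and> b = s + t) \<or> (b = 0 \<and> a = s + t)" using assms(1,3) by linarith
  have ab': "(a' = 0 \<and> b' = s' + t') \<or> (b' = 0 \<and> a' = s' + t')" using assms(2,4) by linarith
  have "h \<le> h' + 1" "h' \<le> h + 1" using st st' assms(7-14) by (elim disjE conjE; simp)+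
  then have hh: "h = h' \<or> h = h' + 1 \<or> h' = h + 1" by linarith
  show "new \<le> old"
    using st st' ab ab' hh assms(5-14) unfolding new_def old_def by (elim disjE conjE) simp_all
  show "new < old" if "h + s < h' + s'" "h' + t' < h + t"
    using st st' ab ab' hh assms(5-14) that unfolding new_def old_def by (elim disjE conjE) simp_all
qed

lemma sum_mset_eq_witness:
  fixes u v :: "'a \<Rightarrow> nat"
  assumes "(\<Sum>p\<in>#P. u p) = (\<Sum>p\<in>#P. v p)" "q \<in># P" "v q < u q"
  shows "\<exists>p\<in>#P. u p < v p"
proof (rule ccontr)
  assume "\<not> ?thesis"
  then have le: "v p \<le> u p" if "p \<in># P" for p using that by (auto simp: not_less)
  obtain Q where Q: "P = add_mset q Q" using assms(2) by (rule mset_add)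
  have "(\<Sum>p\<in>#Q. v p) \<le> (\<Sum>p\<in>#Q. u p)" by (intro sum_mset_mono le) (simp add: Q)
  then show False using assms(1,3) by (simp add: Q)
qed

text \<open>
  Two balanced families are matched up as pairs. Where a pair \<open>(f\<^sub>1, g\<^sub>1)\<close> disagrees in \<open>x\<^sub>i\<close>,
  another pair \<open>(f\<^sub>2, g\<^sub>2)\<close> disagrees in the opposite direction. A balanced orientation of the
  edges between \<open>f\<^sub>1, f\<^sub>2\<close> together with those between \<open>g\<^sub>1, g\<^sub>2\<close> makes the two new pairs agree in
  every variable in which both the \<open>f\<close>'s and the \<open>g\<close>'s differ, so the total distance drops.
\<close>

lemma balanced_exch_conn:
  fixes B :: "'n::finite monom set"
  assumes B: "strongly_orderable B"
    and "set_mset (image_mset fst P) \<subseteq> B" "set_mset (image_mset snd P) \<subseteq> B"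
    and "sum_mset (image_mset fst P) = sum_mset (image_mset snd P)"
    and "balanced (image_mset fst P + image_mset snd P)"
  shows "exch_conn B (image_mset fst P) (image_mset snd P)"
  using assms(2-)
proof (induction "\<Sum>p\<in>#P. monom_dist (fst p) (snd p)" arbitrary: P rule: less_induct)
  case less
  show ?case
  proof (cases "\<forall>p\<in>#P. fst p = snd p")
    case True
    then have "image_mset fst P = image_mset snd P" by (intro image_mset_cong) blast
    then show ?thesis by (simp add: exch_conn_refl)
  next
    case False
    have sums: "(\<Sum>p\<in>#P. dg (fst p) i) = (\<Sum>p\<in>#P. dg (snd p) i)" for i
      using arg_cong[OF less.prems(3), of "\<lambda>f. dg f i"] by (simp add: dg_sum_mset image_mset.compositionality o_def)
    obtain q where q: "q \<in># P" "fst q \<noteq> snd q" using False by blast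
    obtain i where "dg (fst q) i \<noteq> dg (snd q) i" using q(2) by (metis poly_mapping_eqI)
    then consider "dg (fst q) i < dg (snd q) i" | "dg (fst q) i > dg (snd q) i" by linarith
    then have "\<exists>p1 p2. p1 \<in># P \<and> p2 \<in># P \<and> dg (fst p1) i < dg (snd p1) i \<and> dg (snd p2) i < dg (fst p2) i"
      by cases (use q(1) sum_mset_eq_witness[OF sums q(1)] sum_mset_eq_witness[OF sums[symmetric] q(1)] in blast)+
    then obtain p1 p2 where p: "p1 \<in># P" "p2 \<in># P" "dg (fst p1) i < dg (snd p1) i" "dg (snd p2) i < dg (fst p2) i"
      by blast
    then have "p1 \<noteq> p2" by auto
    then obtain C where C: "P = C + {#p1, p2#}" using mset_eq_two[OF p(1,2)] by blast
    obtain f1 g1 f2 g2 where fg: "p1 = (f1, g1)" "p2 = (f2, g2)" by (metis surj_pair)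
    let ?M = "image_mset fst P + image_mset snd P"
    have mem: "f1 \<in> B" "f2 \<in> B" "g1 \<in> B" "g2 \<in> B"
      "set_mset (image_mset fst C) \<subseteq> B" "set_mset (image_mset snd C) \<subseteq> B"
      using less.prems(1,2) by (simp_all add: C fg)
    have inM: "f1 \<in># ?M" "f2 \<in># ?M" "g1 \<in># ?M" "g2 \<in># ?M" by (simp_all add: C fg)
    obtain h es where h: "f1 = h + srcs es" "f2 = h + tgts es" "fst ` set es \<inter> snd ` set es = {}"
      "\<And>os. reorients es os \<Longrightarrow> h + srcs os \<in> B" "\<And>os. reorients es os \<Longrightarrow> h + tgts os \<in> B"
      using strongly_orderable_edges[OF B mem(1,2)] by blast
    obtain h' es' where h': "g1 = h' + srcs es'" "g2 = h' + tgts es'" "fst ` set es' \<inter> snd ` set es' = {}"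
      "\<And>os. reorients es' os \<Longrightarrow> h' + srcs os \<in> B" "\<And>os. reorients es' os \<Longrightarrow> h' + tgts os \<in> B"
      using strongly_orderable_edges[OF B mem(3,4)] by blast
    note de = balanced_edges_distinct[OF less.prems(4) inM(1,2)[unfolded h(1,2)] h(3)]
    note de' = balanced_edges_distinct[OF less.prems(4) inM(3,4)[unfolded h'(1,2)] h'(3)]
    obtain os2 where os2: "reorients (es @ es') os2" "balanced_orientation os2"
      using balanceable[of "es @ es'"] unfolding balanceable_def by blast
    obtain os os' where os: "os2 = os @ os'" "reorients es os" "reorients es' os'"
      using os2(1) unfolding reorients_append by blast
    \<comment> \<open>Source and target are interchanged for the \<open>g\<close>'s: where both lists have an edge at a variable,
      the balanced orientation lets one of them leave and the other one enter.\<close>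
    define F1 F2 G1 G2 where "F1 = h + srcs os" and "F2 = h + tgts os" and "G1 = h' + tgts os'" and "G2 = h' + srcs os'"
    have mem': "F1 \<in> B" "F2 \<in> B" "G1 \<in> B" "G2 \<in> B"
      unfolding F1_def F2_def G1_def G2_def using h(4,5)[OF os(2)] h'(4,5)[OF os(3)] by blast+
    have connF: "exch_conn B {#f1, f2#} {#F1, F2#}"
      using exch_conn_reorient[OF os(2), of "[]" h B] de(1) h(4) unfolding F1_def F2_def h(1,2) by simp
    have "exch_conn B {#g1, g2#} {#G2, G1#}"
      using exch_conn_reorient[OF os(3), of "[]" h' B] de'(1) h'(4) unfolding G1_def G2_def h'(1,2) by simp
    then have connG: "exch_conn B {#g1, g2#} {#G1, G2#}" by (simp add: add_mset_commute)
    let ?P = "C + {#(F1, G1), (F2, G2)#}"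
    have CF: "exch_conn B (image_mset fst P) (image_mset fst ?P)"
      using exch_conn_add[OF connF mem(5)] by (simp add: C fg)
    have CG: "exch_conn B (image_mset snd P) (image_mset snd ?P)"
      using exch_conn_add[OF connG mem(6)] by (simp add: C fg)
    have sumeq: "sum_mset (image_mset fst ?P) = sum_mset (image_mset snd ?P)"
      using exch_conn_invariants[OF CF] exch_conn_invariants[OF CG] less.prems(3) by simp
    have vals: "dg F1 k \<in> {dg f1 k, dg f2 k} \<and> dg F2 k \<in> {dg f1 k, dg f2 k} \<and>
       dg G1 k \<in> {dg g1 k, dg g2 k} \<and> dg G2 k \<in> {dg g1 k, dg g2 k}" for k
      using de(2)[of k] de'(2)[of k] dg_srcs_tgts_reorients[OF os(2), of k] dg_srcs_tgts_reorients[OF os(3), of k]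
      unfolding F1_def F2_def G1_def G2_def h(1,2) h'(1,2) lookup_add insert_iff by linarith
    have bal: "balanced (image_mset fst ?P + image_mset snd ?P)"
    proof (rule balanced_coordinatewise[OF less.prems(4)])
      fix x k assume "x \<in># image_mset fst ?P + image_mset snd ?P"
      then consider "x \<in># ?M" | "x \<in> {F1, F2, G1, G2}" by (auto simp: C)
      then show "\<exists>y\<in>#?M. dg x k = dg y k"
      proof cases
        case 2
        then have "dg x k \<in> {dg f1 k, dg f2 k, dg g1 k, dg g2 k}" using vals[of k] by auto
        then show ?thesis using inM by blast
      qed blast
    qed
    have near: "dg x k \<le> dg y k + 1" if "x \<in># ?M" "y \<in># ?M" for x y k
      by (rule balancedD[OF less.prems(4) that])
    let ?old = "\<lambda>k. ((dg f1 k - dg g1 k) + (dg g1 k - dg f1 k)) + ((dg f2 k - dg g2 k) + (dg g2 k - dg f2 k))"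
    let ?new = "\<lambda>k. ((dg F1 k - dg G1 k) + (dg G1 k - dg F1 k)) + ((dg F2 k - dg G2 k) + (dg G2 k - dg F2 k))"
    have bo: "dg (srcs os) k + dg (srcs os') k \<le> dg (tgts os) k + dg (tgts os') k + 1"
      "dg (tgts os) k + dg (tgts os') k \<le> dg (srcs os) k + dg (srcs os') k + 1" for k
      using os2(2) unfolding os(1) balanced_orientation_def by (simp_all add: lookup_add)
    note nears = near[OF inM(1,3)] near[OF inM(1,4)] near[OF inM(2,3)] near[OF inM(2,4)]
      near[OF inM(3,1)] near[OF inM(3,2)] near[OF inM(4,1)] near[OF inM(4,2)]
    note coord = reorient_coordinate[OF de(2) de'(2) dg_srcs_tgts_reorients[OF os(2)]
        dg_srcs_tgts_reorients[OF os(3)] bo nears[unfolded h(1,2) h'(1,2) lookup_add]]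
    have "(\<Sum>k\<in>UNIV. ?new k) < (\<Sum>k\<in>UNIV. ?old k)"
    proof (rule sum_strict_mono_ex1)
      show "\<forall>k\<in>UNIV. ?new k \<le> ?old k"
        unfolding F1_def F2_def G1_def G2_def h(1,2) h'(1,2) lookup_add using coord(1) by blast
      show "\<exists>k\<in>UNIV. ?new k < ?old k"
      proof
        show "?new i < ?old i"
          using p(3,4) coord(2)[of i] unfolding fg F1_def F2_def G1_def G2_def h(1,2) h'(1,2) lookup_add fst_conv snd_conv
          by blast
      qed simp
    qed simp
    then have "monom_dist F1 G1 + monom_dist F2 G2 < monom_dist f1 g1 + monom_dist f2 g2"
      by (simp add: monom_dist_def sum.distrib)
    then have "(\<Sum>p\<in>#?P. monom_dist (fst p) (snd p)) < (\<Sum>p\<in>#P. monom_dist (fst p) (snd p))"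
      by (simp add: C fg)
    then have "exch_conn B (image_mset fst ?P) (image_mset snd ?P)"
      by (rule less.hyps) (use mem mem' sumeq bal in simp_all)
    then show ?thesis using exch_conn_trans[OF exch_conn_trans[OF CF] exch_conn_sym[OF CG]] by blast
  qed
qed

lemma mset_pairing:
  assumes "size F = size G"
  shows "\<exists>P. image_mset fst P = F \<and> image_mset snd P = G"
proof -
  obtain xs ys where xy: "F = mset xs" "G = mset ys" by (metis ex_mset)
  then have "length xs = length ys" using assms by simp
  then have "image_mset fst (mset (zip xs ys)) = F" "image_mset snd (mset (zip xs ys)) = G"
    unfolding xy mset_map[symmetric] by simp_all
  then show ?thesis by blast
qed

proposition strongly_orderable_exch_conn:
  fixes B :: "'n::finite monom set"
  assumes B: "strongly_orderable B" and "set_mset F \<subseteq> B" "set_mset G \<subseteq> B"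
    and "size F = size G" "sum_mset F = sum_mset G"
  shows "exch_conn B F G"
proof -
  obtain F' where F': "exch_conn B F F'" "balanced F'" using exch_conn_balanced[OF B assms(2)] by blast
  obtain G' where G': "exch_conn B G G'" "balanced G'" using exch_conn_balanced[OF B assms(3)] by blast
  note inv = exch_conn_invariants[OF F'(1)] exch_conn_invariants[OF G'(1)]
  have size: "size F' = size G'" and sum: "sum_mset F' = sum_mset G'" using inv assms(4,5) by simp_all
  obtain P where P: "image_mset fst P = F'" "image_mset snd P = G'" using mset_pairing[OF size] by blast
  have "exch_conn B (image_mset fst P) (image_mset snd P)"
    by (rule balanced_exch_conn[OF B])
      (use inv assms(2,3) sum balanced_union[OF F'(2) G'(2) size sum] in \<open>simp_all add: P\<close>)
  then have "exch_conn B F' G'" by (simp only: P)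
  then show ?thesis using exch_conn_trans[OF exch_conn_trans[OF F'(1)] exch_conn_sym[OF G'(1)]] by blast
qed

section \<open>Connectivity of tuples by degree one moves\<close>

abbreviation mono_power :: "nat \<Rightarrow> 'v monom set \<Rightarrow> 'v monom set" where
  "mono_power i B \<equiv> mono_prod {..<i} (\<lambda>_. B)"

lemma mono_prod_power:
  "f \<in> mono_power k B \<longleftrightarrow> (\<exists>M. size M = k \<and> set_mset M \<subseteq> B \<and> f = sum_mset M)"
proof (induction k arbitrary: f)
  case 0
  show ?case by (simp add: mono_prod_empty)
next
  case (Suc k)
  have eq: "mono_power (Suc k) B = {b + c | b c. b \<in> B \<and> c \<in> mono_power k B}"
    unfolding lessThan_Suc by (rule mono_prod_insert) auto
  show ?case
  proof
    assume "f \<in> mono_power (Suc k) B"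
    then obtain b M where "f = b + sum_mset M" "b \<in> B" "size M = k" "set_mset M \<subseteq> B"
      unfolding eq Suc by blast
    then show "\<exists>M. size M = Suc k \<and> set_mset M \<subseteq> B \<and> f = sum_mset M"
      by (intro exI[of _ "add_mset b M"]) simp
  next
    assume "\<exists>M. size M = Suc k \<and> set_mset M \<subseteq> B \<and> f = sum_mset M"
    then obtain M where M: "size M = Suc k" "set_mset M \<subseteq> B" "f = sum_mset M" by blast
    obtain b N where N: "M = add_mset b N" using M(1) by (auto simp: size_Suc_Diff1 dest: size_eq_Suc_imp_eq_union)
    then show "f \<in> mono_power (Suc k) B"
      unfolding eq Suc using M by auto
  qed
qed

lemma mono_prod_power_add:
  assumes "f \<in> mono_power k B" "g \<in> mono_power l B"
  shows "f + g \<in> mono_power (k + l) B"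
proof -
  obtain M N where "size M = k" "set_mset M \<subseteq> B" "f = sum_mset M" "size N = l" "set_mset N \<subseteq> B" "g = sum_mset N"
    using assms unfolding mono_prod_power by blast
  then show ?thesis unfolding mono_prod_power by (intro exI[of _ "M + N"]) simp
qed

lemma sum_mset_le_if_all_le:
  fixes w :: "'a \<Rightarrow> nat"
  assumes "size M = size N" "\<And>f g. f \<in># M \<Longrightarrow> g \<in># N \<Longrightarrow> w f \<le> w g"
  shows "(\<Sum>f\<in>#M. w f) \<le> (\<Sum>g\<in>#N. w g)"
proof -
  obtain P where P: "image_mset fst P = M" "image_mset snd P = N" using mset_pairing[OF assms(1)] by blast
  have "(\<Sum>p\<in>#P. w (fst p)) \<le> (\<Sum>p\<in>#P. w (snd p))"
    by (intro sum_mset_mono assms(2)) (auto simp: P[symmetric])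
  then show ?thesis by (simp add: P[symmetric] image_mset.compositionality o_def)
qed

lemma sum_mset_less_witness:
  assumes "size M = size N" "dg (sum_mset N) p < dg (sum_mset M) p"
  obtains f g where "f \<in># M" "g \<in># N" "dg g p < dg f p"
proof -
  have "\<exists>f g. f \<in># M \<and> g \<in># N \<and> dg g p < dg f p"
  proof (rule ccontr)
    assume "\<not> ?thesis"
    then have "dg f p \<le> dg g p" if "f \<in># M" "g \<in># N" for f g using that by (auto simp: not_less)
    then have "(\<Sum>f\<in>#M. dg f p) \<le> (\<Sum>g\<in>#N. dg g p)"
      by (rule sum_mset_le_if_all_le[OF assms(1)])
    then show False using assms(2) by (simp add: dg_sum_mset)
  qed
  then show thesis using that by blast
qed

text \<open>
  A product of elements of a basis from which \<open>x\<^sub>p\<close> may be moved to \<open>x\<^sub>q\<close> has a factorization in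
  which a single factor admits this exchange: if the factors \<open>f\<^sub>1\<close> with a superfluous \<open>x\<^sub>p\<close> and
  \<open>f\<^sub>2\<close> with room for \<open>x\<^sub>q\<close> are different, one symmetric exchange makes room in \<open>f\<^sub>1\<close>.
\<close>

lemma SEP_power_exchange:
  fixes B :: "'n::finite monom set"
  assumes B: "SEP_basis B" and M: "set_mset M \<subseteq> B" and N: "set_mset N \<subseteq> B" and size: "size M = size N"
    and p: "dg (sum_mset N) p < dg (sum_mset M) p" and q: "dg (sum_mset M) q < dg (sum_mset N) q"
  obtains f C where "sum_mset M = f + sum_mset C" "size M = Suc (size C)" "f \<in> B" "set_mset C \<subseteq> B"
    "0 < dg f p" "exchange p q f \<in> B"
proof -
  obtain f1 g1 where 1: "f1 \<in># M" "g1 \<in># N" "dg g1 p < dg f1 p"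
    by (rule sum_mset_less_witness[OF size p])
  obtain g2 f2 where 2: "g2 \<in># N" "f2 \<in># M" "dg f2 q < dg g2 q"
    by (rule sum_mset_less_witness[OF size[symmetric] q])
  note found = that
  have mem: "f1 \<in> B" "f2 \<in> B" "g1 \<in> B" "g2 \<in> B" using 1 2 M N by auto
  have split: thesis if "f \<in># M" "dg g1 p < dg f p" "dg f q < dg g2 q" for f
  proof -
    obtain C where C: "M = add_mset f C" using \<open>f \<in># M\<close> by (rule mset_add)
    have "f \<in> B" using M C by simp
    have "exchange p q f \<in> B"
      by (rule SEP_exchange_two_witnesses[OF B \<open>f \<in> B\<close> mem(3,4) that(2,3)])
    then show thesis using M \<open>f \<in> B\<close> \<open>dg g1 p < dg f p\<close> by (intro found[of f C]) (auto simp: C)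
  qed
  consider "dg f1 q < dg g2 q" | "dg g1 p < dg f2 p" | "dg f2 p < dg f1 p" "dg f2 q < dg f1 q"
    using 1 2 by linarith
  then show thesis
  proof cases
    case 1
    show thesis by (rule split[OF \<open>f1 \<in># M\<close> \<open>dg g1 p < dg f1 p\<close> 1])
  next
    case 2
    show thesis by (rule split[OF \<open>f2 \<in># M\<close> 2 \<open>dg f2 q < dg g2 q\<close>])
  next
    case 3
    then have "f1 \<noteq> f2" by auto
    obtain C where C: "M = C + {#f1, f2#}" using mset_eq_two[OF 1(1) 2(2) \<open>f1 \<noteq> f2\<close>] by blast
    obtain k where k: "dg f1 k < dg f2 k"
      by (rule compensating_variable[OF SEP_deg[OF B mem(2,1)] 3(1)])
    have ne: "k \<noteq> p" "k \<noteq> q" "p \<noteq> q" using k 3 p q by auto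
    have ex: "exchangeable q k f1 f2" using 3 k by (simp add: exchangeable_def)
    let ?f1 = "exchange q k f1" and ?f2 = "exchange k q f2"
    have f12: "?f1 \<in> B" "?f2 \<in> B"
      by (rule SEP_exchange[OF B mem(1,2) 3(2) k], rule SEP_exchange[OF B mem(2,1) k 3(2)])
    have "dg g1 p < dg ?f1 p" "dg ?f1 q < dg f1 q"
      using 1(3) ne 3(2) by (simp_all add: dg_exchange)
    then have "exchange p q ?f1 \<in> B"
      by (rule SEP_exchange_two_witnesses[OF B f12(1) mem(3,1)])
    moreover have "sum_mset M = ?f1 + sum_mset (add_mset ?f2 C)"
      using exchange_sum[OF ex] unfolding C by (simp add: add_ac)
    ultimately show thesis
      using M f12 \<open>dg g1 p < dg ?f1 p\<close> by (intro found[of ?f1 "add_mset ?f2 C"]) (auto simp: C)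
  qed
qed

text \<open>
  Replacing \<open>J\<close> by its image shrinks it until \<open>f\<close> is onto.
\<close>

lemma self_map_cycle:
  assumes "finite J" "J \<noteq> {}" "f ` J \<subseteq> J"
  shows "\<exists>K\<subseteq>J. K \<noteq> {} \<and> bij_betw f K K"
  using assms
proof (induction J rule: finite_psubset_induct)
  case (psubset J)
  show ?case
  proof (cases "f ` J = J")
    case True
    then have "inj_on f J" using psubset.hyps by (simp add: eq_card_imp_inj_on)
    then show ?thesis using True psubset.prems unfolding bij_betw_def by blast
  next
    case False
    then have sub: "f ` J \<subset> J" "f ` J \<noteq> {}" "f ` (f ` J) \<subseteq> f ` J" using psubset.prems by auto
    obtain K where K: "K \<subseteq> f ` J" "K \<noteq> {}" "bij_betw f K K"
      using psubset.IH[OF sub] by (elim exE conjE)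
    show ?thesis by (rule exI[of _ K]) (use K sub(1) in simp)
  qed
qed

lemma monom_dist_exchange:
  fixes x y z :: "'n::finite monom"
  assumes "x + var p = y + var q" "dg z p < dg y p" "dg y q < dg z q"
  shows "monom_dist x z < monom_dist y z"
  unfolding monom_dist_def
proof (rule sum_strict_mono_ex1)
  have "p \<noteq> q" using assms(2,3) by auto
  have k: "dg x k + (if p = k then 1 else 0) = dg y k + (if q = k then 1 else 0)" for k
    using arg_cong[OF assms(1), of "\<lambda>f. dg f k"] by (simp only: lookup_add dg_var)
  show "\<forall>k\<in>UNIV. (dg x k - dg z k) + (dg z k - dg x k) \<le> (dg y k - dg z k) + (dg z k - dg y k)"
  proof
    fix k
    consider "k = p" | "k = q" | "k \<noteq> p" "k \<noteq> q" by blast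
    then show "(dg x k - dg z k) + (dg z k - dg x k) \<le> (dg y k - dg z k) + (dg z k - dg y k)"
      by cases (use k[of k] assms(2,3) \<open>p \<noteq> q\<close> in simp_all)
  qed
  show "\<exists>k\<in>UNIV. (dg x k - dg z k) + (dg z k - dg x k) < (dg y k - dg z k) + (dg z k - dg y k)"
  proof
    show "(dg x p - dg z p) + (dg z p - dg x p) < (dg y p - dg z p) + (dg z p - dg y p)"
      using k[of p] assms(2) \<open>p \<noteq> q\<close> by simp
  qed simp
qed simp

text \<open>
  For two tuples with the same product, the surplus of a variable in one component is a deficit
  in another one, which in turn has a surplus of some other variable. Following these surpluses
  leads to a cycle of components. Exchanging in all of them at once preserves the product and is
  a move in degree one.
\<close>

lemma tuples_connected:
  fixes Bs :: "'s::finite \<Rightarrow> 'n::finite monom set" and R :: "('s \<Rightarrow> 'n monom) \<Rightarrow> ('s \<Rightarrow> 'n monom) \<Rightarrow> bool"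
  assumes SEP: "\<And>j. SEP_basis (Bs j)"
    and refl: "\<And>m. R m m" and trans: "\<And>m1 m2 m3. R m1 m2 \<Longrightarrow> R m2 m3 \<Longrightarrow> R m1 m3"
    and move: "\<And>f g r. (\<And>j. f j \<in> Bs j) \<Longrightarrow> (\<And>j. g j \<in> Bs j) \<Longrightarrow>
      (\<And>j. r j \<in> mono_power k (Bs j)) \<Longrightarrow> (\<Sum>j\<in>UNIV. f j) = (\<Sum>j\<in>UNIV. g j) \<Longrightarrow>
      R (\<lambda>j. f j + r j) (\<lambda>j. g j + r j)"
    and m: "\<And>j. m j \<in> mono_power (Suc k) (Bs j)" and m': "\<And>j. m' j \<in> mono_power (Suc k) (Bs j)"
    and eq: "(\<Sum>j\<in>UNIV. m j) = (\<Sum>j\<in>UNIV. m' j)"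
  shows "R m m'"
  using m eq
proof (induction "\<Sum>j\<in>UNIV. monom_dist (m j) (m' j)" arbitrary: m rule: less_induct)
  case less
  define J where "J = {j. m j \<noteq> m' j}"
  show ?case
  proof (cases "J = {}")
    case True
    then have "m = m'" unfolding J_def by auto
    then show ?thesis using refl by simp
  next
    case False
    have "\<exists>M. size M = Suc k \<and> set_mset M \<subseteq> Bs j \<and> m j = sum_mset M" for j
      using less.prems(1)[of j] unfolding mono_prod_power .
    then obtain M where M: "\<And>j. size (M j) = Suc k" "\<And>j. set_mset (M j) \<subseteq> Bs j" "\<And>j. m j = sum_mset (M j)"
      by metis
    have "\<exists>M. size M = Suc k \<and> set_mset M \<subseteq> Bs j \<and> m' j = sum_mset M" for j
      using m'[of j] unfolding mono_prod_power .
    then obtain M' where M': "\<And>j. size (M' j) = Suc k" "\<And>j. set_mset (M' j) \<subseteq> Bs j" "\<And>j. m' j = sum_mset (M' j)"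
      by metis
    have deg: "mono_deg (m j) = mono_deg (m' j)" for j
    proof -
      have deg_sum: "mono_deg (sum_mset X) = size X * d" if "\<And>x. x \<in># X \<Longrightarrow> mono_deg x = d" for X :: "'n monom multiset" and d
        using that by (induction X) (auto simp: mono_deg_add)
      obtain b where b: "b \<in># M j" using M(1)[of j] by (metis size_empty nat.distinct(1) multiset_nonemptyE)
      have "mono_deg x = mono_deg b" if "x \<in> Bs j" for x
        using SEP_deg[OF SEP that] b M(2)[of j] by blast
      then have "mono_deg (m j) = Suc k * mono_deg b" "mono_deg (m' j) = Suc k * mono_deg b"
        unfolding M(3) M'(3) using M(2)[of j] M'(2)[of j] by (subst deg_sum[of _ "mono_deg b"]; auto simp: M(1) M'(1))+
      then show ?thesis by simp
    qed
    have "\<exists>p. dg (m' j) p < dg (m j) p" if j: "j \<in> J" for j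
    proof -
      have "m j \<noteq> m' j" using j by (simp add: J_def)
      then obtain p where "dg (m j) p \<noteq> dg (m' j) p" by (metis poly_mapping_eqI)
      then consider "dg (m' j) p < dg (m j) p" | "dg (m j) p < dg (m' j) p" by linarith
      then show ?thesis by cases (use compensating_variable[OF deg, of j p] in blast)+
    qed
    then obtain p where p: "\<And>j. j \<in> J \<Longrightarrow> dg (m' j) (p j) < dg (m j) (p j)" by metis
    have "\<exists>l. dg (m l) (p j) < dg (m' l) (p j)" if "j \<in> J" for j
    proof (rule ccontr)
      assume "\<not> ?thesis"
      then have "(\<Sum>l\<in>UNIV. dg (m' l) (p j)) < (\<Sum>l\<in>UNIV. dg (m l) (p j))"
        using p[OF that] by (intro sum_strict_mono_ex1) (auto simp: not_less)
      then show False using arg_cong[OF less.prems(2), of "\<lambda>f. dg f (p j)"] by (simp add: lookup_sum)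
    qed
    then obtain nx where nx: "\<And>j. j \<in> J \<Longrightarrow> dg (m (nx j)) (p j) < dg (m' (nx j)) (p j)" by metis
    have nxJ: "nx ` J \<subseteq> J"
    proof
      fix l assume "l \<in> nx ` J"
      then obtain j where "j \<in> J" "l = nx j" by (rule imageE)
      then have "m l \<noteq> m' l" using nx[of j] by auto
      then show "l \<in> J" unfolding J_def by simp
    qed
    obtain K where K: "K \<subseteq> J" "K \<noteq> {}" "bij_betw nx K K"
      using self_map_cycle[OF finite False nxJ] by (elim exE conjE)
    \<comment> \<open>Component \<open>nx j\<close> receives the variable that component \<open>j\<close> gives away.\<close>
    define q where "q = (\<lambda>j. p (inv_into K nx j))"
    have qnx: "q (nx j) = p j" if "j \<in> K" for j
      using that K(3) unfolding q_def bij_betw_def by simp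
    have q: "dg (m j) (q j) < dg (m' j) (q j)" if "j \<in> K" for j
    proof -
      obtain l where l: "l \<in> K" "j = nx l" using \<open>j \<in> K\<close> K(3) unfolding bij_betw_def by blast
      show ?thesis using nx[of l] K(1) l qnx[OF l(1)] by auto
    qed
    have "\<exists>f C. m j = f + sum_mset C \<and> size C = k \<and> f \<in> Bs j \<and> set_mset C \<subseteq> Bs j \<and>
      (j \<in> K \<longrightarrow> 0 < dg f (p j) \<and> exchange (p j) (q j) f \<in> Bs j)" for j
    proof (cases "j \<in> K")
      case True
      have pj: "dg (sum_mset (M' j)) (p j) < dg (sum_mset (M j)) (p j)"
        unfolding M(3)[symmetric] M'(3)[symmetric] using p True K(1) by blast
      have qj: "dg (sum_mset (M j)) (q j) < dg (sum_mset (M' j)) (q j)"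
        unfolding M(3)[symmetric] M'(3)[symmetric] by (rule q[OF True])
      have sj: "size (M j) = size (M' j)" by (simp add: M(1) M'(1))
      show ?thesis
      proof (rule SEP_power_exchange[OF SEP M(2) M'(2) sj pj qj])
        fix f C assume "sum_mset (M j) = f + sum_mset C" "size (M j) = Suc (size C)" "f \<in> Bs j"
          "set_mset C \<subseteq> Bs j" "0 < dg f (p j)" "exchange (p j) (q j) f \<in> Bs j"
        then show ?thesis using M(1)[of j] by (intro exI[of _ f] exI[of _ C]) (simp add: M(3))
      qed
    next
      case False
      obtain f C where "M j = add_mset f C" using M(1)[of j] by (auto dest: size_eq_Suc_imp_eq_union)
      then show ?thesis using False M(1)[of j] M(2)[of j] by (intro exI[of _ f] exI[of _ C]) (simp add: M(3))
    qed
    then obtain f C where fC: "\<And>j. m j = f j + sum_mset (C j)" "\<And>j. size (C j) = k" "\<And>j. f j \<in> Bs j"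
      "\<And>j. set_mset (C j) \<subseteq> Bs j" "\<And>j. j \<in> K \<Longrightarrow> 0 < dg (f j) (p j)"
      "\<And>j. j \<in> K \<Longrightarrow> exchange (p j) (q j) (f j) \<in> Bs j"
      by metis
    define g where "g = (\<lambda>j. if j \<in> K then exchange (p j) (q j) (f j) else f j)"
    define r where "r = (\<lambda>j. sum_mset (C j))"
    have gB: "g j \<in> Bs j" for j using fC(3,6) by (simp add: g_def)
    have r: "r j \<in> mono_power k (Bs j)" for j
      unfolding mono_prod_power r_def using fC(2,4) by blast
    have g1: "g j + (if j \<in> K then var (p j) else 0) = f j + (if j \<in> K then var (q j) else 0)" for j
      using exchange_add[OF fC(5)] by (simp add: g_def)
    have "(\<Sum>j\<in>UNIV. (if j \<in> K then var (p j) else 0)) = (\<Sum>j\<in>UNIV. (if j \<in> K then var (q j) else 0))"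
    proof -
      have "(\<Sum>j\<in>K. var (q j)) = (\<Sum>j\<in>K. var (q (nx j)))"
        by (rule sum.reindex_bij_betw[OF K(3), symmetric])
      also have "\<dots> = (\<Sum>j\<in>K. var (p j))" by (intro sum.cong) (simp_all add: qnx)
      finally show ?thesis by (simp add: sum.If_cases)
    qed
    moreover have "(\<Sum>j\<in>UNIV. g j) + (\<Sum>j\<in>UNIV. (if j \<in> K then var (p j) else 0)) =
        (\<Sum>j\<in>UNIV. f j) + (\<Sum>j\<in>UNIV. (if j \<in> K then var (q j) else 0))"
      unfolding sum.distrib[symmetric] g1 ..
    ultimately have sum_fg: "(\<Sum>j\<in>UNIV. f j) = (\<Sum>j\<in>UNIV. g j)" by simp
    define m2 where "m2 = (\<lambda>j. g j + r j)"
    have "R (\<lambda>j. f j + r j) (\<lambda>j. g j + r j)" by (rule move[OF fC(3) gB r sum_fg])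
    moreover have "m = (\<lambda>j. f j + r j)" by (rule ext) (simp add: fC(1) r_def)
    ultimately have R1: "R m m2" unfolding m2_def by simp
    have m2: "m2 j \<in> mono_power (Suc k) (Bs j)" for j
      unfolding mono_prod_power m2_def r_def
      by (rule exI[of _ "add_mset (g j) (C j)"]) (use gB fC(2,4) in simp)
    have dist: "monom_dist (m2 j) (m' j) < monom_dist (m j) (m' j)" if "j \<in> K" for j
    proof (rule monom_dist_exchange)
      show "m2 j + var (p j) = m j + var (q j)"
      proof -
        have "(g j + var (p j)) + r j = (f j + var (q j)) + r j" using g1[of j] that by simp
        then show ?thesis unfolding m2_def fC(1) r_def by (simp only: add_ac)
      qed
      show "dg (m' j) (p j) < dg (m j) (p j)" using p that K(1) by blast
      show "dg (m j) (q j) < dg (m' j) (q j)" by (rule q[OF that])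
    qed
    have "(\<Sum>j\<in>UNIV. monom_dist (m2 j) (m' j)) < (\<Sum>j\<in>UNIV. monom_dist (m j) (m' j))"
    proof (rule sum_strict_mono_ex1)
      show "\<forall>j\<in>UNIV. monom_dist (m2 j) (m' j) \<le> monom_dist (m j) (m' j)"
      proof
        fix j show "monom_dist (m2 j) (m' j) \<le> monom_dist (m j) (m' j)"
        proof (cases "j \<in> K")
          case True then show ?thesis using dist by (simp add: less_imp_le)
        next
          case False
          then have "m2 j = m j" using fC(1)[of j] by (simp add: m2_def g_def r_def)
          then show ?thesis by simp
        qed
      qed
      show "\<exists>j\<in>UNIV. monom_dist (m2 j) (m' j) < monom_dist (m j) (m' j)" using K(2) dist by blast
    qed simp
    moreover have "(\<Sum>j\<in>UNIV. m2 j) = (\<Sum>j\<in>UNIV. m' j)"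
    proof -
      have "(\<Sum>j\<in>UNIV. m2 j) = (\<Sum>j\<in>UNIV. f j + r j)"
        unfolding m2_def sum.distrib sum_fg ..
      also have "\<dots> = (\<Sum>j\<in>UNIV. m j)" by (simp add: fC(1) r_def)
      finally show ?thesis using less.prems(2) by simp
    qed
    ultimately have "R m2 m'" using less.hyps[of m2] m2 by blast
    then show ?thesis by (rule trans[OF R1])
  qed
qed

section \<open>Linear and bilinear extension of maps on finitely supported functions\<close>

lemma poly_mapping_additive_induct [case_names single add]:
  fixes p :: "'a \<Rightarrow>\<^sub>0 'b::monoid_add"
  assumes "\<And>r a. P (single r a)" "\<And>p q. P p \<Longrightarrow> P q \<Longrightarrow> P (p + q)"
  shows "P p"
proof (induction p rule: update_induct)
  case const
  show ?case using assms(1)[of _ 0] by simp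
next
  case (update f a b)
  have "Poly_Mapping.update a b f = single a b + f"
    using update.hyps(1)
    by (intro poly_mapping_eqI)
      (auto simp: lookup_update lookup_add lookup_single when_def in_keys_iff)
  then show ?case using assms update.IH by simp
qed

definition lin_ext :: "('a \<Rightarrow> 'b::zero \<Rightarrow> 'c::comm_monoid_add) \<Rightarrow> ('a \<Rightarrow>\<^sub>0 'b) \<Rightarrow> 'c" where
  "lin_ext F p = (\<Sum>r\<in>keys p. F r (lookup p r))"

definition additive_family :: "('a \<Rightarrow> 'b::monoid_add \<Rightarrow> 'c::monoid_add) \<Rightarrow> bool" where
  "additive_family F \<longleftrightarrow> (\<forall>r. F r 0 = 0) \<and> (\<forall>r a b. F r (a + b) = F r a + F r b)"

lemma lin_ext_zero [simp]: "lin_ext F 0 = 0"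
  by (simp add: lin_ext_def)

lemma lin_ext_add: "additive_family F \<Longrightarrow> lin_ext F (p + q) = lin_ext F p + lin_ext F q"
  unfolding lin_ext_def additive_family_def by (rule setsum_keys_plus_distrib) simp_all

lemma lin_ext_single [simp]:
  "additive_family F \<Longrightarrow> lin_ext F (single r a) = F r a"
  by (simp add: lin_ext_def additive_family_def)

text \<open>
  The bilinear product determined by a product \<open>f\<close> of indices and a product \<open>m\<close> of coefficients.
  Multiplication of polynomials, of tensors and in the direct sum that covers the Segre product are
  all of this form, so that their laws and the multiplicativity of linear extensions need only be
  shown once.
\<close>

definition conv :: "('a \<Rightarrow> 'b \<Rightarrow> 'c) \<Rightarrow> ('k::zero \<Rightarrow> 'l::zero \<Rightarrow> 'm::comm_monoid_add) \<Rightarrow>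
    ('a \<Rightarrow>\<^sub>0 'k) \<Rightarrow> ('b \<Rightarrow>\<^sub>0 'l) \<Rightarrow> ('c \<Rightarrow>\<^sub>0 'm)" where
  "conv f m p q = (\<Sum>r\<in>keys p. \<Sum>t\<in>keys q.
     single (f r t) (m (lookup p r) (lookup q t)))"

definition biadditive :: "('k::monoid_add \<Rightarrow> 'l::monoid_add \<Rightarrow> 'm::monoid_add) \<Rightarrow> bool" where
  "biadditive m \<longleftrightarrow> (\<forall>a. m a 0 = 0) \<and> (\<forall>a. m 0 a = 0) \<and>
     (\<forall>a b c. m (a + b) c = m a c + m b c) \<and> (\<forall>a b c. m a (b + c) = m a b + m a c)"

lemma biadditiveD:
  assumes "biadditive m"
  shows "m a 0 = 0" "m 0 b = 0" "m (a + a') b = m a b + m a' b" "m a (b + b') = m a b + m a b'"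
  using assms unfolding biadditive_def by blast+

context
  fixes m :: "'k::comm_monoid_add \<Rightarrow> 'l::comm_monoid_add \<Rightarrow> 'm::comm_monoid_add" and f :: "'a \<Rightarrow> 'b \<Rightarrow> 'c"
  assumes m: "biadditive m"
begin

lemma conv_inner_additive: "additive_family (\<lambda>t b. single (f r t) (m a b))"
  by (simp add: additive_family_def biadditiveD[OF m] single_add)

lemma conv_outer_additive:
  "additive_family (\<lambda>r a. lin_ext (\<lambda>t b. single (f r t) (m a b)) q)"
  unfolding additive_family_def
proof (intro conjI allI)
  show "lin_ext (\<lambda>t b. single (f r t) (m 0 b)) q = 0" for r
    by (simp add: lin_ext_def biadditiveD[OF m])
  show "lin_ext (\<lambda>t b. single (f r t) (m (a + a') b)) q =
      lin_ext (\<lambda>t b. single (f r t) (m a b)) q +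
      lin_ext (\<lambda>t b. single (f r t) (m a' b)) q" for r a a'
    by (simp add: lin_ext_def biadditiveD[OF m] single_add sum.distrib)
qed

lemma conv_lin_ext:
  "conv f m p q = lin_ext (\<lambda>r a. lin_ext (\<lambda>t b. single (f r t) (m a b)) q) p"
  by (simp add: conv_def lin_ext_def)

lemma conv_add_left: "conv f m (p + p') q = conv f m p q + conv f m p' q"
  unfolding conv_lin_ext by (rule lin_ext_add[OF conv_outer_additive])

lemma conv_add_right: "conv f m p (q + q') = conv f m p q + conv f m p q'"
  unfolding conv_lin_ext lin_ext_add[OF conv_inner_additive] by (simp add: lin_ext_def sum.distrib)

lemma conv_zero [simp]: "conv f m p 0 = 0" "conv f m 0 q = 0"
  by (simp_all add: conv_def)

lemma biadditive_conv: "biadditive (conv f m)"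
  by (simp add: biadditive_def conv_add_left conv_add_right)

lemma conv_single [simp]:
  "conv f m (single r a) (single t b) = single (f r t) (m a b)"
  unfolding conv_lin_ext
  by (subst lin_ext_single[OF conv_outer_additive], rule lin_ext_single[OF conv_inner_additive])

end

lemma conv_assoc:
  fixes m :: "'k \<Rightarrow> 'k \<Rightarrow> 'k::comm_monoid_add"
  assumes m: "biadditive m" and "\<And>r s t. f (f r s) t = f r (f s t)" "\<And>a b c. m (m a b) c = m a (m b c)"
  shows "conv f m (conv f m p q) z = conv f m p (conv f m q z)"
proof (induction p rule: poly_mapping_additive_induct)
  case (single r a)
  show ?case
  proof (induction q rule: poly_mapping_additive_induct)
    case (single s b)
    show ?case
      by (induction z rule: poly_mapping_additive_induct) (simp_all add: m conv_add_right assms(2,3))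
  qed (simp add: m conv_add_left conv_add_right)
qed (simp add: m conv_add_left)

lemma conv_commute:
  fixes m :: "'k \<Rightarrow> 'k \<Rightarrow> 'k::comm_monoid_add"
  assumes m: "biadditive m" and "\<And>r s. f r s = f s r" "\<And>a b. m a b = m b a"
  shows "conv f m p q = conv f m q p"
proof (induction p rule: poly_mapping_additive_induct)
  case (single r a)
  show ?case
  proof (induction q rule: poly_mapping_additive_induct)
    case (single s b)
    show ?case by (simp add: m assms(2)[of r s] assms(3)[of a b])
  qed (simp add: m conv_add_left conv_add_right)
qed (simp add: m conv_add_left conv_add_right)

lemma conv_one:
  fixes m :: "'k \<Rightarrow> 'k \<Rightarrow> 'k::comm_monoid_add"
  assumes m: "biadditive m" and "\<And>r. f e r = r" "\<And>a. m u a = a"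
  shows "conv f m (single e u) q = q"
  by (induction q rule: poly_mapping_additive_induct) (simp_all add: m conv_add_right assms(2,3))

lemma lin_ext_conv:
  fixes F :: "'a \<Rightarrow> 'k::comm_monoid_add \<Rightarrow> 'r::semiring_0" and m :: "'k \<Rightarrow> 'k \<Rightarrow> 'k"
  assumes m: "biadditive m" and F: "additive_family F"
    and hom: "\<And>r t a b. F (f r t) (m a b) = F r a * F t b"
  shows "lin_ext F (conv f m p q) = lin_ext F p * lin_ext F q"
proof (induction p rule: poly_mapping_additive_induct)
  case (single r a)
  show ?case
    by (induction q rule: poly_mapping_additive_induct)
      (simp_all add: m F hom conv_add_right lin_ext_add distrib_left)
qed (simp add: m F conv_add_left lin_ext_add distrib_right)

lemma biadditive_times: "biadditive (times :: 'a::semiring_0 \<Rightarrow> _)"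
  by (simp add: biadditive_def algebra_simps)

lemma times_eq_conv:
  fixes p q :: "'a::monoid_add \<Rightarrow>\<^sub>0 'k::semiring_0"
  shows "p * q = conv plus times p q"
proof (induction p rule: poly_mapping_additive_induct)
  case (single r a)
  show ?case
    by (induction q rule: poly_mapping_additive_induct)
      (simp_all add: mult_single biadditive_times conv_add_right distrib_left)
qed (simp add: biadditive_times conv_add_left distrib_right)

section \<open>Scalar multiplication\<close>

lemma lookup_smul [simp]: "lookup (smul c p) k = c * lookup p k"
  by (simp add: smul_def map.rep_eq when_def)

interpretation pm: Modules.module smul
  by unfold_locales (auto intro!: poly_mapping_eqI simp: lookup_add algebra_simps)

lemma smul_eq_times:
  fixes p :: "'a::monoid_add \<Rightarrow>\<^sub>0 'k::comm_ring_1"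
  shows "smul c p = single 0 c * p"
  unfolding smul_def by (rule mult_map_scale_conv_mult)

lemma smul_single [simp]: "smul c (single r a) = single r (c * a)"
  by (simp add: smul_def)

lemma smul_mult:
  fixes p :: "'a::comm_monoid_add \<Rightarrow>\<^sub>0 'k::comm_ring_1"
  shows "smul a p * smul b q = smul (a * b) (p * q)"
proof -
  have "single 0 (a * b) = single (0::'a) a * single 0 b"
    by (simp add: mult_single)
  then show ?thesis unfolding smul_eq_times by (simp add: ac_simps)
qed

lemma monomial_mult: "monomial f * monomial g = monomial (f + g)"
  by (simp add: monomial_def mult_single)

lemma monomial_0: "monomial 0 = 1"
  by (simp add: monomial_def)

lemma monomial_prod: "(\<Prod>j\<in>J. monomial (f j)) = monomial (\<Sum>j\<in>J. f j)"
  by (induction J rule: infinite_finite_induct) (simp_all add: monomial_mult monomial_0)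

lemma span_monomials:
  "pm.span (monomial ` U) = {p :: ('v, 'k::comm_ring_1) mpoly. keys p \<subseteq> U}" (is "?l = ?r")
proof
  have "pm.subspace ?r"
  proof (rule pm.subspaceI)
    show "x + y \<in> ?r" if "x \<in> ?r" "y \<in> ?r" for x y using that keys_add[of x y] by blast
    show "smul c x \<in> ?r" if "x \<in> ?r" for c x
    proof -
      have "keys (smul c x) \<subseteq> keys x" by (auto simp: in_keys_iff)
      then show ?thesis using that by blast
    qed
  qed simp
  moreover have "monomial ` U \<subseteq> ?r" by (auto simp: monomial_def split: if_splits)
  ultimately show "?l \<subseteq> ?r" by (intro pm.span_minimal)
  show "?r \<subseteq> ?l"
  proof
    fix p :: "('v, 'k) mpoly" assume "p \<in> ?r"
    then have p: "keys p \<subseteq> U" by simp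
    have "p = (\<Sum>u\<in>keys p. smul (lookup p u) (monomial u))"
      by (intro poly_mapping_eqI)
        (auto simp: lookup_sum monomial_def lookup_single when_def in_keys_iff if_distrib sum.delta cong: if_cong)
    also have "\<dots> \<in> ?l"
      by (intro pm.span_sum pm.span_scale pm.span_base) (use p in auto)
    finally show "p \<in> ?l" .
  qed
qed

text \<open>
  Choosing a generator over each monomial defines a linear map \<open>\<sigma>\<close> in the opposite direction. For
  every generator \<open>a\<close>, and hence for every element \<open>a\<close> of the span, \<open>a - \<sigma> (\<Phi> a)\<close> lies in \<open>L\<close>: it is a
  difference of two generators over the same monomial, unless \<open>a\<close> is one of the generators in \<open>L\<close>
  that \<open>\<Phi>\<close> sends to zero.
\<close>

lemma kernel_of_map_to_monomials:
  fixes sc :: "'k::comm_ring_1 \<Rightarrow> 'w::ab_group_add \<Rightarrow> 'w" and \<Phi> :: "'w \<Rightarrow> ('v, 'k) mpoly"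
  assumes "Modules.module sc"
    and add: "\<And>x y. \<Phi> (x + y) = \<Phi> x + \<Phi> y" and scale: "\<And>c x. \<Phi> (sc c x) = smul c (\<Phi> x)"
    and L: "Modules.module.subspace sc L"
    and E: "\<And>a. a \<in> E \<Longrightarrow> (\<Phi> a = 0 \<and> a \<in> L) \<or> (\<exists>v. \<Phi> a = monomial v)"
    and diff: "\<And>a b v. a \<in> E \<Longrightarrow> b \<in> E \<Longrightarrow> \<Phi> a = monomial v \<Longrightarrow> \<Phi> b = monomial v \<Longrightarrow> a - b \<in> L"
    and y: "y \<in> Modules.module.span sc E" and "\<Phi> y = 0"
  shows "y \<in> L"
proof -
  interpret W: Modules.module sc by fact
  have L0: "0 \<in> L" and Ladd: "\<And>x y. x \<in> L \<Longrightarrow> y \<in> L \<Longrightarrow> x + y \<in> L" and Lsc: "\<And>c x. x \<in> L \<Longrightarrow> sc c x \<in> L"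
    using L unfolding W.subspace_def by blast+
  define \<rho> where "\<rho> = (\<lambda>v. SOME a. a \<in> E \<and> \<Phi> a = monomial v)"
  define \<sigma> where "\<sigma> = lin_ext (\<lambda>v c. sc c (\<rho> v))"
  have fam: "additive_family (\<lambda>v c. sc c (\<rho> v))" by (simp add: additive_family_def W.scale_left_distrib)
  have \<sigma>_scale: "\<sigma> (smul c p) = sc c (\<sigma> p)" for c p
    by (induction p rule: poly_mapping_additive_induct)
      (simp_all add: \<sigma>_def fam lin_ext_add pm.scale_right_distrib W.scale_right_distrib)
  have \<Phi>0: "\<Phi> 0 = 0" using scale[of 0 0] by simp
  have "y - \<sigma> (\<Phi> y) \<in> L"
    using y
  proof (induction rule: W.span_induct_alt)
    case base
    show ?case using L0 by (simp add: \<Phi>0 \<sigma>_def)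
  next
    case (step c a y)
    have "a - \<sigma> (\<Phi> a) \<in> L"
    proof (cases "\<exists>v. \<Phi> a = monomial v")
      case True
      then obtain v where v: "\<Phi> a = monomial v" by blast
      have "\<rho> v \<in> E \<and> \<Phi> (\<rho> v) = monomial v"
        unfolding \<rho>_def
        by (rule someI[where P = "\<lambda>a. a \<in> E \<and> \<Phi> a = monomial v" and x = a]) (use step.hyps(1) v in simp)
      moreover have "\<sigma> (\<Phi> a) = \<rho> v" by (simp add: v \<sigma>_def monomial_def fam)
      ultimately show ?thesis using diff[of a "\<rho> v" v] step.hyps(1) v by simp
    next
      case False
      then show ?thesis using E[OF step.hyps(1)] by (auto simp: \<sigma>_def)
    qed
    then have "sc c (a - \<sigma> (\<Phi> a)) + (y - \<sigma> (\<Phi> y)) \<in> L" by (intro Ladd Lsc step.IH)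
    moreover have "sc c a + y - \<sigma> (\<Phi> (sc c a + y)) = sc c (a - \<sigma> (\<Phi> a)) + (y - \<sigma> (\<Phi> y))"
      by (simp add: add scale \<sigma>_scale[symmetric] W.scale_right_diff_distrib)
        (simp add: \<sigma>_def lin_ext_add[OF fam])
    ultimately show ?case by (simp only:)
  qed
  then show ?thesis using \<open>\<Phi> y = 0\<close> by (simp add: \<sigma>_def)
qed

section \<open>The toric ideal\<close>

lemma alg_on_simps [simp]:
  "carrier (alg_on S) = S" "p \<otimes>\<^bsub>alg_on S\<^esub> q = p * q" "\<one>\<^bsub>alg_on S\<^esub> = 1" "\<zero>\<^bsub>alg_on S\<^esub> = 0"
  "p \<oplus>\<^bsub>alg_on S\<^esub> q = p + q" "c \<odot>\<^bsub>alg_on S\<^esub> p = smul c p"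
  by (simp_all add: alg_on_def)

lemma cring_alg_on:
  assumes "0 \<in> S" "1 \<in> S" "\<And>p q. p \<in> S \<Longrightarrow> q \<in> S \<Longrightarrow> p + q \<in> S" "\<And>p. p \<in> S \<Longrightarrow> - p \<in> S"
    "\<And>p q. p \<in> S \<Longrightarrow> q \<in> S \<Longrightarrow> p * q \<in> S"
  shows "cring (alg_on S)"
proof (rule cringI)
  show "abelian_group (alg_on S)"
    by (rule abelian_groupI) (use assms in \<open>auto simp: algebra_simps intro: bexI[of _ "- _"]\<close>)
  show "Group.comm_monoid (alg_on S)"
    by (rule comm_monoidI) (use assms in \<open>auto simp: algebra_simps\<close>)
qed (simp add: distrib_right)

lemma carrier_poly_alg: "carrier (poly_alg V) = {p. \<forall>m\<in>keys p. keys m \<subseteq> V}"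
  by (simp add: poly_alg_def)

lemma poly_alg_simps [simp]:
  "p \<otimes>\<^bsub>poly_alg V\<^esub> q = p * q" "\<one>\<^bsub>poly_alg V\<^esub> = 1" "\<zero>\<^bsub>poly_alg V\<^esub> = 0"
  "p \<oplus>\<^bsub>poly_alg V\<^esub> q = p + q" "c \<odot>\<^bsub>poly_alg V\<^esub> p = smul c p" "carrier (poly_alg UNIV) = UNIV"
  by (simp_all add: poly_alg_def)

lemma cring_poly_alg: "cring (poly_alg V :: ('k::comm_ring_1, ('v, 'k) mpoly) module)"
proof -
  have keys_minus: "keys (- p) = keys p" for p :: "('v, 'k) mpoly"
    by (auto simp: in_keys_iff)
  show ?thesis
    unfolding poly_alg_def
  proof (rule cring_alg_on; clarify?)
  fix p q :: "('v, 'k) mpoly" and m :: "'v monom" and x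
  assume *: "\<forall>m\<in>keys p. keys m \<subseteq> V" "\<forall>m\<in>keys q. keys m \<subseteq> V"
    "x \<in> keys m"
  {
    assume "m \<in> keys (p + q)"
    then show "x \<in> V" using keys_add[of p q] * by blast
  next
    assume "m \<in> keys (p * q)"
    then obtain a b where "m = a + b" "a \<in> keys p" "b \<in> keys q"
      using keys_mult[of p q] by blast
    then show "x \<in> V" using keys_add[of a b] * by blast
  }
  qed (auto simp: keys_minus)
qed

text \<open>
  Multisets of elements of \<open>B\<close> are the form in which the combinatorial results speak about the
  monomials of \<open>K[Y]\<close>.
\<close>

definition ymon :: "'v monom multiset \<Rightarrow> ('v monom, 'k::comm_ring_1) mpoly" where
  "ymon M = monomial (\<Sum>f\<in>#M. var f)"

lemma ymon_add: "ymon (M + N) = ymon M * ymon N"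
  by (simp add: ymon_def monomial_mult)

lemma ymon_empty [simp]: "ymon {#} = 1"
  by (simp add: ymon_def monomial_0)

lemma ymon_single: "ymon {#f#} = yvar f"
  by (simp add: ymon_def yvar_def)

lemma dg_sum_vars: "dg (\<Sum>f\<in>#M. var f) x = count M x"
  by (induction M) (auto simp: lookup_add dg_var)

lemma keys_sum_vars: "keys (\<Sum>f\<in>#M. var f) = set_mset M"
  by (auto simp: in_keys_iff dg_sum_vars)

lemma monom_eq_sum_vars: "\<exists>M. m = (\<Sum>f\<in>#M. var f)"
proof (induction m rule: poly_mapping_additive_induct)
  case (single f n)
  have "single f n = (\<Sum>x\<in>#replicate_mset n f. var x)"
    by (rule poly_mapping_eqI) (simp only: dg_sum_vars, simp add: lookup_single when_def)
  then show ?case by blast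
next
  case (add p q)
  then obtain M N where "p = (\<Sum>f\<in>#M. var f)" "q = (\<Sum>f\<in>#N. var f)" by blast
  then have "p + q = (\<Sum>f\<in>#M + N. var f)" by simp
  then show ?case by blast
qed

lemma carrier_poly_alg_span:
  "carrier (poly_alg B :: ('k::comm_ring_1, ('v monom, 'k) mpoly) module) = pm.span (ymon ` {M. set_mset M \<subseteq> B})"
proof -
  have "ymon ` {M. set_mset M \<subseteq> B} = (monomial :: _ \<Rightarrow> ('v monom, 'k) mpoly) ` {m. keys m \<subseteq> B}"
  proof (intro equalityI subsetI)
    fix p :: "('v monom, 'k) mpoly"
    assume "p \<in> monomial ` {m. keys m \<subseteq> B}"
    then obtain m where m: "p = monomial m" "keys m \<subseteq> B" by blast
    obtain M where "m = (\<Sum>f\<in>#M. var f)" using monom_eq_sum_vars by blast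
    then have "p = ymon M" "set_mset M \<subseteq> B" using m keys_sum_vars[of M] by (simp_all add: ymon_def)
    then show "p \<in> ymon ` {M. set_mset M \<subseteq> B}" by blast
  qed (auto simp: ymon_def keys_sum_vars)
  then show ?thesis by (auto simp: span_monomials carrier_poly_alg)
qed

text \<open>
  The exponent vector of the image of a monomial of \<open>K[Y]\<close>.
\<close>

definition toric_weight :: "'v monom monom \<Rightarrow> 'v monom" where
  "toric_weight = lin_ext (\<lambda>f n. Poly_Mapping.map (times n) f)"

lemma toric_weight_family: "additive_family (\<lambda>(f::'v monom) n. Poly_Mapping.map (times n) f)"
  unfolding additive_family_def
  by (auto intro!: poly_mapping_eqI simp: map.rep_eq when_def lookup_add algebra_simps)

lemma toric_weight_add: "toric_weight (m + m') = toric_weight m + toric_weight m'"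
  unfolding toric_weight_def by (rule lin_ext_add[OF toric_weight_family])

lemma toric_weight_sum_vars: "toric_weight (\<Sum>f\<in>#M. var f) = sum_mset M"
proof (induction M)
  case (add f M)
  have "toric_weight (var f) = f"
    unfolding toric_weight_def lin_ext_single[OF toric_weight_family]
    by (auto intro!: poly_mapping_eqI simp: map.rep_eq when_def)
  then show ?case using add by (simp add: toric_weight_add)
qed (simp add: toric_weight_def)

lemma monomial_power: "monomial f ^ n = monomial (Poly_Mapping.map (times n) f)"
proof (induction n)
  case 0
  have *: "Poly_Mapping.map (times 0) f = 0" by (auto intro!: poly_mapping_eqI simp: map.rep_eq when_def)
  show ?case by (simp only: * power_0 monomial_0)
next
  case (Suc n)
  have "Poly_Mapping.map (times (Suc n)) f = f + Poly_Mapping.map (times n) f"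
    by (auto intro!: poly_mapping_eqI simp: map.rep_eq when_def lookup_add)
  then show ?case by (simp only: power_Suc Suc monomial_mult)
qed

lemma toric_map_lin_ext: "toric_map = lin_ext (\<lambda>m c. single (toric_weight m) c)"
  unfolding toric_map_def lin_ext_def toric_weight_def
  by (rule ext) (simp add: monomial_power monomial_prod, simp add: monomial_def)

lemma toric_map_family: "additive_family (\<lambda>m c. single (toric_weight m) c)"
  by (simp add: additive_family_def single_add)

lemma toric_map_add: "toric_map (p + q) = toric_map p + toric_map q"
  unfolding toric_map_lin_ext by (rule lin_ext_add[OF toric_map_family])

lemma toric_map_mult: "toric_map (p * q) = toric_map p * toric_map q"
  unfolding toric_map_lin_ext times_eq_conv[of p q]
  by (rule lin_ext_conv[OF biadditive_times toric_map_family])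
    (simp add: toric_weight_add mult_single)

lemma toric_map_ymon: "toric_map (ymon M) = monomial (sum_mset M)"
  by (simp add: toric_map_lin_ext ymon_def monomial_def toric_map_family toric_weight_sum_vars)

lemma toric_map_one: "toric_map 1 = 1"
  using toric_map_ymon[of "{#}"] by (simp add: monomial_0)

lemma toric_map_smul: "toric_map (smul c p) = smul c (toric_map p)"
  by (induction p rule: poly_mapping_additive_induct)
    (simp_all add: toric_map_add pm.scale_right_distrib, simp add: toric_map_lin_ext toric_map_family)

lemma ideal_toric_ideal: "ideal (toric_ideal B :: ('v monom, 'k::comm_ring_1) mpoly set) (poly_alg B)"
proof -
  interpret P: cring "poly_alg B :: ('k, ('v monom, 'k) mpoly) module" by (rule cring_poly_alg)
  interpret Q: cring "poly_alg UNIV :: ('k, ('v, 'k) mpoly) module" by (rule cring_poly_alg)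
  have "ring_hom_ring (poly_alg B) (poly_alg UNIV :: ('k, ('v, 'k) mpoly) module) toric_map"
    by (rule ring_hom_ringI) (unfold_locales, auto simp: toric_map_add toric_map_mult toric_map_one)
  then show ?thesis unfolding toric_ideal_def by (rule ring_hom_ring.kernel_is_ideal)
qed

lemma toric_ideal_eq: "toric_ideal B = {p \<in> carrier (poly_alg B). toric_map p = 0}"
  by (simp add: toric_ideal_def a_kernel_def' )

lemma ideal_poly_alg_closed:
  fixes I :: "('v, 'k::comm_ring_1) mpoly set"
  assumes "ideal I (poly_alg V)"
  shows "0 \<in> I" "x \<in> I \<Longrightarrow> y \<in> I \<Longrightarrow> x + y \<in> I" "x \<in> I \<Longrightarrow> p \<in> carrier (poly_alg V) \<Longrightarrow> p * x \<in> I"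
    "x \<in> I \<Longrightarrow> smul c x \<in> I" "x \<in> I \<Longrightarrow> - x \<in> I"
proof -
  interpret ideal I "poly_alg V" by fact
  show "0 \<in> I" using additive_subgroup.zero_closed[OF is_additive_subgroup] by simp
  show "x \<in> I \<Longrightarrow> y \<in> I \<Longrightarrow> x + y \<in> I" using additive_subgroup.a_closed[OF is_additive_subgroup, of x y] by simp
  show 1: "x \<in> I \<Longrightarrow> p \<in> carrier (poly_alg V) \<Longrightarrow> p * x \<in> I" for x p using I_l_closed[of x p] by simp
  have "single 0 c \<in> carrier (poly_alg V)" for c :: 'k
    by (simp add: carrier_poly_alg)
  then show 2: "smul c x \<in> I" if "x \<in> I" for c x using 1[OF that] unfolding smul_eq_times by blast
  have "- x = smul (- 1) x" by (intro poly_mapping_eqI) simp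
  then show "x \<in> I \<Longrightarrow> - x \<in> I" using 2[of x "- 1"] by simp
qed

lemma sym_exchange_relations_carrier:
  "sym_exchange_relations B \<subseteq> carrier (poly_alg B :: ('k::comm_ring_1, ('v monom, 'k) mpoly) module)"
proof -
  interpret P: cring "poly_alg B :: ('k, ('v monom, 'k) mpoly) module" by (rule cring_poly_alg)
  have y: "(yvar f :: ('v monom, 'k) mpoly) \<in> carrier (poly_alg B)" if "f \<in> B" for f
    using that unfolding ymon_single[symmetric] carrier_poly_alg_span by (intro pm.span_base) auto
  have "(yvar r * yvar s - yvar t * yvar u :: ('v monom, 'k) mpoly) \<in> carrier (poly_alg B)"
    if "r \<in> B" "s \<in> B" "t \<in> B" "u \<in> B" for r s t u
    using P.m_closed[OF y[OF that(1)] y[OF that(2)]] P.m_closed[OF y[OF that(3)] y[OF that(4)]]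
    unfolding carrier_poly_alg_span by (simp add: pm.span_diff)
  then show ?thesis unfolding sym_exchange_relations_def by blast
qed

lemma exch_conn_ideal:
  fixes I :: "('v monom, 'k::comm_ring_1) mpoly set"
  assumes "exch_conn B M N" and I: "ideal I (poly_alg B)" and "sym_exchange_relations B \<subseteq> I"
  shows "ymon M - ymon N \<in> I"
  using assms(1)
proof (induction rule: exch_conn.induct)
  case (exch_conn_refl M)
  show ?case using ideal_poly_alg_closed(1)[OF I] by simp
next
  case (exch_conn_sym M N)
  show ?case using ideal_poly_alg_closed(5)[OF I exch_conn_sym.IH] by simp
next
  case (exch_conn_trans M N P)
  show ?case using ideal_poly_alg_closed(2)[OF I exch_conn_trans.IH] by simp
next
  case (exch_conn_step C r s i j)
  have "(yvar r * yvar s - yvar (exchange i j r) * yvar (exchange j i s) :: ('v monom, 'k) mpoly) \<in> I"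
    using assms(3) exch_conn_step.hyps unfolding sym_exchange_relations_def by blast
  moreover have "(ymon C :: ('v monom, 'k) mpoly) \<in> carrier (poly_alg B)"
    unfolding carrier_poly_alg_span using exch_conn_step.hyps(1) by (intro pm.span_base) simp
  ultimately have "ymon C * (yvar r * yvar s - yvar (exchange i j r) * yvar (exchange j i s)) \<in> I"
    by (rule ideal_poly_alg_closed(3)[OF I])
  moreover have "(ymon {#x, y#} :: ('v monom, 'k) mpoly) = yvar x * yvar y" for x y
    using ymon_add[of "{#x#}" "{#y#}"] by (simp add: ymon_single add_mset_commute)
  ultimately show ?case by (simp only: ymon_add right_diff_distrib)
qed

text \<open>
  Equal images of two monomials of \<open>K[Y]\<close> force equal degrees, because the elements of \<open>B\<close> have the
  same positive degree, and so the two multisets are joined by symmetric exchanges.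
\<close>

proposition toric_ideal_generated:
  fixes B :: "'n::finite monom set"
  assumes B: "strongly_orderable B" and deg: "\<And>f. f \<in> B \<Longrightarrow> mono_deg f = d" and d: "d > 0"
  shows "(toric_ideal B :: ('n monom, 'k::comm_ring_1) mpoly set) =
    genideal (poly_alg B) (sym_exchange_relations B)" (is "_ = ?I")
proof
  interpret P: cring "poly_alg B :: ('k, ('n monom, 'k) mpoly) module" by (rule cring_poly_alg)
  have I: "ideal ?I (poly_alg B)" by (rule P.genideal_ideal[OF sym_exchange_relations_carrier])
  have sub: "sym_exchange_relations B \<subseteq> ?I" by (rule P.genideal_self[OF sym_exchange_relations_carrier])
  have "sym_exchange_relations B \<subseteq> (toric_ideal B :: ('n monom, 'k) mpoly set)"
  proof
    fix p :: "('n monom, 'k) mpoly" assume p: "p \<in> sym_exchange_relations B"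
    then obtain r s i j where rs: "p = yvar r * yvar s - yvar (exchange i j r) * yvar (exchange j i s)"
       "exchangeable i j r s" unfolding sym_exchange_relations_def by blast
    have tm: "toric_map (yvar x * yvar y) = (monomial (x + y) :: ('n, 'k) mpoly)" for x y
      unfolding toric_map_mult ymon_single[symmetric] toric_map_ymon by (simp add: monomial_mult)
    have "toric_map p + toric_map (yvar (exchange i j r) * yvar (exchange j i s)) = toric_map (yvar r * yvar s)"
      unfolding toric_map_add[symmetric] rs(1) by simp
    then have "toric_map p = 0" unfolding tm exchange_sum[OF rs(2)] by simp
    then show "p \<in> toric_ideal B" using p sym_exchange_relations_carrier by (auto simp: toric_ideal_eq)
  qed
  then show "?I \<subseteq> toric_ideal B" by (rule P.genideal_minimal[OF ideal_toric_ideal])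
  show "toric_ideal B \<subseteq> ?I"
  proof
    fix p :: "('n monom, 'k) mpoly" assume "p \<in> toric_ideal B"
    then have p: "p \<in> carrier (poly_alg B)" "toric_map p = 0" by (simp_all add: toric_ideal_eq)
    show "p \<in> ?I"
    proof (rule kernel_of_map_to_monomials[where \<Phi> = toric_map and E = "ymon ` {M. set_mset M \<subseteq> B}"])
      show "Modules.module (smul :: 'k \<Rightarrow> ('n monom, 'k) mpoly \<Rightarrow> _)" by (rule pm.module_axioms)
      show "pm.subspace ?I"
        unfolding pm.subspace_def using ideal_poly_alg_closed[OF I] by blast
      show "p \<in> pm.span (ymon ` {M. set_mset M \<subseteq> B})" using p(1) by (simp add: carrier_poly_alg_span)
      show "toric_map p = 0" by (rule p(2))
      fix a b :: "('n monom, 'k) mpoly" and v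
      assume a: "a \<in> ymon ` {M. set_mset M \<subseteq> B}"
      then show "(toric_map a = 0 \<and> a \<in> ?I) \<or> (\<exists>v. toric_map a = monomial v)"
        by (auto simp: toric_map_ymon)
      assume b: "b \<in> ymon ` {M. set_mset M \<subseteq> B}" and v: "toric_map a = monomial v" "toric_map b = monomial v"
      obtain M N where MN: "a = ymon M" "b = ymon N" "set_mset M \<subseteq> B" "set_mset N \<subseteq> B" using a b by blast
      have "monomial (sum_mset M) = (monomial (sum_mset N) :: ('n, 'k) mpoly)"
        using v unfolding MN toric_map_ymon by simp
      then have eq: "sum_mset M = sum_mset N" unfolding monomial_def
        by (metis lookup_single_eq lookup_single_not_eq zero_neq_one)
      have deg_sum: "mono_deg (sum_mset X) = size X * d" if "set_mset X \<subseteq> B" for X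
        using that by (induction X) (auto simp: mono_deg_add deg)
      have "size M = size N" using deg_sum[OF MN(3)] deg_sum[OF MN(4)] eq d by simp
      then have "exch_conn B M N" by (rule strongly_orderable_exch_conn[OF B MN(3,4) _ eq])
      then show "a - b \<in> ?I" unfolding MN by (rule exch_conn_ideal[OF _ I sub])
    qed (simp_all add: toric_map_add toric_map_smul)
  qed
qed

section \<open>Quotient algebras\<close>

lemma quot_alg_simps:
  "carrier (quot_alg A I) = carrier (A Quot I)" "x \<otimes>\<^bsub>quot_alg A I\<^esub> y = x \<otimes>\<^bsub>A Quot I\<^esub> y"
  "\<one>\<^bsub>quot_alg A I\<^esub> = \<one>\<^bsub>A Quot I\<^esub>" "x \<oplus>\<^bsub>quot_alg A I\<^esub> y = x \<oplus>\<^bsub>A Quot I\<^esub> y" "\<zero>\<^bsub>quot_alg A I\<^esub> = \<zero>\<^bsub>A Quot I\<^esub>"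
  "c \<odot>\<^bsub>quot_alg A I\<^esub> X = (\<Union>x\<in>X. I +>\<^bsub>A\<^esub> (c \<odot>\<^bsub>A\<^esub> x))"
  by (simp_all add: quot_alg_def ring.defs module.defs)

lemma cring_quot_alg:
  assumes "cring A" "ideal I A" shows "cring (quot_alg A I)"
proof -
  interpret Q: cring "A Quot I" by (rule ideal.quotient_is_cring[OF assms(2,1)])
  show ?thesis
  proof (rule cringI)
    show "abelian_group (quot_alg A I)"
    proof (rule abelian_groupI)
      fix x assume "x \<in> carrier (quot_alg A I)"
      then show "\<exists>y\<in>carrier (quot_alg A I). y \<oplus>\<^bsub>quot_alg A I\<^esub> x = \<zero>\<^bsub>quot_alg A I\<^esub>"
        by (intro bexI[of _ "\<ominus>\<^bsub>A Quot I\<^esub> x"]) (simp_all add: quot_alg_simps Q.l_neg)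
    qed (simp_all add: quot_alg_simps Q.a_ac)
    show "Group.comm_monoid (quot_alg A I)"
      by (rule comm_monoidI) (simp_all add: quot_alg_simps Q.m_ac)
  qed (simp add: quot_alg_simps Q.l_distr)
qed

lemma quot_alg_carrier: "carrier (quot_alg A I) = (\<lambda>x. I +>\<^bsub>A\<^esub> x) ` carrier A"
  by (auto simp: quot_alg_simps FactRing_def A_RCOSETS_def')

lemma quot_alg_hom:
  assumes "ideal I A" shows "(\<lambda>x. I +>\<^bsub>A\<^esub> x) \<in> ring_hom A (quot_alg A I)"
  using ideal.rcos_ring_hom[OF assms] by (simp add: ring_hom_def quot_alg_simps)

lemma graded_alg_iso_quot:
  assumes A: "cring A" and B: "cring B" and h: "h \<in> ring_hom A B" and surj: "h ` carrier A = carrier B"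
    and ker: "a_kernel A B h = I"
    and smul: "\<And>c x. x \<in> carrier A \<Longrightarrow> c \<odot>\<^bsub>A\<^esub> x \<in> carrier A \<and> h (c \<odot>\<^bsub>A\<^esub> x) = c \<odot>\<^bsub>B\<^esub> h x"
    and Ac: "\<And>i. Ac i \<subseteq> carrier A" and Bc: "\<And>i. h ` Ac i = Bc i"
  shows "graded_alg_iso (quot_alg A I) (quot_comp A I Ac) B Bc (\<lambda>X. the_elem (h ` X))"
proof -
  interpret A: cring A by fact
  interpret B: cring B by fact
  interpret H: ring_hom_ring A B h
    by (rule ring_hom_ringI2[OF A.ring_axioms B.ring_axioms h])
  let ?h = "\<lambda>X. the_elem (h ` X)"
  have h_coset: "?h (I +>\<^bsub>A\<^esub> x) = h x" if "x \<in> carrier A" for x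
    unfolding ker[symmetric] by (rule H.the_elem_simp[OF that])
  have iso: "?h \<in> ring_iso (quot_alg A I) B"
    using H.FactRing_iso_set[OF surj] unfolding ker
    by (simp add: ring_iso_def ring_hom_def quot_alg_simps)
  have kerI: "i \<in> I \<longleftrightarrow> i \<in> carrier A \<and> h i = \<zero>\<^bsub>B\<^esub>" for i
    unfolding ker[symmetric] a_kernel_def' by simp
  have const: "h z = h x" if z: "z \<in> I +>\<^bsub>A\<^esub> x" and x: "x \<in> carrier A" for x z
  proof -
    obtain i where i: "i \<in> I" "z = i \<oplus>\<^bsub>A\<^esub> x" using z by (auto simp: a_r_coset_def')
    then have "i \<in> carrier A" "h i = \<zero>\<^bsub>B\<^esub>" using kerI by simp_all
    then show ?thesis using i(2) x by simp
  qed
  have coset_carrier: "z \<in> carrier A" if "z \<in> I +>\<^bsub>A\<^esub> x" "x \<in> carrier A" for x z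
    using that by (auto simp: a_r_coset_def' kerI)
  have self: "x \<in> I +>\<^bsub>A\<^esub> x" if "x \<in> carrier A" for x
    using that by (auto simp: a_r_coset_def' kerI intro!: exI[of _ "\<zero>\<^bsub>A\<^esub>"])
  have sc: "?h (c \<odot>\<^bsub>quot_alg A I\<^esub> X) = c \<odot>\<^bsub>B\<^esub> ?h X" if "X \<in> carrier (quot_alg A I)" for c X
  proof -
    obtain x where x: "x \<in> carrier A" "X = I +>\<^bsub>A\<^esub> x" using \<open>X \<in> _\<close> unfolding quot_alg_carrier by blast
    have "h ` (\<Union>y\<in>X. I +>\<^bsub>A\<^esub> (c \<odot>\<^bsub>A\<^esub> y)) = {c \<odot>\<^bsub>B\<^esub> h x}"
    proof (intro equalityI subsetI)
      fix w assume "w \<in> h ` (\<Union>y\<in>X. I +>\<^bsub>A\<^esub> (c \<odot>\<^bsub>A\<^esub> y))"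
      then obtain y z where yz: "y \<in> X" "z \<in> I +>\<^bsub>A\<^esub> (c \<odot>\<^bsub>A\<^esub> y)" "w = h z" by blast
      have y: "y \<in> carrier A" "h y = h x" using yz(1) x coset_carrier const by auto
      have "h z = c \<odot>\<^bsub>B\<^esub> h x" using const[OF yz(2)] smul[OF y(1), of c] y(2) by simp
      then show "w \<in> {c \<odot>\<^bsub>B\<^esub> h x}" using yz(3) by simp
    next
      fix w assume "w \<in> {c \<odot>\<^bsub>B\<^esub> h x}"
      then have "w = h (c \<odot>\<^bsub>A\<^esub> x)" using smul[OF x(1), of c] by simp
      then show "w \<in> h ` (\<Union>y\<in>X. I +>\<^bsub>A\<^esub> (c \<odot>\<^bsub>A\<^esub> y))"
        using self[OF x(1)] self[of "c \<odot>\<^bsub>A\<^esub> x"] smul[OF x(1), of c] unfolding x(2) by blast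
    qed
    then show ?thesis using h_coset[OF x(1)] unfolding quot_alg_simps x(2) by simp
  qed
  have "?h ` quot_comp A I Ac i = Bc i" for i
  proof -
    have "?h ` quot_comp A I Ac i = h ` Ac i"
      unfolding quot_comp_def image_image using Ac[of i] by (intro image_cong) (auto simp: h_coset)
    then show ?thesis using Bc by simp
  qed
  then show ?thesis unfolding graded_alg_iso_def using iso sc by blast
qed

section \<open>Segre products\<close>

lemma lookup_conv:
  "lookup (conv f m p q) c = (\<Sum>r\<in>keys p. \<Sum>t\<in>keys q.
     (m (lookup p r) (lookup q t) when f r t = c))"
  by (simp add: conv_def lookup_sum lookup_single)

lemma keys_conv:
  "keys (conv f m p q) \<subseteq> {f r t | r t. r \<in> keys p \<and> t \<in> keys q}"
proof
  fix c assume "c \<in> keys (conv f m p q)"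
  then have "(\<Sum>r\<in>keys p. \<Sum>t\<in>keys q.
     (m (lookup p r) (lookup q t) when f r t = c)) \<noteq> 0"
    by (simp add: in_keys_iff lookup_conv)
  then obtain r where r: "r \<in> keys p" "(\<Sum>t\<in>keys q.
     (m (lookup p r) (lookup q t) when f r t = c)) \<noteq> 0"
    by (rule sum.not_neutral_contains_not_neutral)
  then obtain t where "t \<in> keys q" "(m (lookup p r) (lookup q t) when f r t = c) \<noteq> 0"
    by (elim sum.not_neutral_contains_not_neutral)
  then show "c \<in> {f r t | r t. r \<in> keys p \<and> t \<in> keys q}"
    using r(1) by auto
qed

lemma poly_mapping_eq_sum_singles:
  "p = (\<Sum>r\<in>keys p. single r (lookup p r))"
  by (intro poly_mapping_eqI) (auto simp: lookup_sum lookup_single when_def in_keys_iff)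

lemma tensor_mult_conv: "tensor_mult = conv (\<lambda>r t j. r j * t j) times"
  by (intro ext) (simp add: tensor_mult_def conv_def)

lemma biadditive_tensor_mult: "biadditive tensor_mult"
  unfolding tensor_mult_conv by (rule biadditive_conv[OF biadditive_times])

lemma tensor_mult_single:
  "tensor_mult (single r a) (single t b) = single (\<lambda>j. r j * t j) (a * b)"
  unfolding tensor_mult_conv by (rule conv_single[OF biadditive_times])

lemma tensor_mult_assoc: "tensor_mult (tensor_mult p q) z = tensor_mult p (tensor_mult q z)"
  unfolding tensor_mult_conv by (rule conv_assoc[OF biadditive_times]) (simp_all add: ac_simps)

lemma tensor_mult_commute: "tensor_mult p q = tensor_mult q p"
  unfolding tensor_mult_conv by (rule conv_commute[OF biadditive_times]) (simp_all add: ac_simps)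

lemma tensor_mult_one: "tensor_mult (single (\<lambda>_. 1) 1) q = q"
  unfolding tensor_mult_conv by (rule conv_one[OF biadditive_times]) simp_all

lemma tensor_mult_smul: "tensor_mult (smul c p) q = smul c (tensor_mult p q)"
proof (induction p rule: poly_mapping_additive_induct)
  case (single r a)
  show ?case
    by (induction q rule: poly_mapping_additive_induct)
      (simp_all add: tensor_mult_single biadditiveD[OF biadditive_tensor_mult] pm.scale_right_distrib ac_simps)
qed (simp add: biadditiveD[OF biadditive_tensor_mult] pm.scale_right_distrib)

lemma tensor_mult_diff: "tensor_mult (p - q) z = tensor_mult p z - tensor_mult q z"
  using biadditiveD(3)[OF biadditive_tensor_mult, of "p - q" q z] by (simp add: algebra_simps)

abbreviation segre_times :: "('s, 'm::comm_monoid_add, 'k::comm_ring_1) tensors \<Rightarrow> ('s, 'm, 'k) tensors \<Rightarrow> ('s, 'm, 'k) tensors" where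
  "segre_times \<equiv> conv plus tensor_mult"

abbreviation tsmul :: "'k::comm_ring_1 \<Rightarrow> ('s, 'm, 'k) tensors \<Rightarrow> ('s, 'm, 'k) tensors" where
  "tsmul c \<equiv> Poly_Mapping.map (smul c)"

lemma lookup_tsmul: "lookup (tsmul c P) i = smul c (lookup P i)"
  by (simp add: map.rep_eq when_def)

interpretation ts: Modules.module tsmul
  by unfold_locales
    (auto intro!: poly_mapping_eqI simp: lookup_tsmul lookup_add pm.scale_right_distrib pm.scale_left_distrib)

lemma segre_free_simps [simp]:
  "carrier (segre_free R) = {P. \<forall>i. lookup P i \<in> free_tensors (\<lambda>j. R j i)}"
  "P \<otimes>\<^bsub>segre_free R\<^esub> Q = segre_times P Q" "\<one>\<^bsub>segre_free R\<^esub> = single 0 (single (\<lambda>_. 1) 1)"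
  "\<zero>\<^bsub>segre_free R\<^esub> = 0" "P \<oplus>\<^bsub>segre_free R\<^esub> Q = P + Q" "c \<odot>\<^bsub>segre_free R\<^esub> P = tsmul c P"
  by (simp_all add: segre_free_def conv_def)

lemma free_tensors_closed:
  fixes V :: "'s \<Rightarrow> 'a set" and p q :: "('s \<Rightarrow> 'a) \<Rightarrow>\<^sub>0 'k::comm_ring_1"
  shows "0 \<in> (free_tensors V :: (('s \<Rightarrow> 'a) \<Rightarrow>\<^sub>0 'k) set)" "p \<in> free_tensors V \<Longrightarrow> q \<in> free_tensors V \<Longrightarrow> p + q \<in> free_tensors V"
  "p \<in> free_tensors V \<Longrightarrow> smul c p \<in> free_tensors V" "p \<in> free_tensors V \<Longrightarrow> - p \<in> free_tensors V"
proof -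
  have *: "p \<in> free_tensors V \<longleftrightarrow> keys p \<subseteq> {r. \<forall>j. r j \<in> V j}" for p :: "('s \<Rightarrow> 'a) \<Rightarrow>\<^sub>0 'k"
    by (auto simp: free_tensors_def)
  have k: "keys (smul c p) \<subseteq> keys p" "keys (- p) \<subseteq> keys p"
    by (auto simp: in_keys_iff)
  show "0 \<in> (free_tensors V :: (('s \<Rightarrow> 'a) \<Rightarrow>\<^sub>0 'k) set)" by (simp add: *)
  show "p \<in> free_tensors V \<Longrightarrow> q \<in> free_tensors V \<Longrightarrow> p + q \<in> free_tensors V"
    using keys_add[of p q] unfolding * by blast
  show "p \<in> free_tensors V \<Longrightarrow> smul c p \<in> free_tensors V" "p \<in> free_tensors V \<Longrightarrow> - p \<in> free_tensors V"
    using k unfolding * by blast+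
qed

lemma free_tensors_single: "(\<And>j. r j \<in> V j) \<Longrightarrow> single r a \<in> free_tensors V"
  by (simp add: free_tensors_def)

lemma tensor_mult_free:
  assumes "p \<in> free_tensors V" "q \<in> free_tensors W" "\<And>j a b. a \<in> V j \<Longrightarrow> b \<in> W j \<Longrightarrow> a * b \<in> U j"
  shows "tensor_mult p q \<in> free_tensors U"
  unfolding free_tensors_def
proof (intro CollectI ballI allI)
  fix z j assume "z \<in> keys (tensor_mult p q)"
  then have "z \<in> {\<lambda>j. r j * t j | r t. r \<in> keys p \<and> t \<in> keys q}"
    unfolding tensor_mult_conv by (rule subsetD[OF keys_conv])
  then obtain r t where rt: "z = (\<lambda>j. r j * t j)" "r \<in> keys p" "t \<in> keys q" by blast
  have "r j \<in> V j" "t j \<in> W j" using assms(1,2) rt(2,3) unfolding free_tensors_def by simp_all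
  then show "z j \<in> U j" unfolding rt(1) by (rule assms(3))
qed

lemma multilinear_relsE:
  assumes "x \<in> multilinear_rels V"
  obtains (add) r j a b where
    "x = single (r(j := a + b)) 1 - single (r(j := a)) 1 - single (r(j := b)) 1"
    "\<And>l. r l \<in> V l" "a \<in> V j" "b \<in> V j"
  | (scale) r j a c where
    "x = single (r(j := smul c a)) 1 - single (r(j := a)) c"
    "\<And>l. r l \<in> V l" "a \<in> V j"
  using assms unfolding multilinear_rels_def by blast

lemma multilinear_rels_addI:
  "(\<And>l. r l \<in> V l) \<Longrightarrow> a \<in> V j \<Longrightarrow> b \<in> V j \<Longrightarrow>
   single (r(j := a + b)) 1 - single (r(j := a)) 1 - single (r(j := b)) 1
     \<in> multilinear_rels V"
  unfolding multilinear_rels_def by blast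

lemma multilinear_rels_scaleI:
  "(\<And>l. r l \<in> V l) \<Longrightarrow> a \<in> V j \<Longrightarrow>
   single (r(j := smul c a)) 1 - single (r(j := a)) c \<in> multilinear_rels V"
  unfolding multilinear_rels_def by blast

section \<open>The multiplication map\<close>

definition mult_tensor :: "(('s::finite \<Rightarrow> ('v, 'k) mpoly) \<Rightarrow>\<^sub>0 'k) \<Rightarrow> ('v, 'k::comm_ring_1) mpoly" where
  "mult_tensor = lin_ext (\<lambda>r a. smul a (\<Prod>j\<in>UNIV. r j))"

definition mult_segre :: "('s::finite, 'v monom, 'k) tensors \<Rightarrow> ('v, 'k::comm_ring_1) mpoly" where
  "mult_segre = lin_ext (\<lambda>_. mult_tensor)"

lemma mult_tensor_family: "additive_family (\<lambda>(r :: 's::finite \<Rightarrow> ('v, 'k::comm_ring_1) mpoly) a. smul a (\<Prod>j\<in>UNIV. r j))"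
  by (simp add: additive_family_def pm.scale_left_distrib)

lemma mult_tensor_add: "mult_tensor (p + q) = mult_tensor p + mult_tensor q"
  unfolding mult_tensor_def by (rule lin_ext_add[OF mult_tensor_family])

lemma mult_tensor_single: "mult_tensor (single r a) = smul a (\<Prod>j\<in>UNIV. r j)"
  unfolding mult_tensor_def by (rule lin_ext_single[OF mult_tensor_family])

lemma mult_tensor_diff: "mult_tensor (p - q) = mult_tensor p - mult_tensor q"
  using mult_tensor_add[of "p - q" q] by (simp add: algebra_simps)

lemma mult_tensor_smul: "mult_tensor (smul c p) = smul c (mult_tensor p)"
  by (induction p rule: poly_mapping_additive_induct)
    (simp_all add: mult_tensor_single mult_tensor_add pm.scale_right_distrib)

lemma mult_tensor_mult: "mult_tensor (tensor_mult p q) = mult_tensor p * mult_tensor q"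
  unfolding mult_tensor_def tensor_mult_conv
  by (rule lin_ext_conv[OF biadditive_times mult_tensor_family]) (simp add: smul_mult prod.distrib)

lemma mult_segre_family: "additive_family (\<lambda>_::nat. mult_tensor)"
  using mult_tensor_single[of _ 0] by (simp add: additive_family_def mult_tensor_add)

lemma mult_segre_add: "mult_segre (P + Q) = mult_segre P + mult_segre Q"
  unfolding mult_segre_def by (rule lin_ext_add[OF mult_segre_family])

lemma mult_segre_single: "mult_segre (single i p) = mult_tensor p"
  unfolding mult_segre_def by (rule lin_ext_single[OF mult_segre_family])

lemma mult_segre_tsmul: "mult_segre (tsmul c P) = smul c (mult_segre P)"
proof (induction P rule: poly_mapping_additive_induct)
  case (single i p)
  have "tsmul c (single i p) = single i (smul c p)" by simp
  then show ?case by (simp only: mult_segre_single mult_tensor_smul)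
qed (simp add: ts.scale_right_distrib mult_segre_add pm.scale_right_distrib)

lemma mult_segre_times: "mult_segre (segre_times P Q) = mult_segre P * mult_segre Q"
  unfolding mult_segre_def
  by (rule lin_ext_conv[OF biadditive_tensor_mult mult_segre_family]) (rule mult_tensor_mult)

lemma mult_tensor_null: "x \<in> null_tensors V \<Longrightarrow> mult_tensor x = 0"
  unfolding null_tensors_def
proof (induction rule: pm.span_induct_alt)
  case base
  show ?case by (simp add: mult_tensor_def)
next
  case (step c x y)
  have upd: "(\<Prod>l\<in>UNIV. (r(j := a)) l) = a * (\<Prod>l\<in>UNIV - {j}. r l)" for r :: "'s::finite \<Rightarrow> ('v, 'k::comm_ring_1) mpoly" and j a
  proof -
    have "(\<Prod>l\<in>UNIV. (r(j := a)) l) = (r(j := a)) j * (\<Prod>l\<in>UNIV - {j}. (r(j := a)) l)"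
      by (rule prod.remove) simp_all
    also have "(\<Prod>l\<in>UNIV - {j}. (r(j := a)) l) = (\<Prod>l\<in>UNIV - {j}. r l)"
      by (rule prod.cong) auto
    finally show ?thesis by simp
  qed
  have "mult_tensor x = 0"
    using step.hyps(1)
  proof (cases rule: multilinear_relsE)
    case (add r j a b)
    show ?thesis unfolding add(1) mult_tensor_diff mult_tensor_single upd by (simp add: distrib_right)
  next
    case (scale r j a e)
    show ?thesis unfolding scale(1) mult_tensor_diff mult_tensor_single upd
      by (simp add: smul_eq_times ac_simps)
  qed
  then show ?case using step.IH by (simp add: mult_tensor_add mult_tensor_smul)
qed

locale graded_subalgebras =
  fixes R :: "'s::finite \<Rightarrow> nat \<Rightarrow> ('v, 'k::comm_ring_1) mpoly set"
  assumes subspace: "pm.subspace (R j i)" and one_in: "1 \<in> R j 0"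
    and mult_in: "a \<in> R j i \<Longrightarrow> b \<in> R j k \<Longrightarrow> a * b \<in> R j (i + k)"
begin

abbreviation "SF \<equiv> segre_free R"
abbreviation "SN \<equiv> segre_null R"

lemma carrier_closed:
  "0 \<in> carrier SF" "P \<in> carrier SF \<Longrightarrow> Q \<in> carrier SF \<Longrightarrow> P + Q \<in> carrier SF"
  "P \<in> carrier SF \<Longrightarrow> tsmul c P \<in> carrier SF" "P \<in> carrier SF \<Longrightarrow> - P \<in> carrier SF"
  by (simp_all add: lookup_add lookup_tsmul free_tensors_closed)

lemma lookup_segre_times_in:
  assumes "0 \<in> U" "\<And>x y. x \<in> U \<Longrightarrow> y \<in> U \<Longrightarrow> x + y \<in> U"
    and "\<And>k l. k + l = i \<Longrightarrow> tensor_mult (lookup P k) (lookup Q l) \<in> U"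
  shows "lookup (segre_times P Q) i \<in> U"
proof -
  have sum_in: "sum f A \<in> U" if "\<And>x. x \<in> A \<Longrightarrow> f x \<in> U" for A and f :: "nat \<Rightarrow> _"
    using that by (induction A rule: infinite_finite_induct) (auto simp: assms(1,2))
  show ?thesis unfolding lookup_conv by (intro sum_in) (auto simp: when_def assms(1,3))
qed

lemma carrier_times: "P \<in> carrier SF \<Longrightarrow> Q \<in> carrier SF \<Longrightarrow> segre_times P Q \<in> carrier SF"
proof -
  assume PQ: "P \<in> carrier SF" "Q \<in> carrier SF"
  have "lookup (segre_times P Q) i \<in> free_tensors (\<lambda>j. R j i)" for i
  proof (rule lookup_segre_times_in)
    fix k l assume "k + l = i"
    then show "tensor_mult (lookup P k) (lookup Q l) \<in> free_tensors (\<lambda>j. R j i)"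
      using PQ mult_in by (intro tensor_mult_free[of _ "\<lambda>j. R j k" _ "\<lambda>j. R j l"]) auto
  qed (simp_all add: free_tensors_closed)
  then show ?thesis by simp
qed

lemma carrier_one: "single 0 (single (\<lambda>_. 1) 1) \<in> carrier SF"
  by (simp add: lookup_single when_def free_tensors_closed free_tensors_single one_in)

lemma cring_SF: "cring SF"
proof (rule cringI)
  show "abelian_group SF"
  proof (rule abelian_groupI)
    fix P assume "P \<in> carrier SF"
    then show "\<exists>Q\<in>carrier SF. Q \<oplus>\<^bsub>SF\<^esub> P = \<zero>\<^bsub>SF\<^esub>"
      using carrier_closed(4) by (intro bexI[of _ "- P"]) simp_all
  qed (use carrier_closed in \<open>simp_all add: ac_simps\<close>)
  show "Group.comm_monoid SF"
  proof (rule comm_monoidI)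
    fix P Q Z assume "P \<in> carrier SF" "Q \<in> carrier SF"
    show "P \<otimes>\<^bsub>SF\<^esub> Q \<in> carrier SF"
      using carrier_times[OF \<open>P \<in> _\<close> \<open>Q \<in> _\<close>] by simp
    show "P \<otimes>\<^bsub>SF\<^esub> Q = Q \<otimes>\<^bsub>SF\<^esub> P"
      by (simp add: conv_commute[OF biadditive_tensor_mult _ tensor_mult_commute] add.commute)
    show "P \<otimes>\<^bsub>SF\<^esub> Q \<otimes>\<^bsub>SF\<^esub> Z = P \<otimes>\<^bsub>SF\<^esub> (Q \<otimes>\<^bsub>SF\<^esub> Z)"
      by (simp add: conv_assoc[OF biadditive_tensor_mult _ tensor_mult_assoc] add.assoc)
    show "\<one>\<^bsub>SF\<^esub> \<otimes>\<^bsub>SF\<^esub> P = P"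
      by (simp add: conv_one[OF biadditive_tensor_mult _ tensor_mult_one])
  next
    show "\<one>\<^bsub>SF\<^esub> \<in> carrier SF" using carrier_one by simp
  qed
qed (simp add: conv_add_left[OF biadditive_tensor_mult])

lemma null_subset_free:
  assumes V: "\<And>j. pm.subspace (V j)" shows "null_tensors V \<subseteq> free_tensors V"
proof -
  have "pm.subspace (free_tensors V)" by (rule pm.subspaceI) (simp_all add: free_tensors_closed)
  moreover have "multilinear_rels V \<subseteq> free_tensors V"
  proof
    fix x assume "x \<in> multilinear_rels V"
    then show "x \<in> free_tensors V"
    proof (cases rule: multilinear_relsE)
      case (add r j a b)
      have "a + b \<in> V j" using pm.subspace_add[OF V add(3,4)] .
      then have "single (r(j := a + b)) 1 + - single (r(j := a)) 1 + - single (r(j := b)) 1 \<in> free_tensors V"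
        using add(2-4) by (intro free_tensors_closed free_tensors_single) auto
      then show ?thesis using add(1) by simp
    next
      case (scale r j a c)
      have "smul c a \<in> V j" using pm.subspace_scale[OF V scale(3)] .
      then have "single (r(j := smul c a)) 1 + - single (r(j := a)) c \<in> free_tensors V"
        using scale(2,3) by (intro free_tensors_closed free_tensors_single) auto
      then show ?thesis using scale(1) by simp
    qed
  qed
  ultimately show ?thesis unfolding null_tensors_def by (intro pm.span_minimal)
qed

text \<open>
  Multiplying a multilinear relation by a pure tensor \<open>t\<close> gives a multiple of the relation of the same
  kind with all entries multiplied by those of \<open>t\<close>.
\<close>

lemma null_times_free:
  assumes x: "x \<in> null_tensors V" and q: "q \<in> free_tensors W"
    and U: "\<And>j a b. a \<in> V j \<Longrightarrow> b \<in> W j \<Longrightarrow> a * b \<in> U j"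
  shows "tensor_mult x q \<in> null_tensors U"
proof -
  have pure: "tensor_mult x (single t c) \<in> null_tensors U" if t: "\<And>j. t j \<in> W j" for t c
    using x unfolding null_tensors_def
  proof (induction rule: pm.span_induct_alt)
    case base
    show ?case by (simp add: biadditiveD[OF biadditive_tensor_mult] pm.span_zero)
  next
    case (step d x y)
    have upd: "(\<lambda>l. (r(j := a)) l * t l) = (\<lambda>l. r l * t l)(j := a * t j)" for r j a by auto
    have "tensor_mult x (single t c) \<in> pm.span (multilinear_rels U)"
      using step.hyps(1)
    proof (cases rule: multilinear_relsE)
      case (add r j a b)
      let ?r = "\<lambda>l. r l * t l"
      have eq: "tensor_mult x (single t c) = smul c (single (?r(j := a * t j + b * t j)) 1
          - single (?r(j := a * t j)) 1 - single (?r(j := b * t j)) 1)"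
        unfolding add(1) tensor_mult_diff tensor_mult_single upd pm.scale_right_diff_distrib by (simp add: distrib_right)
      show ?thesis unfolding eq
        by (intro pm.span_scale pm.span_base multilinear_rels_addI U add(2-4) t)
    next
      case (scale r j a e)
      let ?r = "\<lambda>l. r l * t l"
      have sm: "smul e a * t j = smul e (a * t j)" unfolding smul_eq_times by (simp add: ac_simps)
      have eq: "tensor_mult x (single t c) = smul c (single (?r(j := smul e (a * t j))) 1
          - single (?r(j := a * t j)) e)"
        unfolding scale(1) tensor_mult_diff tensor_mult_single upd sm pm.scale_right_diff_distrib by (simp add: mult.commute)
      show ?thesis unfolding eq
        by (intro pm.span_scale pm.span_base multilinear_rels_scaleI U scale(2,3) t)
    qed
    then show ?case
      unfolding biadditiveD(3)[OF biadditive_tensor_mult] tensor_mult_smul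
      by (intro pm.span_add pm.span_scale step.IH)
  qed
  have sum: "tensor_mult x (\<Sum>t\<in>A. single t (c t)) \<in> null_tensors U"
    if "finite A" "\<And>t. t \<in> A \<Longrightarrow> (\<forall>j. t j \<in> W j)" for A c
    using that
  proof (induction A rule: finite_induct)
    case empty
    show ?case by (simp add: biadditiveD[OF biadditive_tensor_mult] null_tensors_def pm.span_zero)
  next
    case (insert t A)
    have "tensor_mult x (single t (c t)) \<in> null_tensors U" using insert.prems by (intro pure) simp
    moreover have "tensor_mult x (\<Sum>t\<in>A. single t (c t)) \<in> null_tensors U" using insert by simp
    ultimately show ?case
      using insert.hyps by (simp add: biadditiveD(4)[OF biadditive_tensor_mult] null_tensors_def pm.span_add)
  qed
  have "tensor_mult x (\<Sum>t\<in>keys q. single t (lookup q t)) \<in> null_tensors U"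
    using q by (intro sum) (simp_all add: free_tensors_def)
  then show ?thesis by (simp only: poly_mapping_eq_sum_singles[of q, symmetric])
qed

lemma SN_subset: "SN \<subseteq> carrier SF"
  using null_subset_free[of "\<lambda>j. R j i" for i] subspace unfolding segre_null_def by fastforce

lemma SN_closed:
  "0 \<in> SN" "P \<in> SN \<Longrightarrow> Q \<in> SN \<Longrightarrow> P + Q \<in> SN" "P \<in> SN \<Longrightarrow> tsmul c P \<in> SN" "P \<in> SN \<Longrightarrow> - P \<in> SN"
  by (simp_all add: segre_null_def null_tensors_def lookup_add lookup_tsmul pm.span_zero pm.span_add pm.span_scale pm.span_neg)

lemma SN_times: "P \<in> SN \<Longrightarrow> Q \<in> carrier SF \<Longrightarrow> segre_times P Q \<in> SN"
proof -
  assume PQ: "P \<in> SN" "Q \<in> carrier SF"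
  have "lookup (segre_times P Q) i \<in> null_tensors (\<lambda>j. R j i)" for i
  proof (rule lookup_segre_times_in)
    fix k l assume kl: "k + l = i"
    have P: "lookup P k \<in> null_tensors (\<lambda>j. R j k)" using PQ(1) by (simp add: segre_null_def)
    have Q: "lookup Q l \<in> free_tensors (\<lambda>j. R j l)" using PQ(2) by simp
    show "tensor_mult (lookup P k) (lookup Q l) \<in> null_tensors (\<lambda>j. R j i)"
      by (rule null_times_free[OF P Q]) (use mult_in kl in auto)
  qed (simp_all add: null_tensors_def pm.span_zero pm.span_add)
  then show ?thesis by (simp add: segre_null_def)
qed

lemma SF_minus:
  assumes "P \<in> carrier SF" "Q \<in> carrier SF"
  shows "\<ominus>\<^bsub>SF\<^esub> P = - P" "P \<ominus>\<^bsub>SF\<^esub> Q = P - Q"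
proof -
  interpret cring SF by (rule cring_SF)
  have m: "\<ominus>\<^bsub>SF\<^esub> P = - P" if "P \<in> carrier SF" for P
    by (rule minus_equality) (use that carrier_closed(4)[OF that] in simp_all)
  show "\<ominus>\<^bsub>SF\<^esub> P = - P" by (rule m[OF assms(1)])
  show "P \<ominus>\<^bsub>SF\<^esub> Q = P - Q" unfolding a_minus_def m[OF assms(2)] by simp
qed

lemma ideal_SN: "ideal SN SF"
proof (rule idealI)
  interpret cring SF by (rule cring_SF)
  show "ring SF" by (rule ring_axioms)
  show "subgroup SN (add_monoid SF)"
  proof (rule add.subgroupI)
    show "SN \<subseteq> carrier SF" by (rule SN_subset)
    show "SN \<noteq> {}" using SN_closed(1) by blast
    fix P Q assume P: "P \<in> SN"
    show "\<ominus>\<^bsub>SF\<^esub> P \<in> SN" using P SN_subset SN_closed(4) by (subst SF_minus) auto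
    assume Q: "Q \<in> SN"
    show "P \<oplus>\<^bsub>SF\<^esub> Q \<in> SN" using P Q by (simp add: SN_closed)
  qed
  fix P Q assume PQ: "P \<in> SN" "Q \<in> carrier SF"
  show "P \<otimes>\<^bsub>SF\<^esub> Q \<in> SN" using SN_times[OF PQ] by simp
  moreover have "P \<in> carrier SF" using PQ(1) SN_subset by blast
  ultimately show "Q \<otimes>\<^bsub>SF\<^esub> P \<in> SN" using m_comm[OF PQ(2)] by simp
qed

section \<open>The Segre product and its map to the polynomial ring\<close>

lemma mult_segre_null: "P \<in> SN \<Longrightarrow> mult_segre P = 0"
  unfolding mult_segre_def lin_ext_def segre_null_def
  by (intro sum.neutral) (auto intro: mult_tensor_null)

abbreviation "cls \<equiv> (\<lambda>P. SN +>\<^bsub>SF\<^esub> P)"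

definition mult_class :: "('s, 'v monom, 'k) tensors set \<Rightarrow> ('v, 'k) mpoly" where
  "mult_class X = the_elem (mult_segre ` X)"

lemma cring_segre: "cring (segre R)"
  unfolding segre_def by (rule cring_quot_alg[OF cring_SF ideal_SN])

lemma cls_hom: "cls \<in> ring_hom SF (segre R)"
  unfolding segre_def by (rule quot_alg_hom[OF ideal_SN])

lemma carrier_segre: "carrier (segre R) = cls ` carrier SF"
  unfolding segre_def by (rule quot_alg_carrier)

lemma cls_eq_iff_mem: "Q \<in> cls P \<longleftrightarrow> Q - P \<in> SN"
  unfolding a_r_coset_def' by (auto intro!: bexI[of _ "Q - P"])

lemma cls_self: "P \<in> cls P"
  by (simp add: cls_eq_iff_mem SN_closed)

lemma mult_class_cls: "mult_class (cls P) = mult_segre P"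
proof -
  have "mult_segre Q = mult_segre P" if "Q \<in> cls P" for Q
    using mult_segre_add[of "Q - P" P] mult_segre_null[of "Q - P"] that by (simp add: cls_eq_iff_mem)
  then have "mult_segre ` cls P = {mult_segre P}" using cls_self by blast
  then show ?thesis by (simp add: mult_class_def)
qed

lemma cls_smult: "P \<in> carrier SF \<Longrightarrow> c \<odot>\<^bsub>segre R\<^esub> cls P = cls (tsmul c P)"
proof -
  assume "P \<in> carrier SF"
  have "cls (tsmul c Q) = cls (tsmul c P)" if Q: "Q \<in> cls P" for Q
  proof -
    have d: "tsmul c Q - tsmul c P \<in> SN"
      using SN_closed(3)[of "Q - P" c] Q by (simp add: cls_eq_iff_mem ts.scale_right_diff_distrib)
    have "Z - tsmul c Q \<in> SN \<longleftrightarrow> Z - tsmul c P \<in> SN" for Z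
      using SN_closed(2)[OF _ d, of "Z - tsmul c Q"] SN_closed(2)[OF _ SN_closed(4)[OF d], of "Z - tsmul c P"]
      by auto
    then show ?thesis by (auto simp: cls_eq_iff_mem)
  qed
  then have "(\<Union>Q\<in>cls P. cls (tsmul c Q)) = cls (tsmul c P)" using cls_self by blast
  then show ?thesis by (simp add: segre_def quot_alg_simps)
qed

end

section \<open>The graded algebras generated by monomials\<close>

lemma mono_alg_comp_eq:
  "(mono_alg_comp B i :: ('v, 'k::comm_ring_1) mpoly set) =
     {p. keys p \<subseteq> mono_power i B}"
  unfolding mono_alg_comp_def by (rule span_monomials)

lemma zero_in_power: "\<exists>i::nat. 0 \<in> mono_power i B"
  by (rule exI[of _ 0]) (simp add: mono_prod_empty)

lemma graded_subalgebras_mono_comps: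
  "graded_subalgebras (mono_comps Bs :: 's::finite \<Rightarrow> nat \<Rightarrow> ('v, 'k::comm_ring_1) mpoly set)"
proof
  fix j i k and a b :: "('v, 'k) mpoly"
  show "pm.subspace (mono_alg_comp (Bs j) i :: ('v, 'k) mpoly set)"
    unfolding mono_alg_comp_def by (rule pm.subspace_span)
  show "(1 :: ('v, 'k) mpoly) \<in> mono_alg_comp (Bs j) 0"
    by (simp add: mono_alg_comp_eq mono_prod_empty)
  assume a: "a \<in> mono_alg_comp (Bs j) i" and b: "b \<in> mono_alg_comp (Bs j) k"
  show "a * b \<in> mono_alg_comp (Bs j) (i + k)"
    unfolding mono_alg_comp_eq
  proof (intro CollectI subsetI)
    fix m assume "m \<in> keys (a * b)"
    then obtain x y where xy: "m = x + y" "x \<in> keys a" "y \<in> keys b"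
      using keys_mult[of a b] by blast
    then have "x \<in> mono_power i (Bs j)" "y \<in> mono_power k (Bs j)"
      using a b unfolding mono_alg_comp_eq by blast+
    then show "m \<in> mono_power (i + k) (Bs j)" unfolding xy(1) by (rule mono_prod_power_add)
  qed
qed

lemma times_in_mono_alg:
  fixes p q :: "('v, 'k::comm_ring_1) mpoly"
  assumes "\<forall>u\<in>keys p. \<exists>i. u \<in> mono_power i B" "\<forall>u\<in>keys q. \<exists>i. u \<in> mono_power i B"
  shows "\<forall>u\<in>keys (p * q). \<exists>i. u \<in> mono_power i B"
proof
  fix u assume "u \<in> keys (p * q)"
  then obtain x y where xy: "u = x + y" "x \<in> keys p" "y \<in> keys q" using keys_mult[of p q] by auto
  obtain i k where "x \<in> mono_power i B" "y \<in> mono_power k B"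
    using assms xy(2,3) by blast
  then show "\<exists>i. u \<in> mono_power i B" unfolding xy(1) using mono_prod_power_add by blast
qed

lemma carrier_mono_alg:
  "carrier (mono_alg B :: ('k::comm_ring_1, ('v, 'k) mpoly) module) =
     {p. \<forall>u\<in>keys p. \<exists>i. u \<in> mono_power i B}" (is "_ = ?S")
proof -
  interpret P: cring "poly_alg UNIV :: ('k, ('v, 'k) mpoly) module" by (rule cring_poly_alg)
  let ?G = "range (single 0) \<union> monomial ` B :: ('v, 'k) mpoly set"
  let ?H = "generate_ring (poly_alg UNIV :: ('k, ('v, 'k) mpoly) module) ?G"
  have uminus: "\<ominus>\<^bsub>poly_alg UNIV\<^esub> p = - p" for p :: "('v, 'k) mpoly"
    by (rule P.minus_equality) simp_all
  have "?H = ?S"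
  proof (intro equalityI subsetI)
    fix p :: "('v, 'k) mpoly" assume "p \<in> ?H"
    then show "p \<in> ?S"
    proof (induction rule: generate_ring.induct)
      case one
      show ?case using zero_in_power[of B] by simp
    next
      case (incl h)
      have "f \<in> mono_power 1 B" if "f \<in> B" for f
        unfolding mono_prod_power by (rule exI[of _ "{#f#}"]) (use that in simp)
      then have "\<exists>i::nat. f \<in> mono_power i B" if "f \<in> B" for f using that by blast
      then show ?case using incl zero_in_power[of B] by (auto simp: monomial_def split: if_splits)
    next
      case (a_inv h)
      then show ?case unfolding uminus by (simp add: in_keys_iff)
    next
      case (eng_add p q)
      then show ?case using keys_add[of p q] by auto
    next
      case (eng_mult p q)
      then show ?case using times_in_mono_alg[of p B q] by simp
    qed
  next
    fix p :: "('v, 'k) mpoly" assume p: "p \<in> ?S"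
    have add: "x + y \<in> ?H" if "x \<in> ?H" "y \<in> ?H" for x y
      using generate_ring.eng_add[OF that] by simp
    have mult: "x * y \<in> ?H" if "x \<in> ?H" "y \<in> ?H" for x y
      using generate_ring.eng_mult[OF that] by simp
    have const: "single 0 c \<in> ?H" for c by (rule generate_ring.incl) simp
    have zero: "0 \<in> ?H" using const[of 0] by simp
    have mon: "monomial (sum_mset M) \<in> ?H" if "set_mset M \<subseteq> B" for M
      using that
    proof (induction M)
      case empty
      show ?case using generate_ring.one[of "poly_alg UNIV :: ('k, ('v, 'k) mpoly) module"] by (simp add: monomial_0)
    next
      case (add f M)
      have "monomial f \<in> ?H" using add.prems by (intro generate_ring.incl) simp
      moreover have "monomial (sum_mset M) \<in> ?H" using add by simp
      ultimately show ?case using mult by (simp flip: monomial_mult)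
    qed
    have trm: "single u c \<in> ?H" if u: "u \<in> keys p" for u c
    proof -
      obtain i where "u \<in> mono_power i B" using p u by blast
      then obtain M where "set_mset M \<subseteq> B" "u = sum_mset M" unfolding mono_prod_power by blast
      then have "single 0 c * monomial u \<in> ?H" using mult[OF const mon] by simp
      then show ?thesis by (simp add: monomial_def mult_single)
    qed
    have sum: "(\<Sum>u\<in>A. single u (c u)) \<in> ?H" if "finite A" "A \<subseteq> keys p" for A c
      using that by (induction A rule: finite_induct) (simp_all add: zero add trm)
    show "p \<in> ?H" by (subst poly_mapping_eq_sum_singles) (intro sum; simp)
  qed
  then show ?thesis by (simp add: mono_alg_def)
qed

lemma mono_alg_simps [simp]:
  "p \<otimes>\<^bsub>mono_alg B\<^esub> q = p * q" "\<one>\<^bsub>mono_alg B\<^esub> = 1" "\<zero>\<^bsub>mono_alg B\<^esub> = 0" "p \<oplus>\<^bsub>mono_alg B\<^esub> q = p + q"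
  "c \<odot>\<^bsub>mono_alg B\<^esub> p = smul c p"
  by (simp_all add: mono_alg_def)

lemma cring_mono_alg: "cring (mono_alg B :: ('k::comm_ring_1, ('v, 'k) mpoly) module)"
proof -
  let ?S = "carrier (mono_alg B :: ('k, ('v, 'k) mpoly) module)"
  have "cring (alg_on ?S)"
  proof (rule cring_alg_on)
    fix p q assume pq: "p \<in> ?S" "q \<in> ?S"
    show "p + q \<in> ?S" using pq keys_add[of p q] unfolding carrier_mono_alg by blast
    show "p * q \<in> ?S" using pq times_in_mono_alg[of p B q] unfolding carrier_mono_alg by blast
  next
    fix p assume "p \<in> ?S" then show "- p \<in> ?S" unfolding carrier_mono_alg by (simp add: in_keys_iff)
  next
    show "1 \<in> ?S" using zero_in_power[of B] by (simp add: carrier_mono_alg)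
  qed (simp add: carrier_mono_alg)
  then show ?thesis by (simp add: mono_alg_def)
qed

lemma mono_prod_power_mono_prod:
  fixes Bs :: "'s::finite \<Rightarrow> 'v monom set"
  shows "u \<in> mono_power i (mono_prod UNIV Bs) \<longleftrightarrow>
    (\<exists>m. (\<forall>j. m j \<in> mono_power i (Bs j)) \<and> u = (\<Sum>j\<in>UNIV. m j))"
proof
  assume "u \<in> mono_power i (mono_prod UNIV Bs)"
  then obtain c where c: "u = (\<Sum>l<i. c l)" "\<forall>l\<in>{..<i}. c l \<in> mono_prod UNIV Bs"
    unfolding mono_prod_def[of "{..<i}"] by blast
  then have "\<forall>l\<in>{..<i}. \<exists>b. c l = (\<Sum>j\<in>UNIV. b j) \<and> (\<forall>j. b j \<in> Bs j)"
    unfolding mono_prod_def by blast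
  then obtain b where b: "\<forall>l\<in>{..<i}. c l = (\<Sum>j\<in>UNIV. b l j) \<and> (\<forall>j. b l j \<in> Bs j)"
    by (rule bchoice[THEN exE])
  have "u = (\<Sum>l<i. \<Sum>j\<in>UNIV. b l j)" unfolding c(1) using b by (intro sum.cong) simp_all
  also have "\<dots> = (\<Sum>j\<in>UNIV. \<Sum>l<i. b l j)" by (rule sum.swap)
  finally have "u = (\<Sum>j\<in>UNIV. \<Sum>l<i. b l j)" .
  moreover have "(\<Sum>l<i. b l j) \<in> mono_power i (Bs j)" for j
    unfolding mono_prod_def using b by (intro CollectI exI[of _ "\<lambda>l. b l j"]) simp
  ultimately show "\<exists>m. (\<forall>j. m j \<in> mono_power i (Bs j)) \<and> u = (\<Sum>j\<in>UNIV. m j)"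
    by (intro exI[of _ "\<lambda>j. \<Sum>l<i. b l j"]) simp
next
  assume "\<exists>m. (\<forall>j. m j \<in> mono_power i (Bs j)) \<and> u = (\<Sum>j\<in>UNIV. m j)"
  then obtain m where m: "\<forall>j. m j \<in> mono_power i (Bs j)" "u = (\<Sum>j\<in>UNIV. m j)" by blast
  then have "\<forall>j. \<exists>b. m j = (\<Sum>l<i. b l) \<and> (\<forall>l\<in>{..<i}. b l \<in> Bs j)"
    unfolding mono_prod_def by blast
  then obtain b where b: "\<forall>j. m j = (\<Sum>l<i. b j l) \<and> (\<forall>l\<in>{..<i}. b j l \<in> Bs j)"
    by (rule choice[THEN exE])
  have "u = (\<Sum>j\<in>UNIV. \<Sum>l<i. b j l)" unfolding m(2) using b by (intro sum.cong) simp_all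
  also have "\<dots> = (\<Sum>l<i. \<Sum>j\<in>UNIV. b j l)" by (rule sum.swap)
  finally have u: "u = (\<Sum>l<i. \<Sum>j\<in>UNIV. b j l)" .
  have "(\<Sum>j\<in>UNIV. b j l) \<in> mono_prod UNIV Bs" if "l < i" for l
    unfolding mono_prod_def using b that by (intro CollectI exI[of _ "\<lambda>j. b j l"]) simp
  then show "u \<in> mono_power i (mono_prod UNIV Bs)"
    unfolding mono_prod_def[of "{..<i}"] u by (intro CollectI exI[of _ "\<lambda>l. \<Sum>j\<in>UNIV. b j l"]) simp
qed

lemma keys_prod:
  fixes r :: "'s \<Rightarrow> ('v, 'k::comm_ring_1) mpoly"
  assumes "finite J"
  shows "keys (\<Prod>j\<in>J. r j) \<subseteq> mono_prod J (\<lambda>j. keys (r j))"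
  using assms
proof (induction J rule: finite_induct)
  case (insert j J)
  have "keys (r j * (\<Prod>j\<in>J. r j)) \<subseteq>
      {a + b |a b. a \<in> keys (r j) \<and> b \<in> mono_prod J (\<lambda>j. keys (r j))}"
    using keys_mult[of "r j" "\<Prod>j\<in>J. r j"] insert.IH by blast
  then show ?case using insert.hyps by (simp add: mono_prod_insert)
qed (simp add: mono_prod_empty)

lemma mono_prod_mono: "(\<And>j. j \<in> J \<Longrightarrow> A j \<subseteq> A' j) \<Longrightarrow> mono_prod J A \<subseteq> mono_prod J A'"
  unfolding mono_prod_def by blast

section \<open>The kernel of the multiplication map\<close>

text \<open>
  The entries of \<open>r\<close> are expanded into monomials one index after the other, modulo the
  multilinear relations.
\<close>

lemma free_tensors_spanned:
  fixes U :: "'s::finite \<Rightarrow> 'v monom set"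
  assumes r: "\<And>j. r j \<in> (pm.span (monomial ` U j) :: ('v, 'k::comm_ring_1) mpoly set)"
  defines "V \<equiv> \<lambda>j. (pm.span (monomial ` U j) :: ('v, 'k) mpoly set)"
  shows "single r 1 \<in>
    pm.span (multilinear_rels V \<union> {single (\<lambda>j. monomial (m j)) 1 | m. \<forall>j. m j \<in> U j})"
proof -
  let ?E = "{single (\<lambda>j. monomial (m j)) 1 | m. \<forall>j. m j \<in> U j} :: (('s \<Rightarrow> ('v, 'k) mpoly) \<Rightarrow>\<^sub>0 'k) set"
  let ?W = "pm.span (multilinear_rels V \<union> ?E)"
  have Vj: "V j = pm.span (monomial ` U j)" for j by (simp add: V_def)
  have rel: "x \<in> ?W" if "x \<in> multilinear_rels V" for x using that by (intro pm.span_base) simp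
  have "single r 1 \<in> ?W"
    if "finite J" "\<And>j. r j \<in> V j" "\<And>j. j \<notin> J \<Longrightarrow> r j \<in> monomial ` U j" for J and r :: "'s \<Rightarrow> ('v, 'k) mpoly"
    using that
  proof (induction J arbitrary: r rule: finite_induct)
    case empty
    have "\<forall>j. \<exists>u. u \<in> U j \<and> r j = monomial u" using empty.prems(2) by blast
    then obtain m where m: "\<forall>j. m j \<in> U j \<and> r j = monomial (m j)" by (rule choice[THEN exE])
    then have "r = (\<lambda>j. monomial (m j))" by auto
    then have "single r 1 \<in> ?E" using m by blast
    then show ?case by (intro pm.span_base) simp
  next
    case (insert j J)
    have "a \<in> V j \<and> single (r(j := a)) 1 \<in> ?W" if "a \<in> pm.span (monomial ` U j)" for a
      using that
    proof (induction rule: pm.span_induct_alt)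
      case base
      have 0: "(0 :: ('v, 'k) mpoly) \<in> V j" unfolding Vj by (rule pm.span_zero)
      have "single (r(j := smul 0 0)) 1 - single (r(j := 0)) 0 \<in> multilinear_rels V"
        by (rule multilinear_rels_scaleI[where V = V and j = j, OF insert.prems(1) 0])
      then have "single (r(j := 0)) 1 \<in> ?W" using rel by simp
      then show ?case using 0 by blast
    next
      case (step c x y)
      have x: "x \<in> V j" unfolding Vj using step.hyps(1) by (rule pm.span_base)
      have y: "y \<in> V j" using step.IH by blast
      have cx: "smul c x \<in> V j" using x unfolding Vj by (rule pm.span_scale)
      have "single (r(j := x)) 1 \<in> ?W"
        by (rule insert.IH) (use insert.prems x step.hyps(1) in auto)
      then have 1: "single (r(j := x)) c \<in> ?W"
        using pm.span_scale[of "single (r(j := x)) 1" _ c] by simp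
      have 2: "single (r(j := smul c x)) 1 - single (r(j := x)) c \<in> ?W"
        by (rule rel[OF multilinear_rels_scaleI[where V = V and j = j, OF insert.prems(1) x]])
      have 3: "single (r(j := smul c x + y)) 1 - single (r(j := smul c x)) 1
          - single (r(j := y)) 1 \<in> ?W"
        by (rule rel[OF multilinear_rels_addI[where V = V and j = j, OF insert.prems(1) cx y]])
      have 4: "single (r(j := y)) 1 \<in> ?W" using step.IH by blast
      have "single (r(j := smul c x + y)) 1 \<in> ?W"
        using pm.span_add[OF pm.span_add[OF 3 4] pm.span_add[OF 2 1]] by simp
      moreover have "smul c x + y \<in> V j" using cx y unfolding Vj by (rule pm.span_add)
      ultimately show ?case by blast
    qed
    from this[OF insert.prems(1)[of j, unfolded Vj]] show ?case by simp
  qed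
  from this[of UNIV r] show ?thesis using r by (simp add: Vj)
qed

definition mono_tensor :: "nat \<Rightarrow> ('s \<Rightarrow> 'v monom) \<Rightarrow> ('s, 'v monom, 'k::comm_ring_1) tensors" where
  "mono_tensor i m = single i (single (\<lambda>j. monomial (m j)) 1)"

lemma mono_tensor_times:
  "segre_times (mono_tensor i m) (mono_tensor k r) = mono_tensor (i + k) (\<lambda>j. m j + r j)"
  by (simp add: mono_tensor_def conv_single[OF biadditive_tensor_mult] tensor_mult_single monomial_mult)

lemma mult_segre_mono_tensor: "mult_segre (mono_tensor i m) = monomial (\<Sum>j\<in>UNIV. m j)"
  by (simp add: mono_tensor_def mult_segre_single mult_tensor_single monomial_prod)

lemma mono_tensor_carrier:
  assumes "\<And>j. m j \<in> mono_power i (Bs j)"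
  shows "(mono_tensor i m :: ('s::finite, 'v monom, 'k::comm_ring_1) tensors) \<in> carrier (segre_free (mono_comps Bs))"
proof -
  have "(monomial (m j) :: ('v, 'k) mpoly) \<in> mono_alg_comp (Bs j) i" for j
    unfolding mono_alg_comp_eq monomial_def using assms[of j] by simp
  then show ?thesis
    by (simp add: mono_tensor_def lookup_single when_def free_tensors_closed free_tensors_single)
qed

lemma segre_free_spanned:
  fixes P :: "('s::finite, 'v monom, 'k::comm_ring_1) tensors"
  assumes "P \<in> carrier (segre_free (mono_comps Bs))"
  shows "P \<in> ts.span (segre_null (mono_comps Bs) \<union>
    {mono_tensor i m | i m. \<forall>j. m j \<in> mono_power i (Bs j)})" (is "_ \<in> ?W")
proof -
  have gen: "single i x \<in> ?W"
    if "x \<in> pm.span (multilinear_rels (\<lambda>j. mono_alg_comp (Bs j) i) \<union>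
      {single (\<lambda>j. monomial (m j)) 1 | m. \<forall>j. m j \<in> mono_power i (Bs j)})"
    for i and x :: "('s \<Rightarrow> ('v, 'k) mpoly) \<Rightarrow>\<^sub>0 'k"
    using that
  proof (induction rule: pm.span_induct_alt)
    case base
    show ?case by (simp add: ts.span_zero)
  next
    case (step c x y)
    have "single i x \<in> ?W"
      using step.hyps(1)
    proof
      assume "x \<in> multilinear_rels (\<lambda>j. mono_alg_comp (Bs j) i)"
      then have "single i x \<in> segre_null (mono_comps Bs)"
        by (auto simp: segre_null_def null_tensors_def lookup_single when_def pm.span_zero intro: pm.span_base)
      then show ?thesis by (intro ts.span_base) simp
    next
      assume "x \<in> {single (\<lambda>j. monomial (m j)) 1 | m. \<forall>j. m j \<in> mono_power i (Bs j)}"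
      then have "single i x \<in> {mono_tensor i m | i m. \<forall>j. m j \<in> mono_power i (Bs j)}"
        unfolding mono_tensor_def by blast
      then show ?thesis by (intro ts.span_base) simp
    qed
    then have "tsmul c (single i x) + single i y \<in> ?W"
      by (intro ts.span_add ts.span_scale step.IH)
    then show ?case by (simp add: single_add)
  qed
  have pure: "single i (single r c) \<in> ?W"
    if "\<And>j. r j \<in> mono_alg_comp (Bs j) i" for i and r :: "'s \<Rightarrow> ('v, 'k) mpoly" and c
  proof -
    have "single i (single r 1) \<in> ?W"
      using free_tensors_spanned[of r "\<lambda>j. mono_power i (Bs j)"] that
      unfolding mono_alg_comp_def[symmetric] by (intro gen) simp
    from ts.span_scale[OF this, of c] show ?thesis by simp
  qed
  have comp: "single i p \<in> ?W" if p: "p \<in> free_tensors (\<lambda>j. mono_alg_comp (Bs j) i)"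
    for i and p :: "('s \<Rightarrow> ('v, 'k) mpoly) \<Rightarrow>\<^sub>0 'k"
  proof -
    have "single i (\<Sum>r\<in>A. single r (c r)) \<in> ?W"
      if "finite A" "A \<subseteq> keys p" for A c
      using that
    proof (induction A rule: finite_induct)
      case (insert r A)
      have "single i (single r (c r)) \<in> ?W"
        using insert.prems p by (intro pure) (simp add: free_tensors_def)
      then show ?case using insert by (simp add: single_add ts.span_add)
    qed (simp add: ts.span_zero)
    then show ?thesis by (subst poly_mapping_eq_sum_singles) simp
  qed
  have "(\<Sum>i\<in>A. single i (lookup P i)) \<in> ?W" for A
    using assms by (intro ts.span_sum comp) simp
  then show ?thesis by (subst poly_mapping_eq_sum_singles) simp
qed

lemma monomial_inject: "monomial f = (monomial g :: ('v, 'k::comm_ring_1) mpoly) \<Longrightarrow> f = g"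
  unfolding monomial_def by (metis lookup_single_eq lookup_single_not_eq zero_neq_one)

lemma segre_times_tsmul: "segre_times (tsmul c P) Q = tsmul c (segre_times P Q)"
proof (induction P rule: poly_mapping_additive_induct)
  case (single i p)
  show ?case
    by (induction Q rule: poly_mapping_additive_induct)
      (simp_all add: conv_single[OF biadditive_tensor_mult] conv_add_right[OF biadditive_tensor_mult]
        tensor_mult_smul ts.scale_right_distrib)
qed (simp add: conv_add_left[OF biadditive_tensor_mult] ts.scale_right_distrib)

lemma mult_tensor_image:
  fixes Bs :: "'s::finite \<Rightarrow> 'v monom set"
  shows "mult_tensor ` free_tensors (\<lambda>j. mono_alg_comp (Bs j) i) =
    (mono_alg_comp (mono_prod UNIV Bs) i :: ('v, 'k::comm_ring_1) mpoly set)"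
proof (intro equalityI subsetI)
  fix q :: "('v, 'k) mpoly" assume "q \<in> mult_tensor ` free_tensors (\<lambda>j. mono_alg_comp (Bs j) i)"
  then obtain p where p: "q = mult_tensor p" "p \<in> free_tensors (\<lambda>j. mono_alg_comp (Bs j) i)" by blast
  have "(\<Prod>j\<in>UNIV. r j) \<in> mono_alg_comp (mono_prod UNIV Bs) i"
    if r: "\<And>j. r j \<in> mono_alg_comp (Bs j) i" for r :: "'s \<Rightarrow> ('v, 'k) mpoly"
  proof -
    have "mono_prod UNIV (\<lambda>j. keys (r j)) \<subseteq> mono_prod UNIV (\<lambda>j. mono_power i (Bs j))"
      using r unfolding mono_alg_comp_eq by (intro mono_prod_mono) blast
    also have "\<dots> \<subseteq> mono_power i (mono_prod UNIV Bs)"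
    proof
      fix u assume "u \<in> mono_prod UNIV (\<lambda>j. mono_power i (Bs j))"
      then obtain b where "u = (\<Sum>j\<in>UNIV. b j)" "\<forall>j. b j \<in> mono_power i (Bs j)"
        unfolding mono_prod_def[of UNIV] by blast
      then show "u \<in> mono_power i (mono_prod UNIV Bs)"
        unfolding mono_prod_power_mono_prod by blast
    qed
    finally have "keys (\<Prod>j\<in>UNIV. r j) \<subseteq> mono_power i (mono_prod UNIV Bs)"
      by (rule subset_trans[OF keys_prod[OF finite]])
    then show ?thesis unfolding mono_alg_comp_eq by (rule CollectI)
  qed
  then show "q \<in> mono_alg_comp (mono_prod UNIV Bs) i"
    using p(2) unfolding p(1) mult_tensor_def lin_ext_def mono_alg_comp_def free_tensors_def
    by (intro pm.span_sum pm.span_scale) blast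
next
  fix q :: "('v, 'k) mpoly" assume "q \<in> mono_alg_comp (mono_prod UNIV Bs) i"
  then show "q \<in> mult_tensor ` free_tensors (\<lambda>j. mono_alg_comp (Bs j) i)"
    unfolding mono_alg_comp_def[of "mono_prod UNIV Bs"]
  proof (induction rule: pm.span_induct_alt)
    case base
    show ?case by (rule image_eqI[of _ _ 0]) (simp_all add: mult_tensor_def free_tensors_closed)
  next
    case (step c x y)
    obtain T where T: "y = mult_tensor T" "T \<in> free_tensors (\<lambda>j. mono_alg_comp (Bs j) i)"
      using step.IH by blast
    obtain u where u: "x = monomial u" "u \<in> mono_power i (mono_prod UNIV Bs)" using step.hyps(1) by blast
    obtain m where m: "\<And>j. m j \<in> mono_power i (Bs j)" "u = (\<Sum>j\<in>UNIV. m j)"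
      using u(2) unfolding mono_prod_power_mono_prod by blast
    let ?T = "smul c (single (\<lambda>j. monomial (m j)) 1) + T"
    have "?T \<in> free_tensors (\<lambda>j. mono_alg_comp (Bs j) i)"
      using m(1) by (intro free_tensors_closed free_tensors_single T(2)) (simp add: mono_alg_comp_eq monomial_def)
    moreover have "mult_tensor ?T = smul c x + y"
      unfolding mult_tensor_add mult_tensor_smul mult_tensor_single by (simp add: T(1) u(1) m(2) monomial_prod)
    ultimately show ?case by (metis imageI)
  qed
qed

lemma mult_segre_image_comp:
  fixes Bs :: "'s::finite \<Rightarrow> 'v monom set"
  shows "mult_segre ` {P \<in> carrier (segre_free (mono_comps Bs)). keys P \<subseteq> {i}} =
    (mono_alg_comp (mono_prod UNIV Bs) i :: ('v, 'k::comm_ring_1) mpoly set)"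
proof -
  have "{P \<in> carrier (segre_free (mono_comps Bs)). keys P \<subseteq> {i}} =
      (single i ` free_tensors (\<lambda>j. mono_alg_comp (Bs j) i) :: ('s, 'v monom, 'k) tensors set)"
  proof (intro equalityI subsetI)
    fix P :: "('s, 'v monom, 'k) tensors"
    assume "P \<in> {P \<in> carrier (segre_free (mono_comps Bs)). keys P \<subseteq> {i}}"
    then have P: "lookup P i \<in> free_tensors (\<lambda>j. mono_alg_comp (Bs j) i)" "keys P \<subseteq> {i}" by simp_all
    have "P = single i (lookup P i)"
    proof (rule poly_mapping_eqI)
      fix k
      have "lookup P k = 0" if "k \<noteq> i"
        using P(2) that unfolding not_in_keys_iff_lookup_eq_zero[symmetric] by blast
      then show "lookup P k = lookup (single i (lookup P i)) k"
        by (cases "k = i") (simp_all add: lookup_single)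
    qed
    then show "P \<in> single i ` free_tensors (\<lambda>j. mono_alg_comp (Bs j) i)" using P(1) by blast
  next
    fix P :: "('s, 'v monom, 'k) tensors"
    assume "P \<in> single i ` free_tensors (\<lambda>j. mono_alg_comp (Bs j) i)"
    then show "P \<in> {P \<in> carrier (segre_free (mono_comps Bs)). keys P \<subseteq> {i}}"
      by (auto simp: lookup_single when_def free_tensors_closed split: if_splits)
  qed
  then show ?thesis by (simp add: image_image mult_segre_single mult_tensor_image)
qed

lemma mult_segre_image:
  fixes Bs :: "'s::finite \<Rightarrow> 'v monom set"
  shows "mult_segre ` carrier (segre_free (mono_comps Bs)) =
    carrier (mono_alg (mono_prod UNIV Bs) :: ('k::comm_ring_1, ('v, 'k) mpoly) module)" (is "?f ` ?C = ?S")
proof (intro equalityI subsetI)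
  interpret G: graded_subalgebras "mono_comps Bs :: 's \<Rightarrow> nat \<Rightarrow> ('v, 'k) mpoly set"
    by (rule graded_subalgebras_mono_comps)
  interpret M: cring "mono_alg (mono_prod UNIV Bs) :: ('k, ('v, 'k) mpoly) module" by (rule cring_mono_alg)
  have comp: "mono_alg_comp (mono_prod UNIV Bs) i \<subseteq> ?S" for i
    unfolding mono_alg_comp_eq carrier_mono_alg by blast
  {
    fix q assume "q \<in> ?f ` ?C"
    then obtain P where P: "q = mult_segre P" "P \<in> ?C" by blast
    have "mult_tensor (lookup P i) \<in> ?S" for i
    proof -
      have "lookup P i \<in> free_tensors (\<lambda>j. mono_alg_comp (Bs j) i)" using P(2) by simp
      then have "mult_tensor (lookup P i) \<in> mono_alg_comp (mono_prod UNIV Bs) i"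
        unfolding mult_tensor_image[symmetric] by (rule imageI)
      then show ?thesis using comp by blast
    qed
    then have "(\<Sum>i\<in>A. mult_tensor (lookup P i)) \<in> ?S" for A
      using M.zero_closed M.a_closed by (induction A rule: infinite_finite_induct) simp_all
    then show "q \<in> ?S" unfolding P(1) mult_segre_def lin_ext_def .
  next
    fix q :: "('v, 'k) mpoly" assume q: "q \<in> ?S"
    have add: "x + y \<in> ?f ` ?C" if "x \<in> ?f ` ?C" "y \<in> ?f ` ?C" for x y
    proof -
      obtain P Q where PQ: "x = mult_segre P" "P \<in> ?C" "y = mult_segre Q" "Q \<in> ?C" using \<open>x \<in> _\<close> \<open>y \<in> _\<close> by blast
      have "x + y = mult_segre (P + Q)" by (simp add: PQ mult_segre_add)
      then show ?thesis using G.carrier_closed(2)[OF PQ(2,4)] by blast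
    qed
    have zero: "0 \<in> ?f ` ?C"
      by (rule image_eqI[of _ _ 0]) (simp add: mult_segre_def, rule G.carrier_closed(1))
    have sing: "single u c \<in> ?f ` ?C" if u: "u \<in> keys q" for u c
    proof -
      obtain i where "u \<in> mono_power i (mono_prod UNIV Bs)" using q u unfolding carrier_mono_alg by blast
      then have "single u c \<in> mono_alg_comp (mono_prod UNIV Bs) i" by (simp add: mono_alg_comp_eq)
      then show ?thesis unfolding mult_segre_image_comp[symmetric] by blast
    qed
    have "(\<Sum>u\<in>A. single u (c u)) \<in> ?f ` ?C" if "finite A" "A \<subseteq> keys q" for A c
      using that by (induction A rule: finite_induct) (simp_all add: zero add sing del: segre_free_simps)
    then show "q \<in> ?f ` ?C" by (subst poly_mapping_eq_sum_singles) simp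
  }
qed

section \<open>The presentation as a quotient of a Segre product\<close>

text \<open>
  A degree one move multiplies the difference of two tensors of degree one, which lies in \<open>L\<close>, by a
  tensor of degree \<open>i - 1\<close>, and \<open>tuples_connected\<close> composes such moves. In degree zero there is only
  one tuple.
\<close>

lemma mono_tensors_congruent:
  fixes Bs :: "'s::finite \<Rightarrow> 'n::finite monom set" and L :: "('s, 'n monom, 'k::comm_ring_1) tensors set"
  assumes SEP: "\<And>j. SEP_basis (Bs j)"
    and zero: "0 \<in> L" and add: "\<And>x y. x \<in> L \<Longrightarrow> y \<in> L \<Longrightarrow> x + y \<in> L"
    and times: "\<And>x y. x \<in> L \<Longrightarrow> y \<in> carrier (segre_free (mono_comps Bs)) \<Longrightarrow> segre_times x y \<in> L"
    and degree_one: "\<And>f g. (\<And>j. f j \<in> Bs j) \<Longrightarrow> (\<And>j. g j \<in> Bs j) \<Longrightarrow>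
      (\<Sum>j\<in>UNIV. f j) = (\<Sum>j\<in>UNIV. g j) \<Longrightarrow> mono_tensor 1 f - mono_tensor 1 g \<in> L"
    and m: "\<And>j. m j \<in> mono_power i (Bs j)" and m': "\<And>j. m' j \<in> mono_power i (Bs j)"
    and eq: "(\<Sum>j\<in>UNIV. m j) = (\<Sum>j\<in>UNIV. m' j)"
  shows "mono_tensor i m - mono_tensor i m' \<in> L"
proof (cases i)
  case 0
  have "m j = m' j" for j using m[of j] m'[of j] unfolding 0 by (simp add: mono_prod_empty)
  then have "m = m'" by auto
  then show ?thesis using zero by simp
next
  case (Suc k)
  have "mono_tensor (Suc k) m - mono_tensor (Suc k) m' \<in> L"
  proof (rule tuples_connected[where R = "\<lambda>m m'. mono_tensor (Suc k) m - mono_tensor (Suc k) m' \<in> L"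
        and Bs = Bs and k = k])
    fix m1 m2 m3 :: "'s \<Rightarrow> 'n monom"
    show "mono_tensor (Suc k) m1 - mono_tensor (Suc k) m1 \<in> L" using zero by simp
    assume "mono_tensor (Suc k) m1 - mono_tensor (Suc k) m2 \<in> L" "mono_tensor (Suc k) m2 - mono_tensor (Suc k) m3 \<in> L"
    from add[OF this] show "mono_tensor (Suc k) m1 - mono_tensor (Suc k) m3 \<in> L" by simp
  next
    fix f g r :: "'s \<Rightarrow> 'n monom"
    assume fg: "\<And>j. f j \<in> Bs j" "\<And>j. g j \<in> Bs j" and r: "\<And>j. r j \<in> mono_power k (Bs j)"
      and sum: "(\<Sum>j\<in>UNIV. f j) = (\<Sum>j\<in>UNIV. g j)"
    have t: "segre_times (mono_tensor 1 h) (mono_tensor k r) = mono_tensor (Suc k) (\<lambda>j. h j + r j)" for h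
      unfolding mono_tensor_times plus_1_eq_Suc ..
    have "segre_times (mono_tensor 1 f - mono_tensor 1 g) (mono_tensor k r) \<in> L"
      by (rule times[OF degree_one[OF fg sum] mono_tensor_carrier[OF r]])
    moreover have "(segre_times (mono_tensor 1 f - mono_tensor 1 g) (mono_tensor k r) :: ('s, 'n monom, 'k) tensors) =
        mono_tensor (Suc k) (\<lambda>j. f j + r j) - mono_tensor (Suc k) (\<lambda>j. g j + r j)"
      using conv_add_left[OF biadditive_tensor_mult, of plus
          "mono_tensor 1 f - mono_tensor 1 g :: ('s, 'n monom, 'k) tensors" "mono_tensor 1 g" "mono_tensor k r"]
      unfolding t[symmetric] eq_diff_eq diff_add_cancel by (rule sym)
    ultimately show "mono_tensor (Suc k) (\<lambda>j. f j + r j) - mono_tensor (Suc k) (\<lambda>j. g j + r j) \<in> L" by simp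
  qed (use SEP m m' eq Suc in simp_all)
  then show ?thesis using Suc by simp
qed

text \<open>
  The multiplication map from the Segre product to \<open>K[B]\<close> is onto in each degree. Its kernel contains the
  binomials \<open>f\<^sub>1 \<otimes> ... \<otimes> f\<^sub>s - g\<^sub>1 \<otimes> ... \<otimes> g\<^sub>s\<close> of degree one with
  \<open>f\<^sub>1 ... f\<^sub>s = g\<^sub>1 ... g\<^sub>s\<close>, which form the set \<open>D\<close>, and the ideal \<open>L\<close> generated by \<open>D\<close> is all of it. The
  latter is shown for the preimage \<open>L'\<close> of \<open>L\<close> in the direct sum of the spaces of free tensors, where
  \<open>kernel_of_map_to_monomials\<close> applies to the null tensors together with the monomial tensors. That the
  elements of \<open>B\<close> have positive degree ensures that tensors of different degrees have different
  images.
\<close>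

proposition segre_presentation:
  fixes Bs :: "'s::finite \<Rightarrow> 'n::finite monom set" and B :: "'n monom set"
  assumes SEP: "\<And>j. SEP_basis (Bs j)" and B: "B = mono_prod UNIV Bs"
    and deg: "\<And>f. f \<in> B \<Longrightarrow> mono_deg f = d" and d: "d > 0"
  shows "\<exists>D \<subseteq> (degree_one_binomials Bs :: ('s, 'n monom, 'k::comm_ring_1) tensors set set).
        \<exists>L h. L = genideal (segre (mono_comps Bs)) D \<and>
          graded_alg_iso
            (quot_alg (segre (mono_comps Bs)) L)
            (quot_comp (segre (mono_comps Bs)) L (segre_comp (mono_comps Bs)))
            (mono_alg B) (mono_alg_comp B) h"
proof -
  let ?R = "mono_comps Bs :: 's \<Rightarrow> nat \<Rightarrow> ('n, 'k) mpoly set"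
  let ?F = "segre_free ?R" and ?N = "segre_null ?R" and ?S = "segre ?R"
  interpret G: graded_subalgebras ?R by (rule graded_subalgebras_mono_comps)
  interpret F: cring "?F" by (rule G.cring_SF)
  interpret S: cring "?S" by (rule G.cring_segre)
  interpret M: cring "mono_alg B :: ('k, ('n, 'k) mpoly) module" by (rule cring_mono_alg)
  let ?q = G.cls
  interpret q: ring_hom_ring "?F" "?S" ?q
    by (rule ring_hom_ringI2[OF F.ring_axioms S.ring_axioms G.cls_hom])
  define D where "D = {?q (mono_tensor 1 f) \<ominus>\<^bsub>?S\<^esub> ?q (mono_tensor 1 g) | f g.
      (\<forall>j. f j \<in> Bs j \<and> g j \<in> Bs j) \<and> (\<Sum>j\<in>UNIV. f j) = (\<Sum>j\<in>UNIV. g j)}"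
  have D_sub: "D \<subseteq> degree_one_binomials Bs"
    unfolding D_def degree_one_binomials_def pure_tensor_def mono_tensor_def by blast
  have one: "b \<in> mono_power 1 (Bs j)" if "b \<in> Bs j" for b j
    unfolding mono_prod_power by (rule exI[of _ "{#b#}"]) (use that in simp)
  have mt1: "(mono_tensor 1 f :: ('s, 'n monom, 'k) tensors) \<in> carrier ?F" if "\<And>j. f j \<in> Bs j" for f
    by (rule mono_tensor_carrier) (use one that in blast)
  have q_diff: "?q P \<ominus>\<^bsub>?S\<^esub> ?q Q = ?q (P - Q)" if "P \<in> carrier ?F" "Q \<in> carrier ?F" for P Q
  proof -
    have "?q (P - Q) = ?q (P \<ominus>\<^bsub>?F\<^esub> Q)" using G.SF_minus(2)[OF that] by simp
    also have "\<dots> = ?q P \<ominus>\<^bsub>?S\<^esub> ?q Q"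
      unfolding a_minus_def using that by (simp only: q.hom_add q.hom_a_inv F.a_inv_closed)
    finally show ?thesis by simp
  qed
  define L where "L = genideal (?S) D"
  have D_carrier: "D \<subseteq> carrier (?S)"
    unfolding D_def using mt1 q.hom_closed by (auto intro!: S.minus_closed)
  have L: "ideal L (?S)" unfolding L_def by (rule S.genideal_ideal[OF D_carrier])
  interpret L: ideal L "?S" by (rule L)
  have D_L: "D \<subseteq> L" unfolding L_def by (rule S.genideal_self[OF D_carrier])

  define L' where "L' = {P \<in> carrier ?F. ?q P \<in> L}"
  interpret L': ideal L' "?F" unfolding L'_def by (rule q.ideal_vimage[OF L])
  have L'_zero: "0 \<in> L'" using L'.zero_closed by simp
  have L'_add: "x + y \<in> L'" if "x \<in> L'" "y \<in> L'" for x y using L'.a_closed[OF that] by simp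
  have L'_times: "segre_times x y \<in> L'" if "x \<in> L'" "y \<in> carrier ?F" for x y
    using L'.I_r_closed[OF that] by simp
  \<comment> \<open>A scalar multiple of \<open>x\<close> is the product of \<open>x\<close> with a scalar multiple of \<open>1\<close>.\<close>
  have L'_smul: "tsmul c x \<in> L'" if "x \<in> L'" for c x
  proof -
    let ?u = "tsmul c (\<one>\<^bsub>?F\<^esub>)"
    have u: "?u \<in> carrier ?F" by (rule G.carrier_closed(3)[OF F.one_closed])
    have "segre_times x ?u = tsmul c x"
    proof -
      have "segre_times x ?u = segre_times ?u x"
        by (rule conv_commute[OF biadditive_tensor_mult]) (simp_all add: add.commute tensor_mult_commute)
      also have "\<dots> = tsmul c (segre_times (\<one>\<^bsub>?F\<^esub>) x)"
        by (rule segre_times_tsmul)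
      also have "segre_times (\<one>\<^bsub>?F\<^esub>) x = x"
        by (simp add: conv_one[OF biadditive_tensor_mult _ tensor_mult_one])
      finally show ?thesis .
    qed
    then show ?thesis using L'_times[OF that u] by simp
  qed
  have N_L': "?N \<subseteq> L'"
  proof
    fix P assume P: "P \<in> ?N"
    then have "P \<in> carrier ?F" using G.SN_subset by blast
    moreover have "?q P = ?q 0"
    proof -
      have "Z - P \<in> ?N \<longleftrightarrow> Z - 0 \<in> ?N" for Z
        using G.SN_closed(2)[OF _ P, of "Z - P"] G.SN_closed(2)[OF _ G.SN_closed(4)[OF P], of Z] by auto
      then show ?thesis by (auto simp: G.cls_eq_iff_mem)
    qed
    ultimately show "P \<in> L'" using L'_zero unfolding L'_def by simp
  qed
  have L'_degree_one: "mono_tensor 1 f - mono_tensor 1 g \<in> L'"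
    if fg: "\<And>j. f j \<in> Bs j" "\<And>j. g j \<in> Bs j" and sum: "(\<Sum>j\<in>UNIV. f j) = (\<Sum>j\<in>UNIV. g j)" for f g
  proof -
    have "?q (mono_tensor 1 f) \<ominus>\<^bsub>?S\<^esub> ?q (mono_tensor 1 g) \<in> D"
      unfolding D_def using fg sum by blast
    then have "?q (mono_tensor 1 f - mono_tensor 1 g) \<in> L"
      using D_L q_diff[OF mt1[OF fg(1)] mt1[OF fg(2)]] by auto
    moreover have "(mono_tensor 1 f - mono_tensor 1 g :: ('s, 'n monom, 'k) tensors) \<in> carrier ?F"
      using F.minus_closed[OF mt1[OF fg(1)] mt1[OF fg(2)]] G.SF_minus(2)[OF mt1[OF fg(1)] mt1[OF fg(2)]] by simp
    ultimately show ?thesis unfolding L'_def by simp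
  qed
  let ?E = "{mono_tensor i m | i m. \<forall>j. m j \<in> mono_power i (Bs j)} :: ('s, 'n monom, 'k) tensors set"
  have kernel: "P \<in> L'" if P: "P \<in> carrier ?F" and zero: "mult_segre P = 0" for P
  proof (rule kernel_of_map_to_monomials[where \<Phi> = mult_segre and sc = tsmul and E = "?N \<union> ?E"])
    show "Modules.module (tsmul :: 'k \<Rightarrow> ('s, 'n monom, 'k) tensors \<Rightarrow> _)" by (rule ts.module_axioms)
    show "ts.subspace L'" by (rule ts.subspaceI) (rule L'_zero, rule L'_add, assumption+, rule L'_smul)
    show "P \<in> ts.span (?N \<union> ?E)" by (rule segre_free_spanned[OF P])
    show "mult_segre P = 0" by (rule zero)
    show "mult_segre (x + y) = mult_segre x + mult_segre y" for x y :: "('s, 'n monom, 'k) tensors"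
      by (rule mult_segre_add)
    show "mult_segre (tsmul c x) = smul c (mult_segre x)" for c and x :: "('s, 'n monom, 'k) tensors"
      by (rule mult_segre_tsmul)
    show "(mult_segre a = 0 \<and> a \<in> L') \<or> (\<exists>v. mult_segre a = monomial v)" if "a \<in> ?N \<union> ?E" for a
      using that N_L' G.mult_segre_null[of a] mult_segre_mono_tensor by blast
    fix a b v
    assume a: "a \<in> ?N \<union> ?E" and b: "b \<in> ?N \<union> ?E"
      and v: "mult_segre a = monomial v" "mult_segre b = monomial v"
    have mon0: "(monomial v :: ('n, 'k) mpoly) \<noteq> 0" for v
      by (metis lookup_single_eq lookup_zero monomial_def zero_neq_one)
    have "a \<notin> ?N" "b \<notin> ?N" using v G.mult_segre_null mon0 by auto
    then obtain i m k m' where a: "a = mono_tensor i m" "\<And>j. m j \<in> mono_power i (Bs j)"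
      and b: "b = mono_tensor k m'" "\<And>j. m' j \<in> mono_power k (Bs j)"
      using a b by blast
    have "monomial (\<Sum>j\<in>UNIV. m j) = (monomial (\<Sum>j\<in>UNIV. m' j) :: ('n, 'k) mpoly)"
      using v unfolding a b mult_segre_mono_tensor by simp
    then have eq: "(\<Sum>j\<in>UNIV. m j) = (\<Sum>j\<in>UNIV. m' j)" by (rule monomial_inject)
    have deg_power: "mono_deg u = i * d" if u: "u \<in> mono_power i B" for u i
    proof -
      obtain X where X: "size X = i" "set_mset X \<subseteq> B" "u = sum_mset X" using u unfolding mono_prod_power by blast
      have "mono_deg (sum_mset X) = size X * d" using X(2) by (induction X) (auto simp: mono_deg_add deg)
      then show ?thesis using X by simp
    qed
    have "(\<Sum>j\<in>UNIV. m j) \<in> mono_power i B" "(\<Sum>j\<in>UNIV. m' j) \<in> mono_power k B"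
      unfolding B mono_prod_power_mono_prod using a(2) b(2) by blast+
    then have ik: "i = k" using deg_power[of _ i] deg_power[of _ k] eq d by (metis mult_cancel2 less_numeral_extra(3))
    show "a - b \<in> L'"
      unfolding a(1) b(1) ik[symmetric]
      by (rule mono_tensors_congruent[OF SEP L'_zero L'_add L'_times L'_degree_one a(2) b(2)[folded ik] eq])
  qed
  have carrier: "carrier (?S) = ?q ` carrier ?F" by (rule G.carrier_segre)
  have hom: "G.mult_class \<in> ring_hom (?S) (mono_alg B)"
  proof (rule ring_hom_memI)
    fix X assume "X \<in> carrier (?S)"
    then obtain P where P: "X = ?q P" "P \<in> carrier ?F" unfolding carrier by blast
    show "G.mult_class X \<in> carrier (mono_alg B)"
      unfolding P(1) G.mult_class_cls B mult_segre_image[symmetric] using P(2) by (rule imageI)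
    fix Y assume "Y \<in> carrier (?S)"
    then obtain Q where Q: "Y = ?q Q" "Q \<in> carrier ?F" unfolding carrier by blast
    show "G.mult_class (X \<otimes>\<^bsub>?S\<^esub> Y) = G.mult_class X \<otimes>\<^bsub>mono_alg B\<^esub> G.mult_class Y"
      unfolding P(1) Q(1) q.hom_mult[OF P(2) Q(2), symmetric] G.mult_class_cls by (simp add: mult_segre_times)
    show "G.mult_class (X \<oplus>\<^bsub>?S\<^esub> Y) = G.mult_class X \<oplus>\<^bsub>mono_alg B\<^esub> G.mult_class Y"
      unfolding P(1) Q(1) q.hom_add[OF P(2) Q(2), symmetric] G.mult_class_cls by (simp add: mult_segre_add)
  next
    show "G.mult_class \<one>\<^bsub>?S\<^esub> = \<one>\<^bsub>mono_alg B\<^esub>"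
      unfolding q.hom_one[symmetric] G.mult_class_cls by (simp add: mult_segre_single mult_tensor_single)
  qed
  have H: "ring_hom_ring (?S) (mono_alg B) G.mult_class"
    by (rule ring_hom_ringI2[OF S.ring_axioms M.ring_axioms hom])
  have ker: "a_kernel (?S) (mono_alg B) G.mult_class = L"
  proof
    show "a_kernel (?S) (mono_alg B) G.mult_class \<subseteq> L"
    proof
      fix X assume "X \<in> a_kernel (?S) (mono_alg B) G.mult_class"
      then have X: "X \<in> carrier (?S)" "G.mult_class X = 0" by (simp_all add: a_kernel_def')
      then obtain P where P: "X = ?q P" "P \<in> carrier ?F" unfolding carrier by blast
      have "P \<in> L'" using X(2) unfolding P(1) G.mult_class_cls by (rule kernel[OF P(2)])
      then show "X \<in> L" unfolding P(1) L'_def by simp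
    qed
    have "D \<subseteq> a_kernel (?S) (mono_alg B) G.mult_class"
    proof
      fix X assume X: "X \<in> D"
      then obtain f g where fg: "X = ?q (mono_tensor 1 f) \<ominus>\<^bsub>?S\<^esub> ?q (mono_tensor 1 g)"
          "\<And>j. f j \<in> Bs j" "\<And>j. g j \<in> Bs j" "(\<Sum>j\<in>UNIV. f j) = (\<Sum>j\<in>UNIV. g j)"
        unfolding D_def by blast
      have "X = ?q (mono_tensor 1 f - mono_tensor 1 g)"
        unfolding fg(1) by (rule q_diff[OF mt1[OF fg(2)] mt1[OF fg(3)]])
      then have "G.mult_class X = mult_segre (mono_tensor 1 f - mono_tensor 1 g)" by (simp only: G.mult_class_cls)
      also have "\<dots> = 0"
        using mult_segre_add[of "mono_tensor 1 f - mono_tensor 1 g" "mono_tensor 1 g"] fg(4)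
        by (simp add: mult_segre_mono_tensor)
      finally show "X \<in> a_kernel (?S) (mono_alg B) G.mult_class"
        using X D_carrier by (auto simp: a_kernel_def')
    qed
    then show "L \<subseteq> a_kernel (?S) (mono_alg B) G.mult_class"
      unfolding L_def by (rule S.genideal_minimal[OF ring_hom_ring.kernel_is_ideal[OF H]])
  qed
  have comps: "segre_comp ?R i = ?q ` {P \<in> carrier ?F. keys P \<subseteq> {i}}" for i
    unfolding segre_comp_def quot_comp_def ..
  have "graded_alg_iso (quot_alg (?S) L) (quot_comp (?S) L (segre_comp ?R))
      (mono_alg B) (mono_alg_comp B) (\<lambda>X. the_elem (G.mult_class ` X))"
  proof (rule graded_alg_iso_quot[OF S.is_cring M.is_cring hom _ ker])
    show "G.mult_class ` carrier (?S) = carrier (mono_alg B)"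
      unfolding carrier image_image G.mult_class_cls B mult_segre_image ..
    show "segre_comp ?R i \<subseteq> carrier (?S)" for i
      unfolding comps carrier by (rule image_mono) blast
    show "G.mult_class ` segre_comp ?R i = mono_alg_comp B i" for i
      unfolding comps image_image G.mult_class_cls B mult_segre_image_comp ..
    fix c X assume "X \<in> carrier (?S)"
    then obtain P where P: "X = ?q P" "P \<in> carrier ?F" unfolding carrier by blast
    show "c \<odot>\<^bsub>?S\<^esub> X \<in> carrier (?S) \<and>
        G.mult_class (c \<odot>\<^bsub>?S\<^esub> X) = c \<odot>\<^bsub>mono_alg B\<^esub> G.mult_class X"
      unfolding P(1) G.cls_smult[OF P(2)] G.mult_class_cls carrier
      using G.carrier_closed(3)[OF P(2), of c] by (simp add: mult_segre_tsmul del: segre_free_simps)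
  qed
  then show ?thesis using D_sub L_def by blast
qed

theorem theorem2p5:
  fixes Bs :: "'s::finite \<Rightarrow> 'n::finite monom set"
    and B :: "'n monom set"
  assumes "\<And>j. SEP_basis (Bs j)"
    and "B = mono_prod UNIV Bs"
    and "B \<noteq> {0}"
  shows
    "(toric_ideal B :: ('n monom, 'k::field) mpoly set) =
       genideal (poly_alg B) (sym_exchange_relations B) \<and>
     (\<exists>D \<subseteq> (degree_one_binomials Bs :: ('s, 'n monom, 'k) tensors set set).
        \<exists>L h. L = genideal (segre (mono_comps Bs)) D \<and>
          graded_alg_iso
            (quot_alg (segre (mono_comps Bs)) L)
            (quot_comp (segre (mono_comps Bs)) L (segre_comp (mono_comps Bs)))
            (mono_alg B) (mono_alg_comp B) h)"
proof -
  have "\<exists>d>0. \<forall>f\<in>B. mono_deg f = d"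
  proof (cases "B = {}")
    case False
    then obtain f where f: "f \<in> B" by blast
    have same: "mono_deg g = mono_deg f" if g: "g \<in> B" for g
    proof -
      obtain a b where a: "f = (\<Sum>j\<in>UNIV. a j)" "\<And>j. a j \<in> Bs j" and b: "g = (\<Sum>j\<in>UNIV. b j)" "\<And>j. b j \<in> Bs j"
        using f g unfolding assms(2) mono_prod_def by blast
      show ?thesis unfolding a(1) b(1) mono_deg_sum
        by (rule sum.cong[OF refl SEP_deg[OF assms(1) b(2) a(2)]])
    qed
    have "mono_deg f \<noteq> 0"
    proof
      assume 0: "mono_deg f = 0"
      have "g = 0" if "g \<in> B" for g using same[OF that] 0 by (simp add: mono_deg_0_iff)
      then have "B = {0}" using f by auto
      then show False using assms(3) by simp
    qed
    then show ?thesis using same by (intro exI[of _ "mono_deg f"]) simp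
    \<comment> \<open>An empty set has every degree.\<close>
  qed (auto intro: exI[of _ 1])
  then obtain d where d: "d > 0" "\<And>f. f \<in> B \<Longrightarrow> mono_deg f = d" by blast
  have "strongly_orderable B"
    unfolding assms(2) by (rule strongly_orderable_mono_prod) (simp_all add: SEP_strongly_orderable assms(1))
  from toric_ideal_generated[OF this d(2,1)] segre_presentation[OF assms(1,2) d(2,1)]
  show ?thesis by blast
qed

end
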